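(* Let $D$ be a shifted skew diagram with rows and columns indexed by $[n]=\{1,\dots,n\}$, and let $k$ be a field. Then $$\beta_{i,\alpha}(I(G^{\mathrm{nonbip}}_{[n]}(D)))=\beta^{sp}_{i,\alpha}(I(G^{\mathrm{bip}}_{[n],[n]}(D)))$$ for all $i$ and all $\alpha\in\mathbb Z^n$. Equivalently: (i) for all $i$ and all $X,Y\subseteq[n]$ one has $\beta_{i,X\sqcup Y}(I(G^{\mathrm{bip}}_{[n],[n]}(D)))=0$ unless $X\cap sp(Y)=\varnothing$; and (ii) for all $i$ and all $Z\subseteq[n]$, $$\beta_{i,Z}(I(G^{\mathrm{nonbip}}_{[n]}(D)))=\sum_{\substack{X,Y\subseteq[n]:\\ X\sqcup sp(Y)=Z}}\beta_{i,X\sqcup Y}(I(G^{\mathrm{bip}}_{[n],[n]}(D))).$$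
   Context: **Shifted skew diagrams.** Given integers $\lambda_1>\dots>\lambda_\ell>0$ and $\mu_1>\dots>\mu_r>0$ with $r\le \ell$ and $\mu_i<\lambda_i$ for $1\le i\le \ell$ (where $\mu_i:=0$ for $i>r$), the associated shifted skew diagram is $D=\{(i,j)\in\mathbb Z^2: 1\le i\le \ell,\ i+\mu_i+1\le j\le i+\lambda_i\}$; all its cells satisfy $i<j$. "Rows and columns indexed by $[n]$" means $D\subseteq[n]\times[n]$. **Ideals.** $I(G^{\mathrm{bip}}_{[n],[n]}(D))=(x_iy_j:(i,j)\in D)\subset k[x_1,\dots,x_n,y_1,\dots,y_n]$ and $I(G^{\mathrm{nonbip}}_{[n]}(D))=(x_ix_j:(i,j)\in D)\subset k[x_1,\dots,x_n]$. **Gradings.** $k[x_1,\dots,x_n,y_1,\dots,y_n]$ has its fine $\mathbb Z^{2n}$-grading and $k[x_1,\dots,x_n]$ its fine $\mathbb Z^n$-grading; multigraded Betti numbers are $\beta_{i,\alpha}(I)=\dim_k\mathrm{Tor}_i(I,k)_\alpha$. A subset of the variables indexes the multidegree given by its indicator vector; $X\sqcup Y$ with $X,Y\subseteq[n]$ denotes the set of variables $\{x_i:i\in X\}\cup\{y_j:j\in Y\}$. The specialization $sp$ sends $x_i\mapsto x_i$, $y_j\mapsto x_j$, so $sp(Y)$ is the index set $Y$ regarded as a set of $x$-indices ($X\sqcup sp(Y)=Z$ means $X\cap Y=\varnothing$ and $X\cup Y=Z$ as subsets of $[n]$). On gradings, $sp:\mathbb Z^{2n}\to\mathbb Z^n$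 sends both standard basis vectors $e_i$ and $e_{n+i}$ to $e_i$; $\beta^{sp}_{i,\alpha}$ denotes the Betti number of the bipartite ideal in degree $\alpha\in\mathbb Z^n$ for the $\mathbb Z^n$-grading on $k[x_1,\dots,x_n,y_1,\dots,y_n]$ with $\deg x_i=\deg y_i=e_i$, i.e. the sum of $\beta_{i,\gamma}$ over $\gamma\in\mathbb Z^{2n}$ with $sp(\gamma)=\alpha$. *)

theory Defs
  imports Complex_Main "HOL-Library.Poly_Mapping" "HOL-Library.Function_Algebras"
begin

text \<open>Polynomials in variables of type \<open>'v\<close> are finitely supported functions from exponent vectors
  to coefficients; the polynomial ring \<open>k[V]\<close> is a subset of this type.\<close>

type_synonym ('v, 'k) mpoly = "('v \<Rightarrow>\<^sub>0 nat) \<Rightarrow>\<^sub>0 'k"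

definition poly_ring :: "'v set \<Rightarrow> ('v, 'k::field) mpoly set" where
  "poly_ring V = {p. \<forall>m \<in> Poly_Mapping.keys p. Poly_Mapping.keys m \<subseteq> V}"

definition mvar :: "'v \<Rightarrow> ('v, 'k::field) mpoly" where
  "mvar v = Poly_Mapping.single (Poly_Mapping.single v 1) 1"

text \<open>The ideal of \<open>k[V]\<close> generated by a finite set \<open>G\<close>.\<close>

definition gen_ideal :: "'v set \<Rightarrow> ('v, 'k::field) mpoly set \<Rightarrow> ('v, 'k) mpoly set" where
  "gen_ideal V G = {(\<Sum>g\<in>G. q g * g) |q. \<forall>g\<in>G. q g \<in> poly_ring V}"


text \<open>A grading of the polynomial ring is given by the degrees \<open>deg v\<close> of the variables, integer
  vectors with coordinates indexed by \<open>'w\<close>. Zero is homogeneous of every degree.\<close>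

definition mon_degree :: "('v \<Rightarrow> 'w \<Rightarrow> int) \<Rightarrow> ('v \<Rightarrow>\<^sub>0 nat) \<Rightarrow> 'w \<Rightarrow> int" where
  "mon_degree deg m = (\<lambda>w. \<Sum>v\<in>Poly_Mapping.keys m. int (Poly_Mapping.lookup m v) * deg v w)"

definition homogeneous ::
    "('v \<Rightarrow> 'w \<Rightarrow> int) \<Rightarrow> ('w \<Rightarrow> int) \<Rightarrow> ('v, 'k::field) mpoly \<Rightarrow> bool" where
  "homogeneous deg \<gamma> p \<longleftrightarrow> (\<forall>m \<in> Poly_Mapping.keys p. mon_degree deg m = \<gamma>)"

definition fine_deg :: "'v \<Rightarrow> 'v \<Rightarrow> int" where
  "fine_deg v = (\<lambda>w. of_bool (w = v))"


text \<open>The free module of rank \<open>r\<close> over \<open>k[V]\<close> consists of the functions on \<open>nat\<close> with values in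
  \<open>k[V]\<close> that vanish outside \<open>{..<r}\<close>. The function \<open>mat_app r s M\<close> is the homomorphism from rank
  \<open>r\<close> to rank \<open>s\<close> whose matrix entry in row \<open>a\<close> and column \<open>b\<close> is \<open>M a b\<close>.\<close>

definition free_module :: "'v set \<Rightarrow> nat \<Rightarrow> (nat \<Rightarrow> ('v, 'k::field) mpoly) set" where
  "free_module V r = {f. (\<forall>b<r. f b \<in> poly_ring V) \<and> (\<forall>b\<ge>r. f b = 0)}"

definition mat_app ::
    "nat \<Rightarrow> nat \<Rightarrow> (nat \<Rightarrow> nat \<Rightarrow> 'a::comm_semiring_1) \<Rightarrow> (nat \<Rightarrow> 'a) \<Rightarrow> nat \<Rightarrow> 'a" where
  "mat_app r s M f = (\<lambda>a. if a < s then \<Sum>b<r. M a b * f b else 0)"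

text \<open>A complex \<open>\<dots> \<rightarrow> F\<^sub>1 \<rightarrow> F\<^sub>0 \<rightarrow> k[V]\<close>: the module \<open>F\<^sub>i\<close> has rank \<open>rk i\<close>, its \<open>b\<close>-th basis element
  has degree \<open>bdeg i b\<close>, \<open>dif i\<close> is the matrix of \<open>F\<^sub>i\<^sub>+\<^sub>1 \<rightarrow> F\<^sub>i\<close> (with the index of the target),
  and \<open>aug b\<close> is the image in \<open>k[V]\<close> of the \<open>b\<close>-th basis element of \<open>F\<^sub>0\<close>.\<close>

record (overloaded) ('v, 'w, 'k) free_complex =
  rk :: "nat \<Rightarrow> nat"
  bdeg :: "nat \<Rightarrow> nat \<Rightarrow> 'w \<Rightarrow> int"
  dif :: "nat \<Rightarrow> nat \<Rightarrow> nat \<Rightarrow> ('v, 'k) mpoly"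
  aug :: "nat \<Rightarrow> ('v, 'k) mpoly"

text \<open>\<open>F\<close> is a graded free resolution \<open>\<dots> \<rightarrow> F\<^sub>1 \<rightarrow> F\<^sub>0 \<rightarrow> I \<rightarrow> 0\<close> of the ideal \<open>I\<close> by free modules of
  finite rank (not necessarily minimal or of finite length); all maps have degree zero.\<close>

definition graded_free_resolution ::
    "'v set \<Rightarrow> ('v \<Rightarrow> 'w \<Rightarrow> int) \<Rightarrow> ('v, 'k::field) mpoly set \<Rightarrow>
     ('v, 'w, 'k) free_complex \<Rightarrow> bool" where
  "graded_free_resolution V deg I F \<longleftrightarrow>
     (\<forall>b < rk F 0. aug F b \<in> poly_ring V \<and> homogeneous deg (bdeg F 0 b) (aug F b)) \<and>
     (\<forall>i. \<forall>a < rk F i. \<forall>b < rk F (Suc i).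
        dif F i a b \<in> poly_ring V \<and>
        homogeneous deg (bdeg F (Suc i) b - bdeg F i a) (dif F i a b)) \<and>
     (\<lambda>f. \<Sum>b<rk F 0. aug F b * f b) ` free_module V (rk F 0) = I \<and>
     {f \<in> free_module V (rk F 0). (\<Sum>b<rk F 0. aug F b * f b) = 0} =
       mat_app (rk F 1) (rk F 0) (dif F 0) ` free_module V (rk F 1) \<and>
     (\<forall>i. {f \<in> free_module V (rk F (Suc i)).
             mat_app (rk F (Suc i)) (rk F i) (dif F i) f = 0} =
          mat_app (rk F (Suc (Suc i))) (rk F (Suc i)) (dif F (Suc i)) `
            free_module V (rk F (Suc (Suc i))))"


text \<open>The complex \<open>F \<otimes> k\<close>, where \<open>k\<close> is the quotient of \<open>k[V]\<close> by the ideal of all variables: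
  \<open>F\<^sub>i \<otimes> k\<close> has the basis of \<open>F\<^sub>i\<close> as a basis over \<open>k\<close>, and since a polynomial acts on \<open>k\<close> through
  its constant coefficient, the matrices of the differentials are those of the constant
  coefficients. Each piece below is the part of degree \<open>\<alpha>\<close>.\<close>

definition tensor_part ::
    "('v, 'w, 'k::field) free_complex \<Rightarrow> nat \<Rightarrow> ('w \<Rightarrow> int) \<Rightarrow> (nat \<Rightarrow> 'k) set" where
  "tensor_part F i \<alpha> = {x. \<forall>b. x b \<noteq> 0 \<longrightarrow> b < rk F i \<and> bdeg F i b = \<alpha>}"

definition tensor_dif ::
    "('v, 'w, 'k::field) free_complex \<Rightarrow> nat \<Rightarrow> (nat \<Rightarrow> 'k) \<Rightarrow> nat \<Rightarrow> 'k" where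
  "tensor_dif F i =
     mat_app (rk F (Suc i)) (rk F i) (\<lambda>a b. Poly_Mapping.lookup (dif F i a b) 0)"

definition tor_cycles ::
    "('v, 'w, 'k::field) free_complex \<Rightarrow> nat \<Rightarrow> ('w \<Rightarrow> int) \<Rightarrow> (nat \<Rightarrow> 'k) set" where
  "tor_cycles F i \<alpha> =
     {x \<in> tensor_part F i \<alpha>. case i of 0 \<Rightarrow> True | Suc j \<Rightarrow> tensor_dif F j x = 0}"

definition tor_boundaries ::
    "('v, 'w, 'k::field) free_complex \<Rightarrow> nat \<Rightarrow> ('w \<Rightarrow> int) \<Rightarrow> (nat \<Rightarrow> 'k) set" where
  "tor_boundaries F i \<alpha> = tensor_dif F i ` tensor_part F (Suc i) \<alpha>"

definition fscale :: "'k::field \<Rightarrow> (nat \<Rightarrow> 'k) \<Rightarrow> nat \<Rightarrow> 'k" where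
  "fscale c x = (\<lambda>b. c * x b)"

lemma vector_space_fscale: "vector_space (fscale :: 'k::field \<Rightarrow> _)"
  by unfold_locales (auto simp: fscale_def fun_eq_iff algebra_simps)

text \<open>\<open>betti V deg I i \<alpha>\<close> is the dimension over \<open>k\<close> of the degree \<open>\<alpha>\<close> part of \<open>Tor\<^sub>i(I, k)\<close>, the
  \<open>i\<close>-th homology of \<open>F \<otimes> k\<close> for a graded free resolution \<open>F\<close> of \<open>I\<close>. As cycles and boundaries are
  finite-dimensional, the dimension of the quotient is the difference of the dimensions. A
  resolution exists for every homogeneous ideal of \<open>k[V]\<close> when \<open>V\<close> is finite.\<close>

definition betti ::
    "'v set \<Rightarrow> ('v \<Rightarrow> 'w \<Rightarrow> int) \<Rightarrow> ('v, 'k::field) mpoly set \<Rightarrow> nat \<Rightarrow> ('w \<Rightarrow> int) \<Rightarrow> nat" where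
  "betti V deg I i \<alpha> =
     (let F = (SOME F. graded_free_resolution V deg I F)
      in vector_space.dim fscale (tor_cycles F i \<alpha>) -
         vector_space.dim fscale (tor_boundaries F i \<alpha>))"


text \<open>The sequences \<open>\<lambda>\<close> and \<open>\<mu>\<close> are \<open>lam 1, \<dots>, lam l\<close> and \<open>mu 1, \<dots>, mu r\<close>.\<close>

definition shifted_skew_diagram :: "(nat \<times> nat) set \<Rightarrow> bool" where
  "shifted_skew_diagram D \<longleftrightarrow>
     (\<exists>(l::nat) (r::nat) (lam :: nat \<Rightarrow> nat) (mu :: nat \<Rightarrow> nat).
        r \<le> l \<and>
        (\<forall>i\<in>{1..l}. 0 < lam i) \<and>
        (\<forall>i\<in>{1..l}. \<forall>j\<in>{1..l}. i < j \<longrightarrow> lam j < lam i) \<and>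
        (\<forall>i\<in>{1..r}. 0 < mu i) \<and>
        (\<forall>i\<in>{1..r}. \<forall>j\<in>{1..r}. i < j \<longrightarrow> mu j < mu i) \<and>
        (\<forall>i>r. mu i = 0) \<and>
        (\<forall>i\<in>{1..l}. mu i < lam i) \<and>
        D = {(i, j). 1 \<le> i \<and> i \<le> l \<and> i + mu i + 1 \<le> j \<and> j \<le> i + lam i})"

text \<open>In the bipartite setting \<open>Inl i\<close> is the index of \<open>x\<^sub>i\<close> and \<open>Inr j\<close> that of \<open>y\<^sub>j\<close>; accordingly
  \<open>X <+> Y\<close> is the set of variables \<open>X \<squnion> Y\<close>.\<close>

definition nonbip_ideal :: "nat \<Rightarrow> (nat \<times> nat) set \<Rightarrow> (nat, 'k::field) mpoly set" where
  "nonbip_ideal n D = gen_ideal {1..n} ((\<lambda>(i, j). mvar i * mvar j) ` D)"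

definition bip_ideal :: "nat \<Rightarrow> (nat \<times> nat) set \<Rightarrow> (nat + nat, 'k::field) mpoly set" where
  "bip_ideal n D =
     gen_ideal ({1..n} <+> {1..n}) ((\<lambda>(i, j). mvar (Inl i) * mvar (Inr j)) ` D)"

definition sp_deg :: "nat + nat \<Rightarrow> nat \<Rightarrow> int" where
  "sp_deg v = (case v of Inl i \<Rightarrow> fine_deg i | Inr j \<Rightarrow> fine_deg j)"

definition beta_nonbip ::
    "'k::field itself \<Rightarrow> nat \<Rightarrow> (nat \<times> nat) set \<Rightarrow> nat \<Rightarrow> (nat \<Rightarrow> int) \<Rightarrow> nat" where
  "beta_nonbip k n D i \<alpha> =
     betti {1..n} fine_deg (nonbip_ideal n D :: (nat, 'k) mpoly set) i \<alpha>"

definition beta_bip ::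
    "'k::field itself \<Rightarrow> nat \<Rightarrow> (nat \<times> nat) set \<Rightarrow> nat \<Rightarrow> (nat + nat \<Rightarrow> int) \<Rightarrow> nat" where
  "beta_bip k n D i \<gamma> =
     betti ({1..n} <+> {1..n}) fine_deg (bip_ideal n D :: (nat + nat, 'k) mpoly set) i \<gamma>"

definition beta_bip_sp ::
    "'k::field itself \<Rightarrow> nat \<Rightarrow> (nat \<times> nat) set \<Rightarrow> nat \<Rightarrow> (nat \<Rightarrow> int) \<Rightarrow> nat" where
  "beta_bip_sp k n D i \<alpha> =
     betti ({1..n} <+> {1..n}) sp_deg (bip_ideal n D :: (nat + nat, 'k) mpoly set) i \<alpha>"

definition set_deg :: "'v set \<Rightarrow> 'v \<Rightarrow> int" where
  "set_deg S = (\<lambda>v. of_bool (v \<in> S))"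

end

theory Submission
  imports Defs
begin

text \<open>A shifted skew diagram is, read as a binary relation, contained in \<open>{(i, j). i < j}\<close> and
transitive: the row lengths give \<open>p + \<lambda>\<^sub>p \<le> i + \<lambda>\<^sub>i\<close> for \<open>i \<le> p\<close>, so \<open>(i, p), (p, j) \<in> D\<close> force
\<open>(i, j) \<in> D\<close>. The proof rests on these two properties.

The idea is to write down one free resolution of the bipartite ideal that becomes a free resolution of
the nonbipartite ideal when every \<open>y\<^sub>j\<close> is replaced by \<open>x\<^sub>j\<close>. Take the Taylor complex of the bipartite
ideal: its basis elements are the nonempty sets \<open>A\<close> of edges \<open>(i, j) \<in> D\<close>, labelled by the least common multiple
of their generators, the product of the \<open>x\<^sub>i\<close> over the sources \<open>i\<close> and of the \<open>y\<^sub>j\<close> over the targets \<open>j\<close>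
of the edges in \<open>A\<close>. Specializing the labels gives a complex over \<open>k[x\<^sub>1, \<dots>, x\<^sub>n]\<close>. In general a
complex of labelled simplices is exact if, for each monomial \<open>\<alpha>\<close> divisible by the label of some
vertex, the simplicial complex of the faces whose labels divide \<open>\<alpha>\<close> is acyclic
(\<open>labelled_resolution\<close>), since the part of multidegree \<open>\<alpha>\<close> consists of its chains. For the Taylor
complex those faces form a simplex. For the specialized complex they are the sets of edges between
permitted sources and targets such that no vertex with exponent 1 in \<open>\<alpha>\<close> is both a source and a target. This family is acyclic by
induction on the number of such vertices \<open>w\<close> (\<open>acyclic_edge_sets\<close>): it is the union of the family in
which \<open>w\<close> is no source and the one in which \<open>w\<close> is no target, and Mayer-Vietoris applies because the
intersection contains an edge as soon as both parts do. This is the place where transitivity enters: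
edges \<open>(i, w)\<close> and \<open>(w, j)\<close> provide the edge \<open>(i, j)\<close>, which avoids \<open>w\<close>.

Betti numbers may be computed from any graded free resolution (\<open>betti_eq\<close>, by the comparison theorem).
After tensoring with \<open>k\<close>, the specialized complex is the Taylor complex of the bipartite ideal with
the coarser grading: a matrix entry survives precisely when the two labels agree, and for nested
edge sets the specialized labels agree only if the original ones do. This is the equality of all
Betti numbers (\<open>beta_nonbip_eq_sp\<close>). A coarsely graded Betti number is the sum of the finely graded
ones above it (\<open>beta_sp_eq_sum\<close>). Finally, the Taylor complex of the nonbipartite ideal has
squarefree labels, so that its Betti numbers vanish in all other degrees
(\<open>beta_nonbip_squarefree\<close>); as the summands are nonnegative, this yields the vanishing statement (i),
and the summands left in a squarefree degree are those of (ii).\<close>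

section \<open>Dimensions of spaces of coordinate vectors\<close>

interpretation fs: vector_space "fscale :: 'k::field \<Rightarrow> (nat \<Rightarrow> 'k) \<Rightarrow> nat \<Rightarrow> 'k"
  by (rule vector_space_fscale)

lemma sum_apply: "(\<Sum>a\<in>A. f a) x = (\<Sum>a\<in>A. f a x)"
  by (induction A rule: infinite_finite_induct) auto

lemma fs_in_span_units:
  assumes "\<And>b. x b \<noteq> (0::'k::field) \<Longrightarrow> b < r"
  shows "x \<in> fs.span ((\<lambda>c b. of_bool (b = c)) ` {..<r})"
proof -
  have "x = (\<Sum>c<r. fscale (x c) (\<lambda>b. of_bool (b = c)))"
  proof
    fix b
    have "(\<Sum>c<r. fscale (x c) (\<lambda>b. of_bool (b = c))) b = (\<Sum>c<r. if c = b then x c else 0)"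
      unfolding sum_apply by (rule sum.cong) (auto simp: fscale_def)
    also have "\<dots> = x b" using assms[of b] by auto
    finally show "x b = (\<Sum>c<r. fscale (x c) (\<lambda>b. of_bool (b = c))) b" by simp
  qed
  also have "\<dots> \<in> fs.span ((\<lambda>c b. of_bool (b = c)) ` {..<r})"
    by (intro fs.span_sum fs.span_scale fs.span_base) auto
  finally show ?thesis .
qed

lemma fs_finite_basis:
  fixes U :: "(nat \<Rightarrow> 'k::field) set"
  assumes "fs.subspace U" "\<And>x b. x \<in> U \<Longrightarrow> x b \<noteq> 0 \<Longrightarrow> b < r"
    and "C \<subseteq> U" "fs.independent C"
  obtains B where "C \<subseteq> B" "B \<subseteq> U" "fs.independent B" "fs.span B = U" "finite B" "card B = fs.dim U"
proof -
  obtain B where B: "C \<subseteq> B" "B \<subseteq> U" "fs.independent B" "U \<subseteq> fs.span B"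
    using fs.maximal_independent_subset_extend[OF assms(3,4)] by blast
  have "B \<subseteq> fs.span ((\<lambda>c b. of_bool (b = c)) ` {..<r})"
    using B(2) assms(2) fs_in_span_units by blast
  then have "finite B"
    using fs.independent_span_bound[OF _ B(3)] by blast
  moreover have "fs.span B = U"
    using B fs.span_minimal[OF B(2) assms(1)] by blast
  ultimately show thesis
    using that B fs.basis_card_eq_dim[OF B(2,4,3)] by blast
qed

text \<open>The space of all functions on \<open>nat\<close> is infinite-dimensional, so that the dimension formulas for
finite-dimensional spaces do not apply to it. The subspaces below have all supports in a fixed
interval \<open>{..<r}\<close>, which provides finite bases; the formulas are derived from those.\<close>

lemma fs_independent_Un:
  fixes B C :: "(nat \<Rightarrow> 'k::field) set"
  assumes "fs.independent B" "fs.independent C" "finite C" "fs.span B \<inter> fs.span C = {0}"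
  shows "fs.independent (B \<union> C)"
proof -
  have "C' \<subseteq> C \<longrightarrow> fs.independent (B \<union> C')" if "finite C'" for C'
    using that
  proof induction
    case empty
    then show ?case using assms by simp
  next
    case (insert c C')
    show ?case
    proof
      assume sub: "insert c C' \<subseteq> C"
      have var_prod: "fs.independent (B \<union> C')" using insert sub by blast
      have "c \<notin> fs.span (B \<union> C')"
      proof
        assume "c \<in> fs.span (B \<union> C')"
        then obtain u w where uw: "c = u + w" "u \<in> fs.span B" "w \<in> fs.span C'"
          unfolding fs.span_Un by blast
        have "w \<in> fs.span C" using uw(3) sub fs.span_mono[of C' C] by blast
        moreover have "c \<in> fs.span C" using sub by (simp add: fs.span_base)
        ultimately have "c - w \<in> fs.span C" by (rule fs.span_diff[rotated])
        moreover have "c - w = u" using uw(1) by simp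
        ultimately have "u = 0" using uw(2) assms(4) by blast
        then have "c \<in> fs.span C'" using uw by simp
        moreover have "fs.independent (insert c C')" using fs.independent_mono[OF assms(2) sub] .
        ultimately show False using insert(2) by (simp add: fs.independent_insert)
      qed
      then show "fs.independent (B \<union> insert c C')"
        using var_prod by (simp add: fs.independent_insert)
    qed
  qed
  then show ?thesis using assms(3) by blast
qed

lemma fs_dim_direct_sum:
  fixes U W :: "(nat \<Rightarrow> 'k::field) set"
  assumes U: "fs.subspace U" "\<And>x b. x \<in> U \<Longrightarrow> x b \<noteq> 0 \<Longrightarrow> b < r"
    and W: "fs.subspace W" "\<And>x b. x \<in> W \<Longrightarrow> x b \<noteq> 0 \<Longrightarrow> b < s"
    and int: "U \<inter> W = {0}"
  shows "fs.dim {u + w |u w. u \<in> U \<and> w \<in> W} = fs.dim U + fs.dim W"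
proof -
  obtain B where B: "B \<subseteq> U" "fs.independent B" "fs.span B = U" "finite B" "card B = fs.dim U"
    by (rule fs_finite_basis[OF U, where C = "{}"]) (auto simp: fs.independent_empty)
  obtain C where C: "C \<subseteq> W" "fs.independent C" "fs.span C = W" "finite C" "card C = fs.dim W"
    by (rule fs_finite_basis[OF W, where C = "{}"]) (auto simp: fs.independent_empty)
  have var_prod: "fs.independent (B \<union> C)"
    by (rule fs_independent_Un) (use B C int in auto)
  have "0 \<notin> B" using B(2) fs.dependent_zero by blast
  moreover have "B \<inter> C \<subseteq> {0}" using B(1) C(1) unfolding int[symmetric] by (rule Int_mono)
  ultimately have "B \<inter> C = {}" by blast
  then have "card (B \<union> C) = fs.dim U + fs.dim W" using B C by (simp add: card_Un_disjoint)
  moreover have "fs.span (B \<union> C) = {u + w |u w. u \<in> U \<and> w \<in> W}"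
    by (simp add: fs.span_Un B(3) C(3))
  ultimately show ?thesis using fs.dim_span_eq_card_independent[OF var_prod] by simp
qed

lemma fs_dim_mono:
  fixes U W :: "(nat \<Rightarrow> 'k::field) set"
  assumes "fs.subspace U" "fs.subspace W" "\<And>x b. x \<in> W \<Longrightarrow> x b \<noteq> 0 \<Longrightarrow> b < r" "U \<subseteq> W"
  shows "fs.dim U \<le> fs.dim W"
proof -
  obtain B where B: "B \<subseteq> U" "fs.independent B" "fs.span B = U" "finite B" "card B = fs.dim U"
    by (rule fs_finite_basis[where U = U and r = r and C = "{}"]) (use assms in \<open>auto simp: fs.independent_empty\<close>)
  have BW: "B \<subseteq> W" using B assms by blast
  obtain C where "B \<subseteq> C" "C \<subseteq> W" "finite C" "card C = fs.dim W"
    by (rule fs_finite_basis[where U = W and r = r and C = B]) (use assms(2,3) B(2) BW in auto)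
  then show ?thesis using B by (metis card_mono)
qed

text \<open>For \<open>Z\<close> cycles and \<open>B\<close> boundaries, \<open>p\<close> is injective on homology. A complement of \<open>B\<close> in \<open>Z\<close>
represents the homology; it is mapped injectively to a space that meets \<open>B'\<close> only in 0.\<close>

lemma fs_quotient_dim_le:
  fixes p :: "(nat \<Rightarrow> 'k::field) \<Rightarrow> nat \<Rightarrow> 'k"
  assumes Z: "fs.subspace Z" "\<And>x b. x \<in> Z \<Longrightarrow> x b \<noteq> 0 \<Longrightarrow> b < r"
    and B: "fs.subspace B" "B \<subseteq> Z"
    and Z': "fs.subspace Z'" "\<And>x b. x \<in> Z' \<Longrightarrow> x b \<noteq> 0 \<Longrightarrow> b < s"
    and B': "fs.subspace B'" "B' \<subseteq> Z'"
    and p: "module_hom fscale fscale p" "p ` Z \<subseteq> Z'"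
    and inj: "\<And>z. z \<in> Z \<Longrightarrow> p z \<in> B' \<Longrightarrow> z \<in> B"
  shows "fs.dim Z - fs.dim B \<le> fs.dim Z' - fs.dim B'"
proof -
  interpret p: module_hom fscale fscale p by (rule p(1))
  have Bfin: "\<And>x b. x \<in> B \<Longrightarrow> x b \<noteq> 0 \<Longrightarrow> b < r" and B'fin: "\<And>x b. x \<in> B' \<Longrightarrow> x b \<noteq> 0 \<Longrightarrow> b < s"
    using B(2) Z(2) B'(2) Z'(2) by blast+
  obtain B0 where B0: "B0 \<subseteq> B" "fs.independent B0" "fs.span B0 = B" "finite B0" "card B0 = fs.dim B"
    by (rule fs_finite_basis[OF B(1) Bfin, where C = "{}"]) (auto simp: fs.independent_empty)
  have B0Z: "B0 \<subseteq> Z" using B0 B by blast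
  obtain B1 where B1: "B0 \<subseteq> B1" "B1 \<subseteq> Z" "fs.independent B1" "fs.span B1 = Z"
      "finite B1" "card B1 = fs.dim Z"
    by (rule fs_finite_basis[where U = Z and r = r and C = B0]) (use Z B0(2) B0Z in auto)
  define C where "C = B1 - B0"
  have C: "fs.independent C" "finite C" "card C = fs.dim Z - fs.dim B" "C \<subseteq> Z"
    unfolding C_def using B0 B1 fs.independent_mono[OF B1(3), of "B1 - B0"]
    by (auto simp: card_Diff_subset)
  have CZ: "fs.span C \<subseteq> Z" by (rule fs.span_minimal[OF C(4) Z(1)])
  \<comment> \<open>\<open>span C\<close> is a complement of \<open>B\<close> in \<open>Z\<close>.\<close>
  have disj: "fs.span C \<inter> B = {0}"
  proof -
    have "u = 0" if "u \<in> fs.span C" "u \<in> fs.span B0" for u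
    proof -
      from that(1) obtain f where f: "u = (\<Sum>a\<in>C. fscale (f a) a)" 
        unfolding fs.span_finite[OF C(2)] by blast
      from that(2) obtain g where g: "u = (\<Sum>a\<in>B0. fscale (g a) a)" 
        unfolding fs.span_finite[OF B0(4)] by blast
      define h where "h a = (if a \<in> C then f a else - g a)" for a
      have "(\<Sum>a\<in>B1. fscale (h a) a) = (\<Sum>a\<in>C. fscale (h a) a) + (\<Sum>a\<in>B0. fscale (h a) a)"
        unfolding C_def by (rule sum.subset_diff[OF B1(1,5)])
      also have "(\<Sum>a\<in>C. fscale (h a) a) = u" unfolding f h_def by simp
      also have "(\<Sum>a\<in>B0. fscale (h a) a) = (\<Sum>a\<in>B0. - fscale (g a) a)"
        by (rule sum.cong) (auto simp: h_def C_def fs.scale_minus_left)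
      also have "\<dots> = - u" unfolding g by (simp add: sum_negf)
      finally have "(\<Sum>a\<in>B1. fscale (h a) a) = 0" by (simp only: add.right_inverse)
      then have "\<forall>a\<in>B1. h a = 0" using B1(3,5) fs.independentD by blast
      then have "\<forall>a\<in>C. f a = 0" unfolding h_def C_def by auto
      then show "u = 0" unfolding f by simp
    qed
    moreover have "0 \<in> fs.span C \<inter> B" using fs.span_zero fs.subspace_0[OF B(1)] by simp
    ultimately show ?thesis unfolding B0(3) by blast
  qed
  define P where "P = p ` fs.span C"
  have P: "fs.subspace P" unfolding P_def by (rule p.subspace_image) simp
  have PZ: "P \<subseteq> Z'" unfolding P_def using p(2) CZ by blast
  have int: "P \<inter> B' = {0}"
  proof -
    have "y = 0" if y: "y \<in> P" "y \<in> B'" for y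
    proof -
      obtain z where z: "z \<in> fs.span C" "y = p z" using y(1) unfolding P_def by blast
      then have "z \<in> B" using inj CZ y(2) by blast
      then have "z = 0" using z disj by blast
      then show "y = 0" using z by (simp add: p.zero)
    qed
    then show ?thesis using P B'(1) fs.subspace_0 by blast
  qed
  have "inj_on p (fs.span C)"
  proof (rule inj_onI)
    fix x y assume xy: "x \<in> fs.span C" "y \<in> fs.span C" "p x = p y"
    have d: "x - y \<in> fs.span C" using xy by (simp add: fs.span_diff)
    have "p (x - y) = 0" using xy by (simp add: p.diff)
    then have "x - y \<in> B" using inj[of "x - y"] d CZ B'(1) fs.subspace_0 by fastforce
    then have "x - y = 0" using d disj by blast
    then show "x = y" by simp
  qed
  then have ipC: "fs.independent (p ` C)" and icard: "card (p ` C) = card C"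
    using p.dependent_inj_imageD C(1) card_image inj_on_subset[OF _ fs.span_superset] by blast+
  have dP: "fs.dim P = card C"
    unfolding P_def p.span_image[symmetric] using ipC icard fs.dim_span_eq_card_independent by metis
  have "fs.dim {u + w |u w. u \<in> P \<and> w \<in> B'} = fs.dim P + fs.dim B'"
    by (rule fs_dim_direct_sum[OF P _ B'(1) _ int]) (use PZ Z'(2) B'fin in blast)+
  moreover have "fs.dim {u + w |u w. u \<in> P \<and> w \<in> B'} \<le> fs.dim Z'"
    by (rule fs_dim_mono[OF fs.subspace_sums[OF P B'(1)] Z'(1)])
       (use Z'(2) PZ B'(2) Z'(1) fs.subspace_add in blast)+
  ultimately show ?thesis using dP C(3) by simp
qed

text \<open>In applications \<open>g\<close> assigns degrees to the elements of a basis, and this is a homogeneous component.\<close>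

definition restr :: "(nat \<Rightarrow> 'g) \<Rightarrow> 'g \<Rightarrow> (nat \<Rightarrow> 'k::zero) \<Rightarrow> nat \<Rightarrow> 'k" where
  "restr g \<gamma> x = (\<lambda>b. if g b = \<gamma> then x b else 0)"

text \<open>Subspaces that are supported on different classes of coordinates are independent, so that a space
which is determined by its components in finitely many classes is their direct sum.\<close>

lemma fs_dim_graded:
  fixes U :: "'g \<Rightarrow> (nat \<Rightarrow> 'k::field) set"
  assumes "finite \<Gamma>"
    and "\<And>\<gamma>. \<gamma> \<in> \<Gamma> \<Longrightarrow> fs.subspace (U \<gamma>)"
    and "\<And>\<gamma> x b. \<gamma> \<in> \<Gamma> \<Longrightarrow> x \<in> U \<gamma> \<Longrightarrow> x b \<noteq> 0 \<Longrightarrow> b < r \<and> g b = \<gamma>"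
  shows "fs.dim {x. (\<forall>b. x b \<noteq> 0 \<longrightarrow> g b \<in> \<Gamma>) \<and> (\<forall>\<gamma>\<in>\<Gamma>. restr g \<gamma> x \<in> U \<gamma>)} = (\<Sum>\<gamma>\<in>\<Gamma>. fs.dim (U \<gamma>))"
  using assms
proof (induction \<Gamma>)
  case empty
  have "{x :: nat \<Rightarrow> 'k. \<forall>b. x b = 0} = {0}" by (auto simp: fun_eq_iff)
  moreover have "fs.dim {0 :: nat \<Rightarrow> 'k} = 0" 
    by (metis card.empty fs.dim_span_eq_card_independent fs.independent_empty fs.span_empty)
  ultimately show ?case by simp
next
  case (insert \<gamma> \<Gamma>)
  define S where "S = (\<lambda>\<Gamma>. {x. (\<forall>b. x b \<noteq> 0 \<longrightarrow> g b \<in> \<Gamma>) \<and> (\<forall>\<gamma>\<in>\<Gamma>. restr g \<gamma> x \<in> U \<gamma>)})"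
  have restr_lin: "restr g \<delta> (x + y) = restr g \<delta> x + restr g \<delta> y"
      "restr g \<delta> (fscale c x) = fscale c (restr g \<delta> x)" "restr g \<delta> 0 = 0" for \<delta> c and x y :: "nat \<Rightarrow> 'k"
    by (auto simp: restr_def fun_eq_iff fscale_def)
  have sub: "fs.subspace (S \<Gamma>)"
    unfolding fs.subspace_def
  proof (intro conjI ballI allI)
    show "0 \<in> S \<Gamma>" using insert.prems(1) by (auto simp: S_def restr_lin fs.subspace_0)
  next
    fix x y assume xy: "x \<in> S \<Gamma>" "y \<in> S \<Gamma>"
    then have "g b \<in> \<Gamma>" if "(x + y) b \<noteq> 0" for b
      using that by (cases "x b = 0") (auto simp: S_def)
    moreover have "restr g \<delta> (x + y) \<in> U \<delta>" if "\<delta> \<in> \<Gamma>" for \<delta>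
      using xy that insert.prems(1) by (auto simp: S_def restr_lin intro!: fs.subspace_add)
    ultimately show "x + y \<in> S \<Gamma>" unfolding S_def by blast
  next
    fix c x assume x: "x \<in> S \<Gamma>"
    then have "g b \<in> \<Gamma>" if "fscale c x b \<noteq> 0" for b
      using that by (auto simp: S_def fscale_def)
    moreover have "restr g \<delta> (fscale c x) \<in> U \<delta>" if "\<delta> \<in> \<Gamma>" for \<delta>
      using x that insert.prems(1) by (auto simp: S_def restr_lin intro!: fs.subspace_scale)
    ultimately show "fscale c x \<in> S \<Gamma>" unfolding S_def by blast
  qed
  have fin: "b < r" if x: "x \<in> S \<Gamma>" and b: "x b \<noteq> 0" for x b
  proof -
    have "restr g (g b) x \<in> U (g b)" "g b \<in> \<Gamma>" using x b unfolding S_def by auto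
    moreover have "restr g (g b) x b \<noteq> 0" using b by (simp add: restr_def)
    ultimately show ?thesis using insert.prems(2) by blast
  qed
  have U\<gamma>: "fs.subspace (U \<gamma>)" "\<And>x b. x \<in> U \<gamma> \<Longrightarrow> x b \<noteq> 0 \<Longrightarrow> b < r \<and> g b = \<gamma>"
    using insert.prems by blast+
  have int: "U \<gamma> \<inter> S \<Gamma> = {0}"
  proof -
    have "x = 0" if x: "x \<in> U \<gamma>" "x \<in> S \<Gamma>" for x
    proof (rule ccontr)
      assume "x \<noteq> 0"
      then obtain b where "x b \<noteq> 0" by (auto simp: fun_eq_iff)
      then have "g b = \<gamma>" "g b \<in> \<Gamma>" using x U\<gamma> unfolding S_def by blast+
      then show False using insert.hyps by blast
    qed
    then show ?thesis using sub U\<gamma> fs.subspace_0 by blast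
  qed
  have "S (insert \<gamma> \<Gamma>) = {u + w |u w. u \<in> U \<gamma> \<and> w \<in> S \<Gamma>}"
  proof (intro equalityI subsetI)
    fix x assume x: "x \<in> S (insert \<gamma> \<Gamma>)"
    define w where "w = x - restr g \<gamma> x"
    have 1: "restr g \<gamma> x \<in> U \<gamma>" using x by (simp add: S_def)
    have "restr g \<delta> w = restr g \<delta> x" if "\<delta> \<in> \<Gamma>" for \<delta>
      using that insert.hyps by (auto simp: w_def restr_def fun_eq_iff)
    moreover have "g b \<in> \<Gamma>" if "w b \<noteq> 0" for b
      using that x by (auto simp: w_def restr_def S_def split: if_splits)
    ultimately have "w \<in> S \<Gamma>" using x by (auto simp: S_def)
    moreover have "x = restr g \<gamma> x + w" by (simp add: w_def)
    ultimately show "x \<in> {u + w |u w. u \<in> U \<gamma> \<and> w \<in> S \<Gamma>}" using 1 by blast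
  next
    fix x assume "x \<in> {u + w |u w. u \<in> U \<gamma> \<and> w \<in> S \<Gamma>}"
    then obtain u w where x: "x = u + w" and u: "u \<in> U \<gamma>" and w: "w \<in> S \<Gamma>" by blast
    have u0: "u b = 0" if "g b \<noteq> \<gamma>" for b using u U\<gamma> that by blast
    have w0: "w b = 0" if "g b = \<gamma>" for b using w that insert.hyps unfolding S_def by blast
    have "restr g \<gamma> x = u" using u0 w0 by (auto simp: x restr_def fun_eq_iff)
    moreover have "restr g \<delta> x = restr g \<delta> w" if "\<delta> \<in> \<Gamma>" for \<delta>
      using that insert.hyps u0 by (force simp: x restr_def fun_eq_iff)
    moreover have "g b \<in> insert \<gamma> \<Gamma>" if "x b \<noteq> 0" for b
      using that u0[of b] w by (auto simp: x S_def)
    ultimately show "x \<in> S (insert \<gamma> \<Gamma>)" using u w unfolding S_def by auto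
  qed
  moreover have "fs.dim {u + w |u w. u \<in> U \<gamma> \<and> w \<in> S \<Gamma>} = fs.dim (U \<gamma>) + fs.dim (S \<Gamma>)"
    by (rule fs_dim_direct_sum[OF U\<gamma>(1) _ sub fin int]) (use U\<gamma>(2) in blast)+
  moreover have "fs.dim (S \<Gamma>) = (\<Sum>\<gamma>\<in>\<Gamma>. fs.dim (U \<gamma>))"
    unfolding S_def using insert by blast
  ultimately show ?case using insert.hyps unfolding S_def by simp
qed

section \<open>Homogeneous polynomials\<close>

lemma poly_ring_0 [simp]: "0 \<in> poly_ring V"
  by (simp add: poly_ring_def)

lemma poly_ring_1 [simp]: "1 \<in> poly_ring V"
  by (simp add: poly_ring_def)

lemma poly_ring_add: "p \<in> poly_ring V \<Longrightarrow> q \<in> poly_ring V \<Longrightarrow> p + q \<in> poly_ring V"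
  using Poly_Mapping.keys_add[of p q] unfolding poly_ring_def by blast

lemma keys_diff_subset:
  "Poly_Mapping.keys (p - q) \<subseteq> Poly_Mapping.keys p \<union> Poly_Mapping.keys (q :: ('v, 'k::field) mpoly)"
  by (auto simp: in_keys_iff lookup_minus)

lemma poly_ring_diff: "p \<in> poly_ring V \<Longrightarrow> q \<in> poly_ring V \<Longrightarrow> p - q \<in> poly_ring V"
  using keys_diff_subset[of p q] unfolding poly_ring_def by blast

lemma keys_mult_cases:
  assumes "m \<in> Poly_Mapping.keys (p * q :: ('v, 'k::field) mpoly)"
  obtains a b where "a \<in> Poly_Mapping.keys p" "b \<in> Poly_Mapping.keys q" "m = a + b"
  using assms Poly_Mapping.keys_mult[of p q] by blast

lemma keys_add_nat: "Poly_Mapping.keys (a + b) = Poly_Mapping.keys a \<union> Poly_Mapping.keys (b :: 'v \<Rightarrow>\<^sub>0 nat)"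
  by (auto simp: in_keys_iff lookup_add)

lemma poly_ring_mult: "p \<in> poly_ring V \<Longrightarrow> q \<in> poly_ring V \<Longrightarrow> p * q \<in> poly_ring V"
  unfolding poly_ring_def by (fastforce elim!: keys_mult_cases simp: keys_add_nat)

lemma poly_ring_sum: "(\<And>i. i \<in> A \<Longrightarrow> f i \<in> poly_ring V) \<Longrightarrow> (\<Sum>i\<in>A. f i) \<in> poly_ring V"
  by (induction A rule: infinite_finite_induct) (auto intro: poly_ring_add)

lemma mon_degree_superset:
  assumes "finite S" "Poly_Mapping.keys m \<subseteq> S"
  shows "mon_degree deg m w = (\<Sum>v\<in>S. int (Poly_Mapping.lookup m v) * deg v w)"
  unfolding mon_degree_def
  by (rule sum.mono_neutral_left) (use assms in \<open>auto simp: in_keys_iff\<close>)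

lemma mon_degree_add: "mon_degree deg (a + b) = mon_degree deg a + mon_degree deg b"
proof
  fix w
  let ?S = "Poly_Mapping.keys a \<union> Poly_Mapping.keys b"
  have "mon_degree deg (a + b) w = (\<Sum>v\<in>?S. int (Poly_Mapping.lookup (a + b) v) * deg v w)"
    by (rule mon_degree_superset) (auto simp: keys_add_nat)
  also have "\<dots> = (\<Sum>v\<in>?S. int (Poly_Mapping.lookup a v) * deg v w) + (\<Sum>v\<in>?S. int (Poly_Mapping.lookup b v) * deg v w)"
    by (simp add: lookup_add algebra_simps sum.distrib)
  also have "\<dots> = (mon_degree deg a + mon_degree deg b) w"
    by (simp add: mon_degree_superset[of ?S])
  finally show "mon_degree deg (a + b) w = (mon_degree deg a + mon_degree deg b) w" .
qed

lemma mon_degree_0 [simp]: "mon_degree deg 0 = 0"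
  by (simp add: mon_degree_def fun_eq_iff)

lemma homogeneous_0 [simp]: "homogeneous deg \<gamma> 0"
  by (simp add: homogeneous_def)

lemma homogeneous_1 [simp]: "homogeneous deg 0 1"
  by (simp add: homogeneous_def)

lemma homogeneous_add: "homogeneous deg \<gamma> p \<Longrightarrow> homogeneous deg \<gamma> q \<Longrightarrow> homogeneous deg \<gamma> (p + q)"
  using Poly_Mapping.keys_add[of p q] unfolding homogeneous_def by blast

lemma homogeneous_diff: "homogeneous deg \<gamma> p \<Longrightarrow> homogeneous deg \<gamma> q \<Longrightarrow> homogeneous deg \<gamma> (p - q)"
  using keys_diff_subset[of p q] unfolding homogeneous_def by blast

lemma homogeneous_mult:
  "homogeneous deg \<gamma> p \<Longrightarrow> homogeneous deg \<delta> q \<Longrightarrow> homogeneous deg (\<gamma> + \<delta>) (p * q)"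
  unfolding homogeneous_def by (auto elim!: keys_mult_cases simp: mon_degree_add)

lemma homogeneous_sum:
  "(\<And>i. i \<in> A \<Longrightarrow> homogeneous deg \<gamma> (f i)) \<Longrightarrow> homogeneous deg \<gamma> (\<Sum>i\<in>A. f i)"
  by (induction A rule: infinite_finite_induct) (auto intro: homogeneous_add)

definition hom_part :: "('v \<Rightarrow> 'w \<Rightarrow> int) \<Rightarrow> ('w \<Rightarrow> int) \<Rightarrow> ('v, 'k::field) mpoly \<Rightarrow> ('v, 'k) mpoly" where
  "hom_part deg \<gamma> p = (\<Sum>m\<in>{m \<in> Poly_Mapping.keys p. mon_degree deg m = \<gamma>}.
     Poly_Mapping.single m (Poly_Mapping.lookup p m))"

lemma lookup_hom_part:
  "Poly_Mapping.lookup (hom_part deg \<gamma> p) m = (if mon_degree deg m = \<gamma> then Poly_Mapping.lookup p m else 0)"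
proof -
  have "Poly_Mapping.lookup (hom_part deg \<gamma> p) m =
      (\<Sum>m'\<in>{m \<in> Poly_Mapping.keys p. mon_degree deg m = \<gamma>}. if m' = m then Poly_Mapping.lookup p m else 0)"
    unfolding hom_part_def lookup_sum by (rule sum.cong) (auto simp: lookup_single when_def)
  also have "\<dots> = (if mon_degree deg m = \<gamma> then Poly_Mapping.lookup p m else 0)"
    by (auto simp: sum.delta in_keys_iff)
  finally show ?thesis .
qed

lemma hom_part_add: "hom_part deg \<gamma> (p + q) = hom_part deg \<gamma> p + hom_part deg \<gamma> q"
  by (rule poly_mapping_eqI) (simp add: lookup_hom_part lookup_add)

lemma hom_part_0 [simp]: "hom_part deg \<gamma> 0 = 0"
  by (rule poly_mapping_eqI) (simp add: lookup_hom_part)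

lemma hom_part_sum: "hom_part deg \<gamma> (\<Sum>i\<in>A. f i) = (\<Sum>i\<in>A. hom_part deg \<gamma> (f i))"
  by (induction A rule: infinite_finite_induct) (auto simp: hom_part_add)

lemma hom_part_homogeneous: "homogeneous deg \<gamma> p \<Longrightarrow> hom_part deg \<gamma> p = p"
  by (rule poly_mapping_eqI) (auto simp: lookup_hom_part homogeneous_def in_keys_iff)

lemma hom_part_eq_0: "(\<And>m. m \<in> Poly_Mapping.keys p \<Longrightarrow> mon_degree deg m \<noteq> \<gamma>) \<Longrightarrow> hom_part deg \<gamma> p = 0"
  by (rule poly_mapping_eqI) (auto simp: lookup_hom_part in_keys_iff)

lemma homogeneous_hom_part: "homogeneous deg \<gamma> (hom_part deg \<gamma> p)"
  by (auto simp: homogeneous_def in_keys_iff lookup_hom_part split: if_splits)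

lemma poly_ring_hom_part: "p \<in> poly_ring V \<Longrightarrow> hom_part deg \<gamma> p \<in> poly_ring V"
  unfolding poly_ring_def by (auto simp: in_keys_iff lookup_hom_part split: if_splits)

text \<open>This makes every lift along a graded map replaceable by a graded lift. The terms of \<open>q\<close> outside
degree \<open>\<delta>\<close> cannot contribute in degree \<open>\<gamma> + \<delta>\<close>.\<close>

lemma hom_part_mult:
  assumes "homogeneous deg \<gamma> p"
  shows "hom_part deg (\<gamma> + \<delta>) (p * q) = p * hom_part deg \<delta> q"
proof -
  have "p * q = p * hom_part deg \<delta> q + p * (q - hom_part deg \<delta> q)"
    by (simp add: algebra_simps)
  moreover have "hom_part deg (\<gamma> + \<delta>) (p * hom_part deg \<delta> q) = p * hom_part deg \<delta> q"
    by (rule hom_part_homogeneous[OF homogeneous_mult[OF assms homogeneous_hom_part]])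
  moreover have "hom_part deg (\<gamma> + \<delta>) (p * (q - hom_part deg \<delta> q)) = 0"
  proof (rule hom_part_eq_0)
    fix m assume "m \<in> Poly_Mapping.keys (p * (q - hom_part deg \<delta> q))"
    then obtain a b where ab: "a \<in> Poly_Mapping.keys p" "b \<in> Poly_Mapping.keys (q - hom_part deg \<delta> q)" "m = a + b"
      by (rule keys_mult_cases)
    then have "mon_degree deg b \<noteq> \<delta>" by (auto simp: in_keys_iff lookup_minus lookup_hom_part)
    moreover have "mon_degree deg a = \<gamma>" using assms ab(1) by (simp add: homogeneous_def)
    ultimately show "mon_degree deg m \<noteq> \<gamma> + \<delta>" by (simp add: ab(3) mon_degree_add)
  qed
  ultimately show ?thesis by (metis add_0_right hom_part_add)
qed

text \<open>Exponents are nonnegative, so a product of two monomials is constant only if both factors are.\<close>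

lemma lookup_mult_0:
  fixes p q :: "('v, 'k::field) mpoly"
  shows "Poly_Mapping.lookup (p * q) 0 = Poly_Mapping.lookup p 0 * Poly_Mapping.lookup q 0"
proof -
  have *: "Poly_Mapping.lookup (p * q) 0 = 0" if "Poly_Mapping.lookup p 0 = 0 \<or> Poly_Mapping.lookup q 0 = 0" for p q :: "('v, 'k) mpoly"
  proof (rule ccontr)
    assume "Poly_Mapping.lookup (p * q) 0 \<noteq> 0"
    then have "0 \<in> Poly_Mapping.keys (p * q)" by (simp add: in_keys_iff)
    then obtain a b where ab: "a \<in> Poly_Mapping.keys p" "b \<in> Poly_Mapping.keys q" "0 = a + b"
      by (rule keys_mult_cases)
    from ab(3) have "Poly_Mapping.keys a \<union> Poly_Mapping.keys b = {}" by (metis keys_add_nat keys_zero)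
    then have "a = 0" "b = 0" by (simp_all add: poly_mapping_eq_iff fun_eq_iff in_keys_iff set_eq_iff)
    then show False using ab that by (auto simp: in_keys_iff)
  qed
  define a b where "a = Poly_Mapping.lookup p 0" and "b = Poly_Mapping.lookup q 0"
  define p' q' where "p' = p - Poly_Mapping.single 0 a" and "q' = q - Poly_Mapping.single 0 b"
  have "p * q = Poly_Mapping.single 0 a * Poly_Mapping.single 0 b + Poly_Mapping.single 0 a * q' + p' * q"
    unfolding p'_def q'_def by (simp add: algebra_simps)
  moreover have "Poly_Mapping.lookup p' 0 = 0" "Poly_Mapping.lookup q' 0 = 0"
    by (simp_all add: p'_def q'_def a_def b_def lookup_minus)
  ultimately show ?thesis by (simp add: lookup_add * mult_single a_def b_def)
qed

section \<open>Graded matrices\<close>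

definition mat_mul :: "nat \<Rightarrow> (nat \<Rightarrow> nat \<Rightarrow> 'a::comm_ring_1) \<Rightarrow> (nat \<Rightarrow> nat \<Rightarrow> 'a) \<Rightarrow> nat \<Rightarrow> nat \<Rightarrow> 'a" where
  "mat_mul r A B = (\<lambda>a b. \<Sum>c<r. A a c * B c b)"

lemma mat_mul_assoc: "mat_mul s (mat_mul r A B) C = mat_mul r A (mat_mul s B C)"
proof (intro ext)
  fix a b
  have "mat_mul s (mat_mul r A B) C a b = (\<Sum>c<s. \<Sum>k<r. A a k * B k c * C c b)"
    by (simp add: mat_mul_def sum_distrib_right)
  also have "\<dots> = (\<Sum>k<r. \<Sum>c<s. A a k * B k c * C c b)" by (rule sum.swap)
  also have "\<dots> = mat_mul r A (mat_mul s B C) a b"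
    by (simp add: mat_mul_def sum_distrib_left mult.assoc)
  finally show "mat_mul s (mat_mul r A B) C a b = mat_mul r A (mat_mul s B C) a b" .
qed

lemma mat_mul_diff_left: "mat_mul r (A - B) C = mat_mul r A C - mat_mul r B C"
  by (simp add: mat_mul_def fun_eq_iff algebra_simps sum_subtractf)

lemma mat_mul_diff_right: "mat_mul r A (B - C) = mat_mul r A B - mat_mul r A C"
  by (simp add: mat_mul_def fun_eq_iff algebra_simps sum_subtractf)

lemma mat_mul_0_left [simp]: "mat_mul r 0 A = 0" and mat_mul_0_right [simp]: "mat_mul r A 0 = 0"
  by (simp_all add: mat_mul_def fun_eq_iff)

definition id_mat :: "nat \<Rightarrow> nat \<Rightarrow> nat \<Rightarrow> 'a::comm_ring_1" where
  "id_mat r a b = of_bool (a = b \<and> a < r)"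

text \<open>The degree-preserving maps from the free module of rank \<open>t\<close> with basis degrees \<open>e'\<close> to the one of rank
\<open>s\<close> with basis degrees \<open>e\<close>. Entries outside the \<open>s \<times> t\<close> block are 0, so that identities between
such maps are equations between functions.\<close>

definition graded_maps :: "'v set \<Rightarrow> ('v \<Rightarrow> 'w \<Rightarrow> int) \<Rightarrow> nat \<Rightarrow> (nat \<Rightarrow> 'w \<Rightarrow> int) \<Rightarrow> nat \<Rightarrow> (nat \<Rightarrow> 'w \<Rightarrow> int) \<Rightarrow>
    (nat \<Rightarrow> nat \<Rightarrow> ('v, 'k::field) mpoly) set" where
  "graded_maps V deg t e' s e = {M.
     (\<forall>a<s. \<forall>b<t. M a b \<in> poly_ring V \<and> homogeneous deg (e' b - e a) (M a b)) \<and>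
     (\<forall>a b. \<not> (a < s \<and> b < t) \<longrightarrow> M a b = 0)}"

lemma graded_mapsD:
  assumes "M \<in> graded_maps V deg t e' s e"
  shows "M a b \<in> poly_ring V" "homogeneous deg (e' b - e a) (M a b)" "a \<ge> s \<Longrightarrow> M a b = 0" "b \<ge> t \<Longrightarrow> M a b = 0"
  using assms by (cases "a < s \<and> b < t"; auto simp: graded_maps_def)+

lemma graded_mapsI:
  assumes "\<And>a b. a < s \<Longrightarrow> b < t \<Longrightarrow> M a b \<in> poly_ring V"
    "\<And>a b. a < s \<Longrightarrow> b < t \<Longrightarrow> homogeneous deg (e' b - e a) (M a b)"
    "\<And>a b. \<not> (a < s \<and> b < t) \<Longrightarrow> M a b = 0"
  shows "M \<in> graded_maps V deg t e' s e"
  using assms by (auto simp: graded_maps_def)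

lemma graded_maps_0 [simp]: "0 \<in> graded_maps V deg t e' s e"
  by (rule graded_mapsI) auto

lemma graded_maps_diff: "M \<in> graded_maps V deg t e' s e \<Longrightarrow> N \<in> graded_maps V deg t e' s e \<Longrightarrow> M - N \<in> graded_maps V deg t e' s e"
  by (rule graded_mapsI) (auto intro: poly_ring_diff homogeneous_diff graded_mapsD simp: graded_maps_def)

lemma graded_maps_id_mat: "id_mat r \<in> graded_maps V deg r e r e"
  by (rule graded_mapsI) (auto simp: id_mat_def of_bool_def)

lemma graded_maps_mat_mul:
  assumes "M \<in> graded_maps V deg t e' s e" "N \<in> graded_maps V deg u e'' t e'"
  shows "mat_mul t M N \<in> graded_maps V deg u e'' s e"
proof (rule graded_mapsI)
  fix a b
  show "mat_mul t M N a b \<in> poly_ring V"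
    unfolding mat_mul_def by (intro poly_ring_sum poly_ring_mult graded_mapsD(1)[OF assms(1)] graded_mapsD(1)[OF assms(2)])
  have "homogeneous deg ((e' c - e a) + (e'' b - e' c)) (M a c * N c b)" for c
    by (intro homogeneous_mult graded_mapsD(2)[OF assms(1)] graded_mapsD(2)[OF assms(2)])
  then have "homogeneous deg (e'' b - e a) (M a c * N c b)" for c by simp
  then show "homogeneous deg (e'' b - e a) (mat_mul t M N a b)"
    unfolding mat_mul_def by (rule homogeneous_sum)
  show "mat_mul t M N a b = 0" if "\<not> (a < s \<and> b < u)"
    unfolding mat_mul_def using that by (auto intro!: sum.neutral simp: graded_mapsD[OF assms(1)] graded_mapsD[OF assms(2)])
qed

lemma mat_mul_id_mat_left: "M \<in> graded_maps V deg t e' s e \<Longrightarrow> mat_mul s (id_mat s) M = M"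
proof (intro ext)
  fix a b assume M: "M \<in> graded_maps V deg t e' s e"
  have "mat_mul s (id_mat s) M a b = (\<Sum>c<s. if c = a then M a b else 0)"
    unfolding mat_mul_def id_mat_def by (rule sum.cong) auto
  then show "mat_mul s (id_mat s) M a b = M a b" using graded_mapsD(3)[OF M, of a] by auto
qed

lemma mat_mul_id_mat_right: "M \<in> graded_maps V deg t e' s e \<Longrightarrow> mat_mul t M (id_mat t) = M"
proof (intro ext)
  fix a b assume M: "M \<in> graded_maps V deg t e' s e"
  have "mat_mul t M (id_mat t) a b = (\<Sum>c<t. if c = b then M a b else 0)"
    unfolding mat_mul_def id_mat_def by (rule sum.cong) auto
  then show "mat_mul t M (id_mat t) a b = M a b" using graded_mapsD(4)[OF M, of b] by auto
qed

text \<open>Arbitrary preimages of the columns of \<open>N\<close> may be replaced by their homogeneous parts of the right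
degrees, because \<open>d\<close> is homogeneous.\<close>

lemma graded_maps_lift:
  assumes d: "d \<in> graded_maps V deg r\<^sub>1 e\<^sub>1 r\<^sub>0 e\<^sub>0" and N: "N \<in> graded_maps V deg t \<delta> r\<^sub>0 e\<^sub>0"
    and ex: "\<And>b. b < t \<Longrightarrow> \<exists>g. (\<forall>c<r\<^sub>1. g c \<in> poly_ring V) \<and> (\<forall>a<r\<^sub>0. (\<Sum>c<r\<^sub>1. d a c * g c) = N a b)"
  shows "\<exists>M \<in> graded_maps V deg t \<delta> r\<^sub>1 e\<^sub>1. mat_mul r\<^sub>1 d M = N"
proof -
  obtain g where g: "\<And>b c. b < t \<Longrightarrow> c < r\<^sub>1 \<Longrightarrow> g b c \<in> poly_ring V"
      "\<And>a b. b < t \<Longrightarrow> a < r\<^sub>0 \<Longrightarrow> (\<Sum>c<r\<^sub>1. d a c * g b c) = N a b"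
    using ex by metis
  define M where "M c b = (if c < r\<^sub>1 \<and> b < t then hom_part deg (\<delta> b - e\<^sub>1 c) (g b c) else 0)" for c b
  have M: "M \<in> graded_maps V deg t \<delta> r\<^sub>1 e\<^sub>1"
    by (rule graded_mapsI) (auto simp: M_def intro!: poly_ring_hom_part g homogeneous_hom_part)
  have "mat_mul r\<^sub>1 d M a b = N a b" for a b
  proof (cases "a < r\<^sub>0 \<and> b < t")
    case True
    have hp: "hom_part deg (\<delta> b - e\<^sub>0 a) (d a c * g b c) = d a c * hom_part deg (\<delta> b - e\<^sub>1 c) (g b c)" for c
      using hom_part_mult[OF graded_mapsD(2)[OF d, of c a], of "\<delta> b - e\<^sub>1 c" "g b c"] by simp
    have "N a b = hom_part deg (\<delta> b - e\<^sub>0 a) (N a b)"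
      by (rule hom_part_homogeneous[symmetric]) (rule graded_mapsD[OF N])
    also have "\<dots> = (\<Sum>c<r\<^sub>1. hom_part deg (\<delta> b - e\<^sub>0 a) (d a c * g b c))"
      using True g(2) by (simp flip: hom_part_sum)
    also have "\<dots> = mat_mul r\<^sub>1 d M a b"
      unfolding mat_mul_def hp using True by (auto simp: M_def intro!: sum.cong)
    finally show ?thesis by simp
  next
    case False
    then show ?thesis using graded_maps_mat_mul[OF d M] N by (auto simp: graded_maps_def)
  qed
  then show ?thesis using M by blast
qed

section \<open>Augmented resolutions\<close>

text \<open>A resolution \<open>\<dots> \<rightarrow> F\<^sub>1 \<rightarrow> F\<^sub>0 \<rightarrow> I\<close> with the polynomial ring added as module number 0, so that
\<open>F\<^sub>i\<close> has number \<open>i + 1\<close> and the map \<open>F\<^sub>0 \<rightarrow> I\<close> is treated as one more differential.\<close>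

locale aug_res =
  fixes V :: "'v set" and deg :: "'v \<Rightarrow> 'w \<Rightarrow> int" and I :: "('v, 'k::field) mpoly set"
    and r :: "nat \<Rightarrow> nat" and e :: "nat \<Rightarrow> nat \<Rightarrow> 'w \<Rightarrow> int" and d :: "nat \<Rightarrow> nat \<Rightarrow> nat \<Rightarrow> ('v, 'k) mpoly"
  assumes r0: "r 0 = 1" and e0: "e 0 = 0"
    and d_map: "d i \<in> graded_maps V deg (r (Suc i)) (e (Suc i)) (r i) (e i)"
    and d_d: "mat_mul (r (Suc i)) (d i) (d (Suc i)) = 0"
    and exact: "(\<And>c. c < r (Suc i) \<Longrightarrow> v c \<in> poly_ring V) \<Longrightarrow> (\<And>a. a < r i \<Longrightarrow> (\<Sum>c<r (Suc i). d i a c * v c) = 0) \<Longrightarrow>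
        \<exists>g. (\<forall>b<r (Suc (Suc i)). g b \<in> poly_ring V) \<and>
            (\<forall>c<r (Suc i). (\<Sum>b<r (Suc (Suc i)). d (Suc i) c b * g b) = v c)"
    and d0_in: "b < r (Suc 0) \<Longrightarrow> d 0 0 b \<in> I"
    and d0_onto: "p \<in> I \<Longrightarrow> \<exists>g. (\<forall>b<r (Suc 0). g b \<in> poly_ring V) \<and> (\<Sum>b<r (Suc 0). d 0 0 b * g b) = p"
begin

lemma lift_cycle:
  assumes N: "N \<in> graded_maps V deg t \<delta> (r (Suc i)) (e (Suc i))" and c: "mat_mul (r (Suc i)) (d i) N = 0"
  shows "\<exists>M \<in> graded_maps V deg t \<delta> (r (Suc (Suc i))) (e (Suc (Suc i))). mat_mul (r (Suc (Suc i))) (d (Suc i)) M = N"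
proof (rule graded_maps_lift[OF d_map N])
  fix b
  have "(\<Sum>c<r (Suc i). d i a c * N c b) = 0" for a
    using c by (simp add: mat_mul_def fun_eq_iff)
  then show "\<exists>g. (\<forall>c<r (Suc (Suc i)). g c \<in> poly_ring V) \<and> (\<forall>a<r (Suc i). (\<Sum>c<r (Suc (Suc i)). d (Suc i) a c * g c) = N a b)"
    using exact[of i "\<lambda>c. N c b"] graded_mapsD(1)[OF N] by blast
qed

lemma lift_start:
  assumes N: "N \<in> graded_maps V deg t \<delta> (r 0) (e 0)" and c: "\<And>b. b < t \<Longrightarrow> N 0 b \<in> I"
  shows "\<exists>M \<in> graded_maps V deg t \<delta> (r (Suc 0)) (e (Suc 0)). mat_mul (r (Suc 0)) (d 0) M = N"
  by (rule graded_maps_lift[OF d_map N]) (use d0_onto[OF c] in \<open>auto simp: r0\<close>)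

text \<open>Two lifts of the same map differ by a chain map \<open>T\<close> as here. The homotopy is built step by step; the
invariant says that what remains of \<open>T n\<close> after subtracting \<open>d n\<close> applied to
the homotopy is killed by \<open>d n\<close>, which makes the next correction term a cycle.\<close>

lemma null_homotopic:
  assumes T: "\<And>n. T n \<in> graded_maps V deg (r n) (e n) (r n) (e n)" and T0: "T 0 = 0"
    and comm: "\<And>n. mat_mul (r (Suc n)) (d n) (T (Suc n)) = mat_mul (r n) (T n) (d n)"
  shows "\<exists>s. (\<forall>n. s n \<in> graded_maps V deg (r n) (e n) (r (Suc n)) (e (Suc n))) \<and> s 0 = 0 \<and>
    (\<forall>n. T (Suc n) = mat_mul (r (Suc (Suc n))) (d (Suc n)) (s (Suc n)) + mat_mul (r n) (s n) (d n))"
proof -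
  define Inv where "Inv n s \<longleftrightarrow> s \<in> graded_maps V deg (r n) (e n) (r (Suc n)) (e (Suc n)) \<and> (n = 0 \<longrightarrow> s = 0) \<and>
     mat_mul (r n) (T n - mat_mul (r (Suc n)) (d n) s) (d n) = 0" for n s
  define Rel where "Rel n s s' \<longleftrightarrow> T (Suc n) = mat_mul (r (Suc (Suc n))) (d (Suc n)) s' + mat_mul (r n) s (d n)" for n s s'
  have "\<exists>s. \<forall>n. Inv n (s n) \<and> Rel n (s n) (s (Suc n))"
  proof (rule dependent_nat_choice)
    show "\<exists>s. Inv 0 s" by (rule exI[of _ 0]) (simp add: Inv_def T0)
  next
    fix s n assume s: "Inv n s"
    define N where "N = T (Suc n) - mat_mul (r n) s (d n)"
    have N: "N \<in> graded_maps V deg (r (Suc n)) (e (Suc n)) (r (Suc n)) (e (Suc n))"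
      unfolding N_def using s by (intro graded_maps_diff T graded_maps_mat_mul[OF _ d_map]) (simp add: Inv_def)
    have "mat_mul (r (Suc n)) (d n) N = 0"
      using s by (simp add: N_def mat_mul_diff_right comm Inv_def mat_mul_diff_left mat_mul_assoc)
    then obtain s' where s': "s' \<in> graded_maps V deg (r (Suc n)) (e (Suc n)) (r (Suc (Suc n))) (e (Suc (Suc n)))"
        "mat_mul (r (Suc (Suc n))) (d (Suc n)) s' = N"
      using lift_cycle[OF N] by blast
    have "mat_mul (r (Suc n)) (mat_mul (r n) s (d n)) (d (Suc n)) = 0"
      by (simp add: mat_mul_assoc d_d)
    then have "Inv (Suc n) s'" using s' by (simp add: Inv_def N_def)
    moreover have "Rel n s s'" using s' by (simp add: Rel_def N_def)
    ultimately show "\<exists>s'. Inv (Suc n) s' \<and> Rel n s s'" by blast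
  qed
  then show ?thesis unfolding Inv_def Rel_def by blast
qed

end

text \<open>The existence part of the comparison theorem. Each step lifts the columns of the composite of the
previous map and the differential; these columns are elements of the
ideal at the start and cycles afterwards, by the invariant.\<close>

lemma comparison:
  assumes F: "aug_res V deg I rF eF dF" and G: "aug_res V deg I rG eG dG"
  shows "\<exists>P. (\<forall>n. P n \<in> graded_maps V deg (rF n) (eF n) (rG n) (eG n)) \<and> P 0 = id_mat 1 \<and>
    (\<forall>n. mat_mul (rG (Suc n)) (dG n) (P (Suc n)) = mat_mul (rF n) (P n) (dF n))"
proof -
  interpret F: aug_res V deg I rF eF dF by (rule F)
  interpret G: aug_res V deg I rG eG dG by (rule G)
  define Inv where "Inv n P \<longleftrightarrow> P \<in> graded_maps V deg (rF n) (eF n) (rG n) (eG n) \<and> (n = 0 \<longrightarrow> P = id_mat 1) \<and>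
     (\<forall>k. n = Suc k \<longrightarrow> mat_mul (rF n) (mat_mul (rG n) (dG k) P) (dF n) = 0)" for n P
  define Rel where "Rel n P P' \<longleftrightarrow> mat_mul (rG (Suc n)) (dG n) P' = mat_mul (rF n) P (dF n)" for n P P'
  have "\<exists>P. \<forall>n. Inv n (P n) \<and> Rel n (P n) (P (Suc n))"
  proof (rule dependent_nat_choice)
    have "id_mat 1 \<in> graded_maps V deg (rF 0) (eF 0) (rG 0) (eG 0)"
      unfolding F.r0 G.r0 F.e0 G.e0 by (rule graded_maps_id_mat)
    then show "\<exists>P. Inv 0 P" by (auto simp: Inv_def)
  next
    fix P n assume P: "Inv n P"
    define N where "N = mat_mul (rF n) P (dF n)"
    have N: "N \<in> graded_maps V deg (rF (Suc n)) (eF (Suc n)) (rG n) (eG n)"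
      unfolding N_def using P by (intro graded_maps_mat_mul[OF _ F.d_map]) (simp add: Inv_def)
    have "\<exists>P' \<in> graded_maps V deg (rF (Suc n)) (eF (Suc n)) (rG (Suc n)) (eG (Suc n)). mat_mul (rG (Suc n)) (dG n) P' = N"
    proof (cases n)
      case 0
      have "mat_mul (rF 0) (id_mat (rF 0)) (dF 0) = dF 0" by (rule mat_mul_id_mat_left[OF F.d_map])
      then have "N = dF 0" using P 0 by (simp add: Inv_def N_def F.r0)
      then show ?thesis using G.lift_start[of N] N F.d0_in 0 by auto
    next
      case (Suc k)
      then show ?thesis using G.lift_cycle[of N _ _ k] N P by (auto simp: Inv_def N_def mat_mul_assoc)
    qed
    then obtain P' where P': "P' \<in> graded_maps V deg (rF (Suc n)) (eF (Suc n)) (rG (Suc n)) (eG (Suc n))"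
        "mat_mul (rG (Suc n)) (dG n) P' = N" by blast
    have "mat_mul (rF (Suc n)) N (dF (Suc n)) = 0"
      by (simp add: N_def mat_mul_assoc F.d_d)
    then have "Inv (Suc n) P'" using P' by (simp add: Inv_def)
    moreover have "Rel n P P'" using P' by (simp add: Rel_def N_def)
    ultimately show "\<exists>P'. Inv (Suc n) P' \<and> Rel n P P'" by blast
  qed
  then show ?thesis unfolding Inv_def Rel_def by blast
qed

section \<open>Independence of the resolution\<close>

definition aug_rk :: "('v, 'w, 'k::field) free_complex \<Rightarrow> nat \<Rightarrow> nat" where
  "aug_rk F i = (case i of 0 \<Rightarrow> 1 | Suc j \<Rightarrow> rk F j)"

definition aug_bdeg :: "('v, 'w, 'k::field) free_complex \<Rightarrow> nat \<Rightarrow> nat \<Rightarrow> 'w \<Rightarrow> int" where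
  "aug_bdeg F i = (case i of 0 \<Rightarrow> 0 | Suc j \<Rightarrow> bdeg F j)"

definition aug_dif :: "('v, 'w, 'k::field) free_complex \<Rightarrow> nat \<Rightarrow> nat \<Rightarrow> nat \<Rightarrow> ('v, 'k) mpoly" where
  "aug_dif F i a b =
     (if a < aug_rk F i \<and> b < aug_rk F (Suc i) then case i of 0 \<Rightarrow> aug F b | Suc j \<Rightarrow> dif F j a b else 0)"

lemma aug_simps [simp]:
  "aug_rk F 0 = 1" "aug_rk F (Suc i) = rk F i" "aug_bdeg F 0 = 0" "aug_bdeg F (Suc i) = bdeg F i"
  by (simp_all add: aug_rk_def aug_bdeg_def)

lemma aug_res_of_resolution:
  fixes F :: "('v, 'w, 'k::field) free_complex"
  assumes "graded_free_resolution V deg I F"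
  shows "aug_res V deg I (aug_rk F) (aug_bdeg F) (aug_dif F)"
proof -
  note F = assms[unfolded graded_free_resolution_def]
  note F1 = conjunct1[OF F] and F2 = conjunct1[OF conjunct2[OF F]]
    and F3 = conjunct1[OF conjunct2[OF conjunct2[OF F]]]
    and F4 = conjunct1[OF conjunct2[OF conjunct2[OF conjunct2[OF F]]]]
    and F5 = conjunct2[OF conjunct2[OF conjunct2[OF conjunct2[OF F]]]]
  have aug0: "\<And>b. b < rk F 0 \<Longrightarrow> aug F b \<in> poly_ring V" "\<And>b. b < rk F 0 \<Longrightarrow> homogeneous deg (bdeg F 0 b) (aug F b)"
    and difS: "\<And>i a b. a < rk F i \<Longrightarrow> b < rk F (Suc i) \<Longrightarrow> dif F i a b \<in> poly_ring V"
        "\<And>i a b. a < rk F i \<Longrightarrow> b < rk F (Suc i) \<Longrightarrow> homogeneous deg (bdeg F (Suc i) b - bdeg F i a) (dif F i a b)"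
    using F1 F2 by simp_all
  have im: "(\<lambda>f. \<Sum>b<rk F 0. aug F b * f b) ` free_module V (rk F 0) = I"
    and ex0: "{f \<in> free_module V (rk F 0). (\<Sum>b<rk F 0. aug F b * f b) = 0} =
       mat_app (rk F 1) (rk F 0) (dif F 0) ` free_module V (rk F 1)"
    and exS: "\<And>i. {f \<in> free_module V (rk F (Suc i)). mat_app (rk F (Suc i)) (rk F i) (dif F i) f = 0} =
          mat_app (rk F (Suc (Suc i))) (rk F (Suc i)) (dif F (Suc i)) ` free_module V (rk F (Suc (Suc i)))"
    using F3 F4 F5 by simp_all
  define unit :: "nat \<Rightarrow> nat \<Rightarrow> ('v, 'k) mpoly" where "unit c b = of_bool (b = c)" for c b
  have unit: "unit c \<in> free_module V n" if "c < n" for c n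
    using that by (auto simp: unit_def free_module_def of_bool_def)
  have sum_unit: "(\<Sum>b<n. h b * unit c b) = h c" if "c < n" for c n and h :: "nat \<Rightarrow> ('v, 'k) mpoly"
  proof -
    have "(\<Sum>b<n. h b * unit c b) = (\<Sum>b<n. if b = c then h c else 0)"
      by (rule sum.cong) (auto simp: unit_def)
    then show ?thesis using that by simp
  qed
  have D0: "aug_dif F 0 0 b = (if b < rk F 0 then aug F b else 0)" for b
    by (simp add: aug_dif_def)
  have DS: "aug_dif F (Suc i) a b = (if a < rk F i \<and> b < rk F (Suc i) then dif F i a b else 0)" for i a b
    by (simp add: aug_dif_def)
  have matS: "mat_app (rk F (Suc i)) (rk F i) (dif F i) f = (\<lambda>a. \<Sum>b<rk F (Suc i). aug_dif F (Suc i) a b * f b)" for i f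
    by (auto simp: mat_app_def DS fun_eq_iff)
  have aug0_sum: "(\<Sum>b<rk F 0. aug F b * f b) = (\<Sum>b<rk F 0. aug_dif F 0 0 b * f b)" for f
    by (auto simp: D0)
  show ?thesis
  proof
    show "aug_rk F 0 = 1" "aug_bdeg F 0 = 0" by simp_all
    show "aug_dif F i \<in> graded_maps V deg (aug_rk F (Suc i)) (aug_bdeg F (Suc i)) (aug_rk F i) (aug_bdeg F i)" for i
    proof (rule graded_mapsI)
      fix a b assume ab: "a < aug_rk F i" "b < aug_rk F (Suc i)"
      show "aug_dif F i a b \<in> poly_ring V"
        using ab by (cases i) (auto simp: D0 DS aug0 difS)
      show "homogeneous deg (aug_bdeg F (Suc i) b - aug_bdeg F i a) (aug_dif F i a b)"
        using ab by (cases i) (auto simp: D0 DS aug0 difS)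
    qed (auto simp: aug_dif_def)
    show "mat_mul (aug_rk F (Suc i)) (aug_dif F i) (aug_dif F (Suc i)) = 0" for i
    proof (intro ext)
      fix a c
      show "mat_mul (aug_rk F (Suc i)) (aug_dif F i) (aug_dif F (Suc i)) a c = 0 a c"
      proof (cases "c < rk F (Suc i)")
        case False
        then show ?thesis by (simp add: mat_mul_def DS)
      next
        case c: True
        define f where "f = mat_app (rk F (Suc i)) (rk F i) (dif F i) (unit c)"
        have f: "f \<in> mat_app (rk F (Suc i)) (rk F i) (dif F i) ` free_module V (rk F (Suc i))"
          unfolding f_def using unit[OF c] by blast
        have f': "f b = aug_dif F (Suc i) b c" for b
          unfolding f_def matS using sum_unit[OF c] by simp
        show ?thesis
        proof (cases i)
          case 0
          then have "(\<Sum>b<rk F 0. aug F b * f b) = 0" using f ex0 by auto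
          then show ?thesis unfolding aug0_sum using 0 by (cases "a = 0") (auto simp: mat_mul_def f' aug_dif_def)
        next
          case (Suc j)
          then have "mat_app (rk F (Suc j)) (rk F j) (dif F j) f = 0" using f exS[of j] by auto
          then show ?thesis unfolding matS using Suc by (auto simp: mat_mul_def f' fun_eq_iff)
        qed
      qed
    qed
    show "\<exists>g. (\<forall>b<aug_rk F (Suc (Suc i)). g b \<in> poly_ring V) \<and>
            (\<forall>c<aug_rk F (Suc i). (\<Sum>b<aug_rk F (Suc (Suc i)). aug_dif F (Suc i) c b * g b) = v c)"
      if v: "\<And>c. c < aug_rk F (Suc i) \<Longrightarrow> v c \<in> poly_ring V"
        "\<And>a. a < aug_rk F i \<Longrightarrow> (\<Sum>c<aug_rk F (Suc i). aug_dif F i a c * v c) = 0" for i v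
    proof -
      define f where "f c = (if c < rk F i then v c else 0)" for c
      have f: "f \<in> free_module V (rk F i)" using v(1) by (auto simp: f_def free_module_def)
      have "f \<in> mat_app (rk F (Suc i)) (rk F i) (dif F i) ` free_module V (rk F (Suc i))"
      proof (cases i)
        case 0
        have "(\<Sum>b<rk F 0. aug F b * f b) = 0" unfolding aug0_sum using v(2)[of 0] by (simp add: 0 f_def)
        then show ?thesis using f 0 ex0 by auto
      next
        case (Suc j)
        have "(\<Sum>b<rk F (Suc j). aug_dif F (Suc j) a b * f b) = 0" for a
        proof (cases "a < rk F j")
          case True
          then show ?thesis using v(2)[of a] by (simp add: Suc f_def)
        qed (simp add: DS)
        then have "mat_app (rk F (Suc j)) (rk F j) (dif F j) f = 0"
          unfolding matS by (simp add: fun_eq_iff)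
        then show ?thesis using f Suc exS[of j] by blast
      qed
      then obtain g where g: "g \<in> free_module V (rk F (Suc i))" "f = mat_app (rk F (Suc i)) (rk F i) (dif F i) g"
        by blast
      have "(\<Sum>b<rk F (Suc i). aug_dif F (Suc i) c b * g b) = v c" if "c < rk F i" for c
        using fun_cong[OF g(2)[unfolded matS], of c] that by (simp add: f_def)
      then show ?thesis using g(1) by (intro exI[of _ g]) (auto simp: free_module_def)
    qed
    show "aug_dif F 0 0 b \<in> I" if "b < aug_rk F (Suc 0)" for b
    proof -
      have b: "b < rk F 0" using that by simp
      have "aug_dif F 0 0 b = (\<Sum>c<rk F 0. aug F c * unit b c)"
        using sum_unit[OF b] b by (simp add: D0)
      then show ?thesis using im unit[OF b] by blast
    qed
    show "\<exists>g. (\<forall>b<aug_rk F (Suc 0). g b \<in> poly_ring V) \<and> (\<Sum>b<aug_rk F (Suc 0). aug_dif F 0 0 b * g b) = p"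
      if "p \<in> I" for p
    proof -
      from that im obtain g where "g \<in> free_module V (rk F 0)" "p = (\<Sum>b<rk F 0. aug F b * g b)" by blast
      then show ?thesis by (intro exI[of _ g]) (auto simp: free_module_def aug0_sum)
    qed
  qed
qed

text \<open>Tensoring with \<open>k\<close>: a matrix is replaced by the matrix of its constant coefficients.\<close>

definition const_mat :: "(nat \<Rightarrow> nat \<Rightarrow> ('v, 'k::field) mpoly) \<Rightarrow> nat \<Rightarrow> nat \<Rightarrow> 'k" where
  "const_mat M a b = Poly_Mapping.lookup (M a b) 0"

definition mat_vec :: "nat \<Rightarrow> (nat \<Rightarrow> nat \<Rightarrow> 'k::field) \<Rightarrow> (nat \<Rightarrow> 'k) \<Rightarrow> nat \<Rightarrow> 'k" where
  "mat_vec r M x = (\<lambda>a. \<Sum>b<r. M a b * x b)"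

lemma const_mat_mat_mul: "const_mat (mat_mul r A B) = mat_mul r (const_mat A) (const_mat B)"
  by (simp add: const_mat_def mat_mul_def lookup_sum lookup_mult_0 fun_eq_iff)

lemma const_mat_add: "const_mat (A + B) = const_mat A + const_mat B" and const_mat_diff: "const_mat (A - B) = const_mat A - const_mat B"
  and const_mat_0: "const_mat 0 = 0"
  by (simp_all add: const_mat_def fun_eq_iff lookup_add lookup_minus)

lemma const_mat_id_mat: "const_mat (id_mat r) = id_mat r"
  by (auto simp: const_mat_def id_mat_def fun_eq_iff of_bool_def)

lemma mat_vec_mat_mul: "mat_vec s (mat_mul r A B) x = mat_vec r A (mat_vec s B x)"
proof
  fix a
  have "mat_vec s (mat_mul r A B) x a = (\<Sum>c<s. \<Sum>k<r. A a k * B k c * x c)"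
    by (simp add: mat_mul_def mat_vec_def sum_distrib_right)
  also have "\<dots> = (\<Sum>k<r. \<Sum>c<s. A a k * B k c * x c)" by (rule sum.swap)
  also have "\<dots> = mat_vec r A (mat_vec s B x) a"
    by (simp add: mat_vec_def sum_distrib_left mult.assoc)
  finally show "mat_vec s (mat_mul r A B) x a = mat_vec r A (mat_vec s B x) a" .
qed

lemma mat_vec_add_mat: "mat_vec r (A + B) x = mat_vec r A x + mat_vec r B x" and mat_vec_diff_mat: "mat_vec r (A - B) x = mat_vec r A x - mat_vec r B x"
  and mat_vec_0_mat: "mat_vec r 0 x = 0"
  by (simp_all add: mat_vec_def fun_eq_iff sum.distrib sum_subtractf algebra_simps)

lemma mat_vec_hom: "module_hom fscale fscale (mat_vec r M)"
proof -
  have "mat_vec r M (x + y) = mat_vec r M x + mat_vec r M y" "mat_vec r M (fscale c x) = fscale c (mat_vec r M x)" for x y c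
    by (simp_all add: mat_vec_def fscale_def fun_eq_iff sum.distrib algebra_simps sum_distrib_left)
  then show ?thesis
    by (intro module_hom.intro module_hom_axioms.intro fs.module_axioms)
qed

lemma mat_vec_id_mat: "(\<And>b. x b \<noteq> 0 \<Longrightarrow> b < r) \<Longrightarrow> mat_vec r (id_mat r) x = x"
proof
  fix a assume x: "\<And>b. x b \<noteq> 0 \<Longrightarrow> b < r"
  have "mat_vec r (id_mat r) x a = (\<Sum>c<r. if c = a then x a else 0)"
    unfolding mat_vec_def id_mat_def by (rule sum.cong) auto
  then show "mat_vec r (id_mat r) x a = x a" using x[of a] by auto
qed

lemma tensor_dif_mat_vec:
  "tensor_dif F i = mat_vec (rk F (Suc i)) (const_mat (aug_dif F (Suc i)))"
  by (auto simp: tensor_dif_def mat_app_def mat_vec_def const_mat_def aug_dif_def fun_eq_iff)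

lemma homogeneous_constant_coeff:
  assumes "homogeneous deg \<gamma> p" "Poly_Mapping.lookup p 0 \<noteq> 0"
  shows "\<gamma> = 0"
  using assms unfolding homogeneous_def by (force simp: in_keys_iff)

text \<open>A homogeneous polynomial with a nonzero constant coefficient has degree 0. Hence a graded matrix,
after tensoring with \<open>k\<close>, only connects basis elements of equal degree.\<close>

lemma mat_vec_graded_maps:
  assumes M: "M \<in> graded_maps V deg t e' s e" and x: "\<And>b. x b \<noteq> 0 \<Longrightarrow> e' b = \<alpha>"
    and a: "mat_vec t (const_mat M) x a \<noteq> 0"
  shows "a < s \<and> e a = \<alpha>"
proof -
  obtain b where b: "const_mat M a b \<noteq> 0" "x b \<noteq> 0"
    using a unfolding mat_vec_def by (metis (no_types, lifting) mult_eq_0_iff sum.neutral)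
  then have "e' b - e a = 0" using homogeneous_constant_coeff[OF graded_mapsD(2)[OF M]] by (simp add: const_mat_def)
  moreover have "a < s" using b(1) graded_mapsD(3)[OF M, of a b] by (cases "a < s") (auto simp: const_mat_def)
  ultimately show ?thesis using x[OF b(2)] by simp
qed

lemma subspace_tensor_part: "fs.subspace (tensor_part F i \<alpha>)"
  unfolding fs.subspace_def tensor_part_def by (auto simp: fscale_def) (metis add.right_neutral)+

lemma tensor_dif_hom: "module_hom fscale fscale (tensor_dif F i)"
  unfolding tensor_dif_mat_vec by (rule mat_vec_hom)

lemma subspace_tor_boundaries: "fs.subspace (tor_boundaries F i \<alpha>)"
  unfolding tor_boundaries_def
  by (rule module_hom.subspace_image[OF tensor_dif_hom subspace_tensor_part])

lemma subspace_tor_cycles: "fs.subspace (tor_cycles F i \<alpha>)"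
proof (cases i)
  case 0
  then show ?thesis by (simp add: tor_cycles_def subspace_tensor_part)
next
  case (Suc j)
  have "tor_cycles F i \<alpha> = tensor_part F i \<alpha> \<inter> {x. tensor_dif F j x = 0}"
    by (auto simp: tor_cycles_def Suc)
  then show ?thesis
    using fs.subspace_inter[OF subspace_tensor_part module_hom.subspace_kernel[OF tensor_dif_hom]] by metis
qed

lemma tor_cycles_bounded: "x \<in> tor_cycles F i \<alpha> \<Longrightarrow> x b \<noteq> 0 \<Longrightarrow> b < rk F i \<and> bdeg F i b = \<alpha>"
  by (auto simp: tor_cycles_def tensor_part_def)

lemma mat_vec_tensor_part:
  assumes "M \<in> graded_maps V deg t e' (rk F i) (bdeg F i)" "\<And>b. x b \<noteq> 0 \<Longrightarrow> e' b = \<alpha>"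
  shows "mat_vec t (const_mat M) x \<in> tensor_part F i \<alpha>"
  using mat_vec_graded_maps[OF assms] by (auto simp: tensor_part_def)

lemma tor_boundaries_le_cycles:
  assumes "graded_free_resolution V deg I F"
  shows "tor_boundaries F i \<alpha> \<subseteq> tor_cycles F i \<alpha>"
proof -
  interpret F: aug_res V deg I "aug_rk F" "aug_bdeg F" "aug_dif F"
    by (rule aug_res_of_resolution[OF assms])
  have "tensor_dif F i x \<in> tensor_part F i \<alpha>" if "x \<in> tensor_part F (Suc i) \<alpha>" for x
    unfolding tensor_dif_mat_vec using that
    by (intro mat_vec_tensor_part[OF F.d_map[of "Suc i", simplified]]) (auto simp: tensor_part_def)
  moreover have "tensor_dif F j (tensor_dif F (Suc j) x) = 0" for j x
    unfolding tensor_dif_mat_vec mat_vec_mat_mul[symmetric] const_mat_mat_mul[symmetric] using F.d_d[of "Suc j"]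
    by (simp add: const_mat_0 mat_vec_0_mat)
  ultimately show ?thesis
    unfolding tor_boundaries_def tor_cycles_def by (auto split: nat.split)
qed

text \<open>For comparison maps \<open>p : F \<rightarrow> G\<close> and \<open>q : G \<rightarrow> F\<close>, the composite \<open>q p\<close> is homotopic to the identity, so
\<open>p\<close> is injective on homology after tensoring with \<open>k\<close>. Exchanging \<open>F\<close> and \<open>G\<close> gives the
reverse inequality.\<close>

lemma tor_dim_le:
  fixes F G :: "('v, 'w, 'k::field) free_complex"
  assumes F: "graded_free_resolution V deg I F" and G: "graded_free_resolution V deg I G"
  shows "fs.dim (tor_cycles F i \<alpha>) - fs.dim (tor_boundaries F i \<alpha>)
       \<le> fs.dim (tor_cycles G i \<alpha>) - fs.dim (tor_boundaries G i \<alpha>)"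
proof -
  note aF = aug_res_of_resolution[OF F] and aG = aug_res_of_resolution[OF G]
  interpret F: aug_res V deg I "aug_rk F" "aug_bdeg F" "aug_dif F" by (rule aF)
  interpret G: aug_res V deg I "aug_rk G" "aug_bdeg G" "aug_dif G" by (rule aG)
  obtain P where P: "\<And>n. P n \<in> graded_maps V deg (aug_rk F n) (aug_bdeg F n) (aug_rk G n) (aug_bdeg G n)" "P 0 = id_mat 1"
    "\<And>n. mat_mul (aug_rk G (Suc n)) (aug_dif G n) (P (Suc n)) = mat_mul (aug_rk F n) (P n) (aug_dif F n)"
    using comparison[OF aF aG] by blast
  obtain Q where Q: "\<And>n. Q n \<in> graded_maps V deg (aug_rk G n) (aug_bdeg G n) (aug_rk F n) (aug_bdeg F n)" "Q 0 = id_mat 1"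
    "\<And>n. mat_mul (aug_rk F (Suc n)) (aug_dif F n) (Q (Suc n)) = mat_mul (aug_rk G n) (Q n) (aug_dif G n)"
    using comparison[OF aG aF] by blast
  define T where "T n = mat_mul (aug_rk G n) (Q n) (P n) - id_mat (aug_rk F n)" for n
  have T: "T n \<in> graded_maps V deg (aug_rk F n) (aug_bdeg F n) (aug_rk F n) (aug_bdeg F n)" for n
    unfolding T_def by (intro graded_maps_diff graded_maps_mat_mul[OF Q(1) P(1)] graded_maps_id_mat)
  have T0: "T 0 = 0"
    using mat_mul_id_mat_left[OF P(1), of 0] by (simp add: T_def P(2) Q(2))
  have "mat_mul (aug_rk F (Suc n)) (aug_dif F n) (T (Suc n)) = mat_mul (aug_rk F n) (T n) (aug_dif F n)" for n
  proof -
    have "mat_mul (aug_rk F (Suc n)) (aug_dif F n) (mat_mul (aug_rk G (Suc n)) (Q (Suc n)) (P (Suc n)))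
        = mat_mul (aug_rk F n) (mat_mul (aug_rk G n) (Q n) (P n)) (aug_dif F n)"
      by (simp only: mat_mul_assoc[symmetric] Q(3)) (simp only: mat_mul_assoc P(3))
    then show ?thesis
      unfolding T_def mat_mul_diff_left mat_mul_diff_right
      using mat_mul_id_mat_left[OF F.d_map] mat_mul_id_mat_right[OF F.d_map] by simp
  qed
  from F.null_homotopic[OF T T0 this] obtain s where
    s: "\<And>n. s n \<in> graded_maps V deg (aug_rk F n) (aug_bdeg F n) (aug_rk F (Suc n)) (aug_bdeg F (Suc n))" "s 0 = 0"
    "\<And>n. T (Suc n) = mat_mul (aug_rk F (Suc (Suc n))) (aug_dif F (Suc n)) (s (Suc n)) + mat_mul (aug_rk F n) (s n) (aug_dif F n)"
    by blast
  define p where "p n = mat_vec (rk F n) (const_mat (P (Suc n)))" for n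
  define q where "q n = mat_vec (rk G n) (const_mat (Q (Suc n)))" for n
  have p_d: "tensor_dif G n (p (Suc n) x) = p n (tensor_dif F n x)" for n x
    unfolding p_def tensor_dif_mat_vec mat_vec_mat_mul[symmetric] const_mat_mat_mul[symmetric] using P(3)[of "Suc n"] by simp
  have q_d: "tensor_dif F n (q (Suc n) x) = q n (tensor_dif G n x)" for n x
    unfolding q_def tensor_dif_mat_vec mat_vec_mat_mul[symmetric] const_mat_mat_mul[symmetric] using Q(3)[of "Suc n"] by simp
  have p_part: "p n x \<in> tensor_part G n \<alpha>" if "x \<in> tensor_part F n \<alpha>" for n x
    unfolding p_def using that by (intro mat_vec_tensor_part[OF P(1)[of "Suc n", simplified]]) (auto simp: tensor_part_def)
  have q_part: "q n x \<in> tensor_part F n \<alpha>" if "x \<in> tensor_part G n \<alpha>" for n x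
    unfolding q_def using that by (intro mat_vec_tensor_part[OF Q(1)[of "Suc n", simplified]]) (auto simp: tensor_part_def)
  have p0: "p n 0 = 0" for n by (simp add: p_def mat_vec_def fun_eq_iff)
  show ?thesis
  proof (rule fs_quotient_dim_le[where p = "p i" and r = "rk F i" and s = "rk G i"])
    show "module_hom fscale fscale (p i)" unfolding p_def by (rule mat_vec_hom)
    show "p i ` tor_cycles F i \<alpha> \<subseteq> tor_cycles G i \<alpha>"
      by (auto simp: tor_cycles_def p_part p_d p0 split: nat.splits)
    show "z \<in> tor_boundaries F i \<alpha>" if z: "z \<in> tor_cycles F i \<alpha>" and b: "p i z \<in> tor_boundaries G i \<alpha>" for z
    proof -
      obtain w where w: "w \<in> tensor_part G (Suc i) \<alpha>" "p i z = tensor_dif G i w"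
        using b unfolding tor_boundaries_def by blast
      have zb: "z b \<noteq> 0 \<Longrightarrow> b < rk F i \<and> bdeg F i b = \<alpha>" for b using tor_cycles_bounded[OF z] .
      define u where "u = mat_vec (rk F i) (const_mat (s (Suc i))) z"
      have u: "u \<in> tensor_part F (Suc i) \<alpha>"
        unfolding u_def using zb by (intro mat_vec_tensor_part[OF s(1)[of "Suc i", simplified]]) auto
      have "q i (p i z) - z = mat_vec (rk F i) (const_mat (T (Suc i))) z"
        by (simp add: T_def const_mat_diff const_mat_mat_mul const_mat_id_mat mat_vec_diff_mat mat_vec_mat_mul p_def q_def mat_vec_id_mat zb)
      also have "\<dots> = tensor_dif F i u + mat_vec (aug_rk F i) (const_mat (s i)) (mat_vec (rk F i) (const_mat (aug_dif F i)) z)"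
        by (simp add: s(3) const_mat_add const_mat_mat_mul mat_vec_add_mat mat_vec_mat_mul u_def tensor_dif_mat_vec)
      also have "mat_vec (aug_rk F i) (const_mat (s i)) (mat_vec (rk F i) (const_mat (aug_dif F i)) z) = 0"
      proof (cases i)
        case 0
        then show ?thesis by (simp add: s(2) const_mat_0 mat_vec_0_mat)
      next
        case (Suc j)
        then have "tensor_dif F j z = 0" using z by (simp add: tor_cycles_def)
        then show ?thesis using Suc by (simp add: tensor_dif_mat_vec) (simp add: mat_vec_def fun_eq_iff)
      qed
      finally have "q i (tensor_dif G i w) - z = tensor_dif F i u" unfolding w(2) by (simp only: add_0_right)
      then have "z = q i (tensor_dif G i w) - tensor_dif F i u" by (metis add.commute diff_eq_eq eq_diff_eq)
      also have "\<dots> = tensor_dif F i (q (Suc i) w - u)"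
        unfolding q_d[symmetric] by (rule module_hom.diff[OF tensor_dif_hom, symmetric])
      finally show ?thesis
        unfolding tor_boundaries_def using fs.subspace_diff[OF subspace_tensor_part q_part[OF w(1)] u] by blast
    qed
  qed (rule subspace_tor_cycles subspace_tor_boundaries tor_boundaries_le_cycles[OF F]
         tor_boundaries_le_cycles[OF G] | drule (1) tor_cycles_bounded, simp)+
qed

theorem betti_eq:
  assumes "graded_free_resolution V deg I F"
  shows "betti V deg I i \<alpha> = fs.dim (tor_cycles F i \<alpha>) - fs.dim (tor_boundaries F i \<alpha>)"
proof -
  have "graded_free_resolution V deg I (SOME F. graded_free_resolution V deg I F)"
    using assms by (rule someI)
  then show ?thesis
    unfolding betti_def Let_def using assms by (intro antisym tor_dim_le)
qed

section \<open>Acyclic families of faces\<close>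

text \<open>Chains on finite simplicial complexes with vertices in \<open>{..<N}\<close> are functions on sets of vertices,
of all dimensions at once. The empty face is included, so that the homology is reduced.\<close>

definition insertion_sign :: "nat \<Rightarrow> nat set \<Rightarrow> 'k::field" where
  "insertion_sign a B = (- 1) ^ card {b \<in> B. b < a}"

definition boundary :: "nat \<Rightarrow> (nat set \<Rightarrow> 'k::field) \<Rightarrow> nat set \<Rightarrow> 'k" where
  "boundary N c B = (\<Sum>a\<in>{..<N} - B. insertion_sign a B * c (insert a B))"

lemma insertion_sign_insert_less: "a < a' \<Longrightarrow> a \<notin> B \<Longrightarrow> insertion_sign a' (insert a B) = - insertion_sign a' B"
proof -
  assume a: "a < a'" "a \<notin> B"
  then have "{b \<in> insert a B. b < a'} = insert a {b \<in> B. b < a'}" by auto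
  then show ?thesis using a by (simp add: insertion_sign_def)
qed

lemma insertion_sign_insert_ge: "a \<ge> a' \<Longrightarrow> insertion_sign a' (insert a B) = insertion_sign a' B"
proof -
  assume a: "a \<ge> a'"
  then have "{b \<in> insert a B. b < a'} = {b \<in> B. b < a'}" by auto
  then show ?thesis by (simp add: insertion_sign_def)
qed

lemma boundary_add: "boundary N (c + c') = boundary N c + boundary N c'"
  and boundary_diff: "boundary N (c - c') = boundary N c - boundary N c'"
  and boundary_0 [simp]: "boundary N 0 = 0"
  by (simp_all add: boundary_def fun_eq_iff algebra_simps sum.distrib sum_subtractf)

text \<open>Adding two vertices in either order gives opposite signs. The terms are paired by splitting the sum
according to the order of the two vertices, which is valid in characteristic 2 as well.\<close>

lemma boundary_boundary: "boundary N (boundary N c) = 0"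
proof
  fix B
  define K where "K = {..<N} - B"
  define h where "h a a' = insertion_sign a B * (insertion_sign a' (insert a B) * c (insert a' (insert a B)))" for a a'
  have K: "finite K" by (simp add: K_def)
  have anti: "h a a' + h a' a = 0" if "a < a'" "a \<in> K" "a' \<in> K" for a a'
    using that by (simp add: h_def K_def insertion_sign_insert_less insertion_sign_insert_ge insert_commute)
  have "boundary N (boundary N c) B = (\<Sum>a\<in>K. \<Sum>a'\<in>K - {a}. h a a')"
  proof -
    have "{..<N} - insert a B = K - {a}" for a by (auto simp: K_def)
    then show ?thesis by (simp add: boundary_def sum_distrib_left h_def K_def[symmetric])
  qed
  also have "\<dots> = (\<Sum>a\<in>K. \<Sum>a'\<in>K. (if a < a' then h a a' else 0) + (if a' < a then h a a' else 0))"
  proof (rule sum.cong)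
    fix a assume "a \<in> K"
    show "(\<Sum>a'\<in>K - {a}. h a a') = (\<Sum>a'\<in>K. (if a < a' then h a a' else 0) + (if a' < a then h a a' else 0))"
      by (rule sum.mono_neutral_cong_left) (use K in auto)
  qed simp
  also have "\<dots> = (\<Sum>a\<in>K. \<Sum>a'\<in>K. if a < a' then h a a' else 0) + (\<Sum>a\<in>K. \<Sum>a'\<in>K. if a' < a then h a a' else 0)"
    by (simp add: sum.distrib)
  also have "(\<Sum>a\<in>K. \<Sum>a'\<in>K. if a' < a then h a a' else 0) = (\<Sum>a\<in>K. \<Sum>a'\<in>K. if a < a' then h a' a else 0)"
    by (rule sum.swap)
  also have "(\<Sum>a\<in>K. \<Sum>a'\<in>K. if a < a' then h a a' else 0) + \<dots>
      = (\<Sum>a\<in>K. \<Sum>a'\<in>K. if a < a' then h a a' + h a' a else 0)"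
    by (simp add: sum.distrib[symmetric] if_distrib cong: if_cong)
  also have "\<dots> = 0" using anti by (auto intro!: sum.neutral)
  finally show "boundary N (boundary N c) B = 0 B" by simp
qed

definition supp_in :: "(nat set \<Rightarrow> 'k::zero) \<Rightarrow> nat set set \<Rightarrow> bool" where
  "supp_in c \<Delta> \<longleftrightarrow> (\<forall>A. c A \<noteq> 0 \<longrightarrow> A \<in> \<Delta>)"

definition down_closed :: "'a set set \<Rightarrow> bool" where
  "down_closed \<Delta> \<longleftrightarrow> (\<forall>A\<in>\<Delta>. \<forall>B\<subseteq>A. B \<in> \<Delta>)"

text \<open>The argument of type \<open>itself\<close> fixes the field of coefficients.\<close>

definition acyclic_complex :: "'k::field itself \<Rightarrow> nat \<Rightarrow> nat set set \<Rightarrow> bool" where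
  "acyclic_complex k N \<Delta> \<longleftrightarrow> (\<forall>c :: nat set \<Rightarrow> 'k. supp_in c \<Delta> \<longrightarrow> boundary N c = 0 \<longrightarrow>
     (\<exists>e. supp_in e \<Delta> \<and> boundary N e = c))"

lemma supp_in_boundary: "supp_in c \<Delta> \<Longrightarrow> down_closed \<Delta> \<Longrightarrow> supp_in (boundary N c) \<Delta>"
  unfolding supp_in_def
proof (intro allI impI)
  fix B assume c: "\<forall>A. c A \<noteq> 0 \<longrightarrow> A \<in> \<Delta>" and \<Delta>: "down_closed \<Delta>" and "boundary N c B \<noteq> 0"
  then obtain a where "c (insert a B) \<noteq> 0"
    unfolding boundary_def by (metis (no_types, lifting) mult_zero_right sum.neutral)
  then have "insert a B \<in> \<Delta>" using c by blast
  then show "B \<in> \<Delta>" using \<Delta> unfolding down_closed_def by (meson subset_insertI)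
qed

lemma supp_in_add: "supp_in c \<Delta> \<Longrightarrow> supp_in c' \<Delta> \<Longrightarrow> supp_in (c + c' :: nat set \<Rightarrow> 'k::field) \<Delta>"
  unfolding supp_in_def by (metis add.right_neutral plus_fun_apply)

lemma supp_in_diff: "supp_in c \<Delta> \<Longrightarrow> supp_in c' \<Delta> \<Longrightarrow> supp_in (c - c' :: nat set \<Rightarrow> 'k::field) \<Delta>"
  unfolding supp_in_def by (metis diff_zero minus_apply)

lemma supp_in_mono: "supp_in c \<Delta> \<Longrightarrow> \<Delta> \<subseteq> \<Delta>' \<Longrightarrow> supp_in c \<Delta>'"
  by (auto simp: supp_in_def)

text \<open>The cone over the least vertex is a contraction; as all vertices of \<open>S\<close> are at least this
vertex, adding it carries the sign 1 and reverses all other signs.\<close>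

lemma acyclic_simplex:
  assumes S: "S \<subseteq> {..<N}" "S \<noteq> {}"
  shows "acyclic_complex TYPE('k::field) N (Pow S)"
  unfolding acyclic_complex_def
proof (intro allI impI)
  fix c :: "nat set \<Rightarrow> 'k" assume c: "supp_in c (Pow S)" "boundary N c = 0"
  have fin: "finite S" using S finite_subset by blast
  define v where "v = Min S"
  have v: "v \<in> S" "\<And>a. a \<in> S \<Longrightarrow> v \<le> a" using fin S(2) by (auto simp: v_def)
  define e where "e A = (if v \<in> A then c (A - {v}) else 0)" for A
  have c0: "c A = 0" if "\<not> A \<subseteq> S" for A using c(1) that by (auto simp: supp_in_def)
  have sgn1: "insertion_sign v B = (1::'k)" if "B \<subseteq> S" for B
  proof -
    have "{b \<in> B. b < v} = {}" using that v(2) by fastforce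
    then show ?thesis by (simp only: insertion_sign_def card.empty power_0)
  qed
  have "supp_in e (Pow S)" using c(1) v(1) by (auto simp: e_def supp_in_def split: if_splits)
  moreover have "boundary N e B = c B" for B
  proof (cases "v \<in> B")
    case False
    have "boundary N e B = (\<Sum>a\<in>{..<N} - B. if a = v then insertion_sign v B * c B else 0)"
      unfolding boundary_def by (rule sum.cong) (use False in \<open>auto simp: e_def\<close>)
    also have "\<dots> = insertion_sign v B * c B" using False v S by (auto simp: sum.delta)
    also have "\<dots> = c B" using c0[of B] sgn1[of B] by (cases "B \<subseteq> S") simp_all
    finally show ?thesis .
  next
    case True
    define B' where "B' = B - {v}"
    have B: "B = insert v B'" "v \<notin> B'" using True by (auto simp: B'_def)
    have N: "{..<N} - B' = insert v ({..<N} - B)" using v S by (auto simp: B)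
    have "boundary N e B = (\<Sum>a\<in>{..<N} - B. - (insertion_sign a B' * c (insert a B')))"
      unfolding boundary_def
    proof (rule sum.cong)
      fix a assume a: "a \<in> {..<N} - B"
      have ea: "e (insert a B) = c (insert a B')"
        using a B by (auto simp: e_def insert_Diff_if intro!: arg_cong[of _ _ c])
      show "insertion_sign a B * e (insert a B) = - (insertion_sign a B' * c (insert a B'))"
      proof (cases "a \<in> S")
        case True
        then have "v < a" using v(2)[of a] a B by (cases "v = a") auto
        then show ?thesis using B(2) ea by (simp add: B(1) insertion_sign_insert_less)
      next
        case False
        then show ?thesis using c0[of "insert a B'"] ea by simp
      qed
    qed simp
    also have "\<dots> = insertion_sign v B' * c (insert v B') - boundary N c B'"
      unfolding boundary_def N using B by (simp add: sum_negf)
    also have "\<dots> = insertion_sign v B' * c B" by (simp add: c(2) B(1)[symmetric])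
    also have "\<dots> = c B" using c0[of B] sgn1[of B'] B by (cases "B \<subseteq> S") auto
    finally show ?thesis .
  qed
  ultimately show "\<exists>e. supp_in e (Pow S) \<and> boundary N e = c" by blast
qed

text \<open>Mayer-Vietoris. A cycle is cut into chains on the two parts; their boundaries are opposite and lie
in the intersection, where they bound a chain \<open>e\<close> that corrects both pieces to cycles.\<close>

lemma acyclic_Un:
  assumes down: "down_closed \<Delta>\<^sub>1" "down_closed \<Delta>\<^sub>2"
    and ac: "acyclic_complex k N \<Delta>\<^sub>1" "acyclic_complex k N \<Delta>\<^sub>2" "acyclic_complex k N (\<Delta>\<^sub>1 \<inter> \<Delta>\<^sub>2)"
  shows "acyclic_complex (k :: 'k::field itself) N (\<Delta>\<^sub>1 \<union> \<Delta>\<^sub>2)"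
  unfolding acyclic_complex_def
proof (intro allI impI)
  fix c :: "nat set \<Rightarrow> 'k" assume c: "supp_in c (\<Delta>\<^sub>1 \<union> \<Delta>\<^sub>2)" "boundary N c = 0"
  define c\<^sub>1 where "c\<^sub>1 A = (if A \<in> \<Delta>\<^sub>1 then c A else 0)" for A
  define c\<^sub>2 where "c\<^sub>2 = c - c\<^sub>1"
  have s1: "supp_in c\<^sub>1 \<Delta>\<^sub>1" and s2: "supp_in c\<^sub>2 \<Delta>\<^sub>2"
    using c(1) by (auto simp: supp_in_def c\<^sub>1_def c\<^sub>2_def)
  have sum: "c = c\<^sub>1 + c\<^sub>2" by (simp add: c\<^sub>2_def)
  have b: "boundary N c\<^sub>1 = 0 - boundary N c\<^sub>2"
    using c(2) unfolding sum boundary_add by (simp add: eq_neg_iff_add_eq_0)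
  have "supp_in (boundary N c\<^sub>1) \<Delta>\<^sub>2"
    unfolding b by (intro supp_in_diff supp_in_boundary s2 down) (simp add: supp_in_def)
  then have "supp_in (boundary N c\<^sub>1) (\<Delta>\<^sub>1 \<inter> \<Delta>\<^sub>2)"
    using supp_in_boundary[OF s1 down(1)] by (simp add: supp_in_def)
  then obtain e where e: "supp_in e (\<Delta>\<^sub>1 \<inter> \<Delta>\<^sub>2)" "boundary N e = boundary N c\<^sub>1"
    using ac(3) boundary_boundary unfolding acyclic_complex_def by metis
  have e12: "supp_in e \<Delta>\<^sub>1" "supp_in e \<Delta>\<^sub>2" using e(1) by (auto simp: supp_in_def)
  have "boundary N (c\<^sub>1 - e) = 0" by (simp add: boundary_diff e)
  then obtain g\<^sub>1 where g1: "supp_in g\<^sub>1 \<Delta>\<^sub>1" "boundary N g\<^sub>1 = c\<^sub>1 - e"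
    using ac(1) supp_in_diff[OF s1 e12(1)] unfolding acyclic_complex_def by metis
  have "boundary N (c\<^sub>2 + e) = 0" by (simp add: boundary_add e b)
  then obtain g\<^sub>2 where g2: "supp_in g\<^sub>2 \<Delta>\<^sub>2" "boundary N g\<^sub>2 = c\<^sub>2 + e"
    using ac(2) supp_in_add[OF s2 e12(2)] unfolding acyclic_complex_def by metis
  have "supp_in (g\<^sub>1 + g\<^sub>2) (\<Delta>\<^sub>1 \<union> \<Delta>\<^sub>2)"
    by (intro supp_in_add supp_in_mono[OF g1(1)] supp_in_mono[OF g2(1)]) auto
  moreover have "boundary N (g\<^sub>1 + g\<^sub>2) = c" by (simp add: boundary_add g1 g2 sum)
  ultimately show "\<exists>e. supp_in e (\<Delta>\<^sub>1 \<union> \<Delta>\<^sub>2) \<and> boundary N e = c" by blast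
qed

section \<open>Complexes of labelled simplices\<close>

definition mono_dvd :: "('v \<Rightarrow>\<^sub>0 nat) \<Rightarrow> ('v \<Rightarrow>\<^sub>0 nat) \<Rightarrow> bool" where
  "mono_dvd s t \<longleftrightarrow> (\<forall>v. Poly_Mapping.lookup s v \<le> Poly_Mapping.lookup t v)"

lemma mono_dvd_add_diff: "mono_dvd s t \<Longrightarrow> s + (t - s) = t"
  by (rule poly_mapping_eqI) (simp add: mono_dvd_def lookup_add lookup_minus)

lemma mono_dvd_add [simp]: "mono_dvd s (s + u)" "mono_dvd s (u + s)"
  by (simp_all add: mono_dvd_def lookup_add)

lemma mono_dvd_trans: "mono_dvd s t \<Longrightarrow> mono_dvd t u \<Longrightarrow> mono_dvd s u"
  unfolding mono_dvd_def using le_trans by blast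

lemma mono_dvd_diff_iff: "mono_dvd s u \<Longrightarrow> mono_dvd s t \<Longrightarrow> mono_dvd (t - s) (u - s) \<longleftrightarrow> mono_dvd t u"
  by (simp add: mono_dvd_def lookup_minus le_diff_iff)

lemma mono_dvd_diff_diff: "mono_dvd s t \<Longrightarrow> (u - s) - (t - s) = u - t"
  by (rule poly_mapping_eqI) (simp add: mono_dvd_def lookup_minus)

lemma lookup_single_mult:
  fixes p :: "('v, 'k::field) mpoly"
  shows "Poly_Mapping.lookup (Poly_Mapping.single s c * p) t =
    (if mono_dvd s t then c * Poly_Mapping.lookup p (t - s) else 0)"
proof -
  have p: "p = (\<Sum>u\<in>Poly_Mapping.keys p. Poly_Mapping.single u (Poly_Mapping.lookup p u))"
    by (rule poly_mapping_eqI) (simp add: lookup_sum lookup_single when_def in_keys_iff)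
  have "Poly_Mapping.lookup (Poly_Mapping.single s c * p) t =
      (\<Sum>u\<in>Poly_Mapping.keys p. if s + u = t then c * Poly_Mapping.lookup p u else 0)"
    by (subst p) (simp add: sum_distrib_left mult_single lookup_sum lookup_single when_def)
  also have "\<dots> = (if mono_dvd s t then c * Poly_Mapping.lookup p (t - s) else 0)"
  proof (cases "mono_dvd s t")
    case True
    then have "s + u = t \<longleftrightarrow> u = t - s" for u using mono_dvd_add_diff[OF True] by (metis add_diff_cancel_left')
    then show ?thesis using True by (simp add: in_keys_iff)
  next
    case False
    then have "s + u \<noteq> t" for u by auto
    then show ?thesis using False by simp
  qed
  finally show ?thesis .
qed

lemma resolution_of_aug_res:
  assumes R: "aug_res V deg I r e d"
    and I: "\<And>g. (\<And>b. b < r (Suc 0) \<Longrightarrow> g b \<in> poly_ring V) \<Longrightarrow> (\<Sum>b<r (Suc 0). d 0 0 b * g b) \<in> I"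
  shows "graded_free_resolution V deg I
    \<lparr>rk = \<lambda>i. r (Suc i), bdeg = \<lambda>i. e (Suc i), dif = \<lambda>i. d (Suc i), aug = d 0 0\<rparr>"
proof -
  interpret R: aug_res V deg I r e d by (rule R)
  have d_hom: "homogeneous deg (e (Suc i) b - e i a) (d i a b)" for i a b
    by (rule graded_mapsD(2)[OF R.d_map])
  have d_V: "d i a b \<in> poly_ring V" for i a b
    by (rule graded_mapsD(1)[OF R.d_map])
  have d_d: "(\<Sum>b<r (Suc i). d i a b * (\<Sum>c<r (Suc (Suc i)). d (Suc i) b c * g c)) = 0" for i a g
  proof -
    have "(\<Sum>b<r (Suc i). d i a b * (\<Sum>c<r (Suc (Suc i)). d (Suc i) b c * g c))
        = mat_mul (r (Suc i)) (d i) (mat_mul (r (Suc (Suc i))) (d (Suc i)) (\<lambda>c _. g c)) a 0"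
      by (simp add: mat_mul_def)
    then show ?thesis by (simp add: mat_mul_assoc[symmetric] R.d_d)
  qed
  have mat: "mat_app (r (Suc i)) (r i) (d i) f = (\<lambda>a. \<Sum>b<r (Suc i). d i a b * f b)" for i f
    using graded_mapsD(3)[OF R.d_map] by (auto simp: mat_app_def fun_eq_iff intro!: sum.neutral)
  have ker_im: "{f \<in> free_module V (r (Suc i)). \<forall>a. (\<Sum>b<r (Suc i). d i a b * f b) = 0} =
      (\<lambda>f a. \<Sum>b<r (Suc (Suc i)). d (Suc i) a b * f b) ` free_module V (r (Suc (Suc i)))" for i
  proof (intro equalityI subsetI)
    fix f assume "f \<in> {f \<in> free_module V (r (Suc i)). \<forall>a. (\<Sum>b<r (Suc i). d i a b * f b) = 0}"
    then have f: "f \<in> free_module V (r (Suc i))" "\<And>a. (\<Sum>b<r (Suc i). d i a b * f b) = 0" by auto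
    obtain g where g: "\<And>b. b < r (Suc (Suc i)) \<Longrightarrow> g b \<in> poly_ring V"
        "\<And>c. c < r (Suc i) \<Longrightarrow> (\<Sum>b<r (Suc (Suc i)). d (Suc i) c b * g b) = f c"
      using R.exact[of i f] f by (auto simp: free_module_def)
    define h where "h b = (if b < r (Suc (Suc i)) then g b else 0)" for b
    have "h \<in> free_module V (r (Suc (Suc i)))" using g by (auto simp: h_def free_module_def)
    moreover have "f c = (\<Sum>b<r (Suc (Suc i)). d (Suc i) c b * h b)" for c
    proof (cases "c < r (Suc i)")
      case True
      then show ?thesis using g(2)[of c] by (simp add: h_def)
    next
      case False
      then show ?thesis using f(1) graded_mapsD(3)[OF R.d_map, of _ c] by (auto simp: free_module_def)
    qed
    ultimately show "f \<in> (\<lambda>f a. \<Sum>b<r (Suc (Suc i)). d (Suc i) a b * f b) ` free_module V (r (Suc (Suc i)))"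
      by (intro image_eqI[of _ _ h]) (auto simp: fun_eq_iff)
  next
    fix f assume "f \<in> (\<lambda>f a. \<Sum>b<r (Suc (Suc i)). d (Suc i) a b * f b) ` free_module V (r (Suc (Suc i)))"
    then obtain g where g: "g \<in> free_module V (r (Suc (Suc i)))"
        "f = (\<lambda>a. \<Sum>b<r (Suc (Suc i)). d (Suc i) a b * g b)" by blast
    have "f a = 0" if "a \<ge> r (Suc i)" for a
      unfolding g(2) using graded_mapsD(3)[OF R.d_map that] by simp
    moreover have "f a \<in> poly_ring V" for a
      unfolding g(2) using g(1) by (intro poly_ring_sum poly_ring_mult d_V) (auto simp: free_module_def)
    ultimately have "f \<in> free_module V (r (Suc i))"
      by (simp add: free_module_def)
    moreover have "(\<Sum>b<r (Suc i). d i a b * f b) = 0" for a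
      unfolding g(2) by (rule d_d)
    ultimately show "f \<in> {f \<in> free_module V (r (Suc i)). \<forall>a. (\<Sum>b<r (Suc i). d i a b * f b) = 0}"
      by simp
  qed
  have row0: "(\<forall>a. (\<Sum>b<r (Suc 0). d 0 a b * f b) = 0) \<longleftrightarrow> (\<Sum>b<r (Suc 0). d 0 0 b * f b) = 0" for f
  proof -
    have "d 0 a b = 0" if "a \<noteq> 0" for a b
      using that graded_mapsD(3)[OF R.d_map[of 0]] by (simp add: R.r0)
    then have "(\<Sum>b<r (Suc 0). d 0 a b * f b) = 0" if "a \<noteq> 0" for a
      using that by simp
    then show ?thesis by (metis (no_types))
  qed
  have "(\<lambda>f. \<Sum>b<r (Suc 0). d 0 0 b * f b) ` free_module V (r (Suc 0)) = I"
  proof (intro equalityI subsetI)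
    fix p assume "p \<in> I"
    then obtain g where g: "\<And>b. b < r (Suc 0) \<Longrightarrow> g b \<in> poly_ring V" "(\<Sum>b<r (Suc 0). d 0 0 b * g b) = p"
      using R.d0_onto by blast
    then show "p \<in> (\<lambda>f. \<Sum>b<r (Suc 0). d 0 0 b * f b) ` free_module V (r (Suc 0))"
      by (intro image_eqI[of _ _ "\<lambda>b. if b < r (Suc 0) then g b else 0"]) (auto simp: free_module_def)
  qed (auto simp: free_module_def intro: I)
  moreover have "homogeneous deg (e (Suc 0) b) (d 0 0 b)" for b
    using d_hom[of 0 b 0] by (simp add: R.e0)
  ultimately show ?thesis
    unfolding graded_free_resolution_def
    using ker_im[of 0] ker_im[of "Suc _"] d_hom d_V
    by (simp add: mat row0 fun_eq_iff)
qed

lemma gen_ideal_image: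
  assumes "inj_on h S"
  shows "gen_ideal V (h ` S) = {(\<Sum>x\<in>S. q x * h x) |q. \<forall>x\<in>S. q x \<in> poly_ring V}"
proof (intro equalityI subsetI)
  fix p assume "p \<in> gen_ideal V (h ` S)"
  then obtain q where q: "p = (\<Sum>g\<in>h ` S. q g * g)" "\<forall>g\<in>h ` S. q g \<in> poly_ring V"
    unfolding gen_ideal_def by blast
  have "p = (\<Sum>x\<in>S. (q \<circ> h) x * h x)" unfolding q(1) by (simp add: sum.reindex[OF assms])
  then show "p \<in> {(\<Sum>x\<in>S. q x * h x) |q. \<forall>x\<in>S. q x \<in> poly_ring V}" using q(2) by fastforce
next
  fix p assume "p \<in> {(\<Sum>x\<in>S. q x * h x) |q. \<forall>x\<in>S. q x \<in> poly_ring V}"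
  then obtain q where q: "p = (\<Sum>x\<in>S. q x * h x)" "\<forall>x\<in>S. q x \<in> poly_ring V" by blast
  have "p = (\<Sum>g\<in>h ` S. q (inv_into S h g) * g)" unfolding q(1) using assms by (simp add: sum.reindex)
  moreover have "\<forall>g\<in>h ` S. q (inv_into S h g) \<in> poly_ring V" using q(2) assms by auto
  ultimately show "p \<in> gen_ideal V (h ` S)"
    unfolding gen_ideal_def by (intro CollectI exI[of _ "\<lambda>g. q (inv_into S h g)"] conjI)
qed

definition faces :: "nat \<Rightarrow> nat \<Rightarrow> nat set set" where
  "faces N i = {A. A \<subseteq> {..<N} \<and> card A = i}"

text \<open>A numbering of the faces with \<open>i\<close> vertices, needed because bases of free modules are indexed by
initial segments of \<open>nat\<close>.\<close>

definition face :: "nat \<Rightarrow> nat \<Rightarrow> nat \<Rightarrow> nat set" where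
  "face N i = (SOME h. bij_betw h {..<card (faces N i)} (faces N i))"

definition face_index :: "nat \<Rightarrow> nat \<Rightarrow> nat set \<Rightarrow> nat" where
  "face_index N i = inv_into {..<card (faces N i)} (face N i)"

text \<open>The coefficient of the face \<open>B\<close> in the boundary of the face \<open>A\<close>; the sum has at most one nonzero term.\<close>

definition incidence :: "nat \<Rightarrow> nat set \<Rightarrow> nat set \<Rightarrow> 'k::field" where
  "incidence N B A = (\<Sum>x\<in>{..<N} - B. if insert x B = A then insertion_sign x B else 0)"

text \<open>The complex of a labelled simplex: the basis element of a face \<open>A\<close> has the degree of the label \<open>m A\<close>,
and the boundary coefficients are multiplied by the quotients of the labels. Number \<open>i\<close> counts
vertices, so that the empty face spans the polynomial ring itself, in accordance with \<open>aug_res\<close>.\<close>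

definition simplex_deg :: "('v \<Rightarrow> 'w \<Rightarrow> int) \<Rightarrow> nat \<Rightarrow> (nat set \<Rightarrow> 'v \<Rightarrow>\<^sub>0 nat) \<Rightarrow> nat \<Rightarrow> nat \<Rightarrow> 'w \<Rightarrow> int" where
  "simplex_deg deg N m i b = (if b < card (faces N i) then mon_degree deg (m (face N i b)) else 0)"

definition simplex_dif :: "nat \<Rightarrow> (nat set \<Rightarrow> 'v \<Rightarrow>\<^sub>0 nat) \<Rightarrow> nat \<Rightarrow> nat \<Rightarrow> nat \<Rightarrow> ('v, 'k::field) mpoly" where
  "simplex_dif N m i a b =
     (if a < card (faces N i) \<and> b < card (faces N (Suc i)) then
        Poly_Mapping.single (m (face N (Suc i) b) - m (face N i a)) (incidence N (face N i a) (face N (Suc i) b))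
      else 0)"

text \<open>The part of multidegree \<open>\<alpha>\<close> of an element of the free module. The basis element of \<open>A\<close> occurs there
with the monomial \<open>\<alpha> - m A\<close> (written additively), so that this part is a chain on the faces whose
labels divide \<open>\<alpha>\<close>.\<close>

definition strand ::
    "nat \<Rightarrow> (nat set \<Rightarrow> 'v \<Rightarrow>\<^sub>0 nat) \<Rightarrow> ('v \<Rightarrow>\<^sub>0 nat) \<Rightarrow> nat \<Rightarrow> (nat \<Rightarrow> ('v, 'k::field) mpoly) \<Rightarrow> nat set \<Rightarrow> 'k" where
  "strand N m \<alpha> i f A =
     (if A \<in> faces N i \<and> mono_dvd (m A) \<alpha> then Poly_Mapping.lookup (f (face_index N i A)) (\<alpha> - m A) else 0)"

lemma finite_faces: "finite (faces N i)"
  by (rule finite_subset[of _ "Pow {..<N}"]) (auto simp: faces_def)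

lemma face_bij: "bij_betw (face N i) {..<card (faces N i)} (faces N i)"
proof -
  have "\<exists>h. bij_betw h {..<card (faces N i)} (faces N i)"
    using ex_bij_betw_nat_finite[OF finite_faces, of N i] by (simp add: atLeast0LessThan)
  then show ?thesis unfolding face_def by (rule someI_ex)
qed

lemma face_in: "b < card (faces N i) \<Longrightarrow> face N i b \<in> faces N i"
  using face_bij[of N i] by (auto simp: bij_betw_def)

lemma face_index_less: "A \<in> faces N i \<Longrightarrow> face_index N i A < card (faces N i)"
  using face_bij[of N i] inv_into_into[of A "face N i" "{..<card (faces N i)}"]
  by (simp add: face_index_def bij_betw_def)

lemma face_face_index: "A \<in> faces N i \<Longrightarrow> face N i (face_index N i A) = A"
  using face_bij[of N i] by (simp add: face_index_def bij_betw_def f_inv_into_f)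

lemma face_index_face: "b < card (faces N i) \<Longrightarrow> face_index N i (face N i b) = b"
  using face_bij[of N i] by (simp add: face_index_def bij_betw_def inv_into_f_f)

lemma sum_faces: "(\<Sum>b<card (faces N i). h b) = (\<Sum>A\<in>faces N i. h (face_index N i A))"
proof -
  have "(\<Sum>b<card (faces N i). h b) = (\<Sum>b<card (faces N i). h (face_index N i (face N i b)))"
    by (rule sum.cong) (simp_all add: face_index_face)
  also have "\<dots> = (\<Sum>A\<in>faces N i. h (face_index N i A))"
    by (rule sum.reindex_bij_betw[OF face_bij])
  finally show ?thesis .
qed

lemma faces_0: "faces N 0 = {{}}"
  by (auto simp: faces_def dest: finite_subset)

lemma face_0: "face N 0 0 = {}"
  using face_in[of 0 N 0] by (simp add: faces_0)

lemma insert_in_faces: "x < N \<Longrightarrow> x \<notin> B \<Longrightarrow> insert x B \<in> faces N (Suc i) \<longleftrightarrow> B \<in> faces N i"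
  by (auto simp: faces_def card_insert_if dest: finite_subset)

lemma incidence_nonzero: "incidence N B A \<noteq> (0::'k::field) \<Longrightarrow> B \<subseteq> A"
proof (rule ccontr)
  assume *: "incidence N B A \<noteq> (0::'k)" "\<not> B \<subseteq> A"
  then have "insert x B \<noteq> A" for x by blast
  then show False using *(1) by (simp add: incidence_def)
qed

text \<open>Acyclicity is demanded only in the multidegrees that are divisible by the label of a vertex, that is,
by a generator; in all others the only face is the empty one.\<close>

locale labelled_simplex =
  fixes K :: "'k::field itself" and V :: "'v set" and N :: nat and m :: "nat set \<Rightarrow> 'v \<Rightarrow>\<^sub>0 nat"
  assumes label_mono: "A \<subseteq> B \<Longrightarrow> B \<subseteq> {..<N} \<Longrightarrow> mono_dvd (m A) (m B)"
    and label_empty: "m {} = 0"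
    and label_V: "A \<subseteq> {..<N} \<Longrightarrow> Poly_Mapping.keys (m A) \<subseteq> V"
    and acyclic: "x < N \<Longrightarrow> mono_dvd (m {x}) \<alpha> \<Longrightarrow> acyclic_complex K N {A. A \<subseteq> {..<N} \<and> mono_dvd (m A) \<alpha>}"
    and label_inj: "inj_on (\<lambda>x. m {x}) {..<N}"
begin

text \<open>This reduces exactness to simplicial homology, one multidegree at a time.\<close>

lemma strand_simplex_dif:
  fixes g :: "nat \<Rightarrow> ('v, 'k) mpoly"
  shows "strand N m \<alpha> i (\<lambda>a. \<Sum>b<card (faces N (Suc i)). simplex_dif N m i a b * g b) = boundary N (strand N m \<alpha> (Suc i) g)"
    (is "strand N m \<alpha> i ?dg = _")
proof
  fix B
  show "strand N m \<alpha> i ?dg B = boundary N (strand N m \<alpha> (Suc i) g) B"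
  proof (cases "B \<in> faces N i \<and> mono_dvd (m B) \<alpha>")
    case False
    have "strand N m \<alpha> (Suc i) g (insert x B) = 0" if x: "x \<in> {..<N} - B" for x
    proof (rule ccontr)
      assume "strand N m \<alpha> (Suc i) g (insert x B) \<noteq> 0"
      then have *: "insert x B \<in> faces N (Suc i)" "mono_dvd (m (insert x B)) \<alpha>"
        by (auto simp: strand_def split: if_splits)
      then have "B \<in> faces N i" using insert_in_faces x by auto
      moreover have "mono_dvd (m B) (m (insert x B))"
        using *(1) by (intro label_mono) (auto simp: faces_def)
      ultimately show False using False *(2) mono_dvd_trans by blast
    qed
    then show ?thesis using False by (auto simp: strand_def boundary_def)
  next
    case True
    let ?a = "face_index N i B"
    have a: "?a < card (faces N i)" "face N i ?a = B" using True face_index_less face_face_index by auto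
    have entry: "Poly_Mapping.lookup (simplex_dif N m i ?a (face_index N (Suc i) A) * g (face_index N (Suc i) A)) (\<alpha> - m B)
        = incidence N B A * strand N m \<alpha> (Suc i) g A" if A: "A \<in> faces N (Suc i)" for A
    proof (cases "incidence N B A = (0::'k)")
      case True
      then show ?thesis using A by (simp add: simplex_dif_def a face_face_index face_index_less)
    next
      case False
      then have "B \<subseteq> A" by (rule incidence_nonzero)
      then have BA: "mono_dvd (m B) (m A)" using A by (intro label_mono) (auto simp: faces_def)
      show ?thesis using A True
        by (simp add: simplex_dif_def a face_face_index face_index_less lookup_single_mult strand_def
            mono_dvd_diff_iff[OF _ BA] mono_dvd_diff_diff[OF BA])
    qed
    have "strand N m \<alpha> i ?dg B = (\<Sum>b<card (faces N (Suc i)). Poly_Mapping.lookup (simplex_dif N m i ?a b * g b) (\<alpha> - m B))"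
      using True by (simp add: strand_def lookup_sum)
    also have "\<dots> = (\<Sum>A\<in>faces N (Suc i). incidence N B A * strand N m \<alpha> (Suc i) g A)"
      unfolding sum_faces by (rule sum.cong) (simp_all add: entry)
    also have "\<dots> = (\<Sum>A\<in>faces N (Suc i). \<Sum>x\<in>{..<N} - B. if insert x B = A then insertion_sign x B * strand N m \<alpha> (Suc i) g A else 0)"
      unfolding incidence_def sum_distrib_right by (intro sum.cong) auto
    also have "\<dots> = (\<Sum>x\<in>{..<N} - B. \<Sum>A\<in>faces N (Suc i). if insert x B = A then insertion_sign x B * strand N m \<alpha> (Suc i) g A else 0)"
      by (rule sum.swap)
    also have "\<dots> = boundary N (strand N m \<alpha> (Suc i) g) B"
      unfolding boundary_def
    proof (rule sum.cong)
      fix x assume "x \<in> {..<N} - B"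
      then have "insert x B \<in> faces N (Suc i)" using True insert_in_faces by auto
      then show "(\<Sum>A\<in>faces N (Suc i). if insert x B = A then insertion_sign x B * strand N m \<alpha> (Suc i) g A else 0)
          = insertion_sign x B * strand N m \<alpha> (Suc i) g (insert x B)"
        using finite_faces by (simp add: sum.delta)
    qed simp
    finally show ?thesis .
  qed
qed

lemma strand_ext:
  fixes f g :: "nat \<Rightarrow> ('v, 'k) mpoly"
  assumes "\<And>\<alpha>. strand N m \<alpha> i f = strand N m \<alpha> i g" "a < card (faces N i)"
  shows "f a = g a"
proof (rule poly_mapping_eqI)
  fix t
  let ?A = "face N i a"
  have "strand N m (t + m ?A) i f ?A = strand N m (t + m ?A) i g ?A" using assms(1) by simp
  then show "Poly_Mapping.lookup (f a) t = Poly_Mapping.lookup (g a) t"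
    using assms(2) by (simp add: strand_def face_in face_index_face)
qed

lemma strand_cong: "(\<And>a. a < card (faces N i) \<Longrightarrow> f a = g a) \<Longrightarrow> strand N m \<alpha> i f = strand N m \<alpha> i g"
  by (auto simp: strand_def fun_eq_iff face_index_less)

text \<open>A cycle is filled in each multidegree separately. Only finitely many multidegrees occur in it, so
that the fillings \<open>E \<alpha>\<close> add up to an element \<open>g\<close> of the free module.\<close>

lemma simplex_exact:
  fixes v :: "nat \<Rightarrow> ('v, 'k) mpoly"
  assumes v: "\<And>c. c < card (faces N (Suc i)) \<Longrightarrow> v c \<in> poly_ring V"
    and cyc: "\<And>a. a < card (faces N i) \<Longrightarrow> (\<Sum>c<card (faces N (Suc i)). simplex_dif N m i a c * v c) = 0"
  shows "\<exists>g. (\<forall>b<card (faces N (Suc (Suc i))). g b \<in> poly_ring V) \<and>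
    (\<forall>c<card (faces N (Suc i)). (\<Sum>b<card (faces N (Suc (Suc i))). simplex_dif N m (Suc i) c b * g b) = v c)"
proof -
  define C where "C \<alpha> = strand N m \<alpha> (Suc i) v" for \<alpha>
  define \<Delta> where "\<Delta> \<alpha> = {A. A \<subseteq> {..<N} \<and> mono_dvd (m A) \<alpha>}" for \<alpha>
  have C_boundary: "boundary N (C \<alpha>) = 0" for \<alpha>
  proof -
    have "boundary N (C \<alpha>) = strand N m \<alpha> i (\<lambda>_. 0)"
      unfolding C_def strand_simplex_dif[symmetric] by (rule strand_cong) (simp add: cyc)
    then show ?thesis by (simp add: strand_def fun_eq_iff)
  qed
  have C_supp: "A \<in> faces N (Suc i)" "A \<in> \<Delta> \<alpha>" if "C \<alpha> A \<noteq> 0" for \<alpha> A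
    using that by (auto simp: C_def strand_def \<Delta>_def faces_def split: if_splits)
  have ex: "\<exists>e. supp_in e (faces N (Suc (Suc i)) \<inter> \<Delta> \<alpha>) \<and> boundary N e = C \<alpha> \<and> (C \<alpha> = 0 \<longrightarrow> e = 0)" for \<alpha>
  proof (cases "C \<alpha> = 0")
    case True
    then show ?thesis by (intro exI[of _ 0]) (simp add: supp_in_def)
  next
    case False
    then obtain A where A: "C \<alpha> A \<noteq> 0" by (auto simp: fun_eq_iff)
    have "card A = Suc i" using C_supp(1)[OF A] by (simp add: faces_def)
    then obtain x where x: "x \<in> A" by (metis card.empty ex_in_conv nat.distinct(1))
    have "A \<subseteq> {..<N}" "mono_dvd (m A) \<alpha>" using C_supp(2)[OF A] by (auto simp: \<Delta>_def)
    then have "x < N" "mono_dvd (m {x}) \<alpha>" using x label_mono[of "{x}" A] mono_dvd_trans by auto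
    then have "acyclic_complex K N (\<Delta> \<alpha>)" unfolding \<Delta>_def by (rule acyclic)
    moreover have "supp_in (C \<alpha>) (\<Delta> \<alpha>)" using C_supp by (auto simp: supp_in_def)
    ultimately obtain e where e: "supp_in e (\<Delta> \<alpha>)" "boundary N e = C \<alpha>"
      using C_boundary unfolding acyclic_complex_def by blast
    \<comment> \<open>The filling may have parts of other dimensions, which are discarded.\<close>
    define e' where "e' A = (if A \<in> faces N (Suc (Suc i)) then e A else 0)" for A
    have "boundary N e' B = C \<alpha> B" for B
    proof (cases "B \<in> faces N (Suc i)")
      case True
      then have "boundary N e' B = boundary N e B"
        unfolding boundary_def by (intro sum.cong) (auto simp: e'_def insert_in_faces)
      then show ?thesis by (simp add: e)
    next
      case False
      then have "boundary N e' B = 0"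
        unfolding boundary_def by (intro sum.neutral) (auto simp: e'_def insert_in_faces)
      then show ?thesis using C_supp(1)[of \<alpha> B] False by auto
    qed
    moreover have "supp_in e' (faces N (Suc (Suc i)) \<inter> \<Delta> \<alpha>)"
      using e(1) by (auto simp: supp_in_def e'_def split: if_splits)
    ultimately show ?thesis using False by blast
  qed
  then obtain E where E: "\<And>\<alpha>. supp_in (E \<alpha>) (faces N (Suc (Suc i)) \<inter> \<Delta> \<alpha>)" "\<And>\<alpha>. boundary N (E \<alpha>) = C \<alpha>"
      "\<And>\<alpha>. C \<alpha> = 0 \<Longrightarrow> E \<alpha> = 0" by metis
  define T where "T = {\<alpha>. C \<alpha> \<noteq> 0}"
  have T_form: "\<exists>b<card (faces N (Suc i)). \<exists>t\<in>Poly_Mapping.keys (v b). \<alpha> = t + m (face N (Suc i) b)" if "\<alpha> \<in> T" for \<alpha>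
  proof -
    obtain A where A: "C \<alpha> A \<noteq> 0" using \<open>\<alpha> \<in> T\<close> by (auto simp: T_def fun_eq_iff)
    have f: "A \<in> faces N (Suc i)" "mono_dvd (m A) \<alpha>" using C_supp[OF A] by (auto simp: \<Delta>_def)
    have "\<alpha> - m A \<in> Poly_Mapping.keys (v (face_index N (Suc i) A))"
      using A f by (simp add: C_def strand_def in_keys_iff)
    moreover have "\<alpha> = (\<alpha> - m A) + m (face N (Suc i) (face_index N (Suc i) A))"
      using mono_dvd_add_diff[OF f(2)] f(1) by (simp add: face_face_index add.commute)
    ultimately show ?thesis using face_index_less[OF f(1)] by blast
  qed
  have "T \<subseteq> (\<Union>b<card (faces N (Suc i)). (\<lambda>t. t + m (face N (Suc i) b)) ` Poly_Mapping.keys (v b))"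
    using T_form by blast
  then have finT: "finite T" by (rule finite_subset) simp
  have T_V: "Poly_Mapping.keys \<alpha> \<subseteq> V" if \<alpha>T: "\<alpha> \<in> T" for \<alpha>
  proof -
    obtain b t where bt: "b < card (faces N (Suc i))" "t \<in> Poly_Mapping.keys (v b)" "\<alpha> = t + m (face N (Suc i) b)"
      using T_form[OF \<alpha>T] by blast
    have "Poly_Mapping.keys t \<subseteq> V" using v[OF bt(1)] bt(2) by (auto simp: poly_ring_def)
    moreover have "Poly_Mapping.keys (m (face N (Suc i) b)) \<subseteq> V"
      by (rule label_V) (use face_in[OF bt(1)] in \<open>simp add: faces_def\<close>)
    ultimately show ?thesis by (simp add: bt(3) keys_add_nat)
  qed
  define g :: "nat \<Rightarrow> ('v, 'k) mpoly" where
    "g b = (\<Sum>\<alpha>\<in>T. Poly_Mapping.single (\<alpha> - m (face N (Suc (Suc i)) b)) (E \<alpha> (face N (Suc (Suc i)) b)))" for b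
  have "g b \<in> poly_ring V" for b
    unfolding g_def
  proof (rule poly_ring_sum)
    fix \<alpha> assume "\<alpha> \<in> T"
    then have "Poly_Mapping.keys (\<alpha> - m (face N (Suc (Suc i)) b)) \<subseteq> V"
      using T_V[of \<alpha>] by (auto simp: in_keys_iff lookup_minus subset_iff)
    then show "Poly_Mapping.single (\<alpha> - m (face N (Suc (Suc i)) b)) (E \<alpha> (face N (Suc (Suc i)) b)) \<in> poly_ring V"
      by (auto simp: poly_ring_def split: if_splits)
  qed
  moreover have sg: "strand N m \<alpha> (Suc (Suc i)) g = E \<alpha>" for \<alpha>
  proof
    fix A
    show "strand N m \<alpha> (Suc (Suc i)) g A = E \<alpha> A"
    proof (cases "A \<in> faces N (Suc (Suc i)) \<and> mono_dvd (m A) \<alpha>")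
      case False
      then have "E \<alpha> A = 0" using E(1)[of \<alpha>] by (auto simp: supp_in_def \<Delta>_def)
      then show ?thesis using False by (auto simp: strand_def)
    next
      case True
      have "strand N m \<alpha> (Suc (Suc i)) g A = (\<Sum>\<beta>\<in>T. if \<beta> - m A = \<alpha> - m A then E \<beta> A else 0)"
        using True by (simp add: strand_def g_def face_face_index lookup_sum lookup_single when_def)
      also have "\<dots> = (\<Sum>\<beta>\<in>T. if \<beta> = \<alpha> then E \<alpha> A else 0)"
      proof (rule sum.cong)
        fix \<beta>
        show "(if \<beta> - m A = \<alpha> - m A then E \<beta> A else 0) = (if \<beta> = \<alpha> then E \<alpha> A else 0)"
        proof (cases "E \<beta> A = 0")
          case False
          then have "mono_dvd (m A) \<beta>" using E(1)[of \<beta>] by (auto simp: supp_in_def \<Delta>_def)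
          then have "\<beta> - m A = \<alpha> - m A \<longleftrightarrow> \<beta> = \<alpha>" using True mono_dvd_add_diff by metis
          then show ?thesis by auto
        qed auto
      qed simp
      also have "\<dots> = E \<alpha> A" using finT E(3)[of \<alpha>] by (auto simp: T_def)
      finally show ?thesis .
    qed
  qed
  have "(\<Sum>b<card (faces N (Suc (Suc i))). simplex_dif N m (Suc i) c b * g b) = v c" if "c < card (faces N (Suc i))" for c
  proof (rule strand_ext[OF _ that])
    fix \<alpha>
    show "strand N m \<alpha> (Suc i) (\<lambda>c. \<Sum>b<card (faces N (Suc (Suc i))). simplex_dif N m (Suc i) c b * g b) = strand N m \<alpha> (Suc i) v"
      unfolding strand_simplex_dif sg E(2) by (simp add: C_def)
  qed
  ultimately show ?thesis by blast
qed

definition label_ideal :: "('v, 'k) mpoly set" where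
  "label_ideal = gen_ideal V ((\<lambda>x. Poly_Mapping.single (m {x}) 1) ` {..<N})"

lemma simplex_dif_0: "b < card (faces N (Suc 0)) \<Longrightarrow>
    simplex_dif N m 0 0 b = (Poly_Mapping.single (m (face N (Suc 0) b)) 1 :: ('v, 'k) mpoly)"
proof -
  assume b: "b < card (faces N (Suc 0))"
  then obtain x where x: "face N (Suc 0) b = {x}" "x < N"
    using face_in[OF b] by (auto simp: faces_def card_Suc_eq)
  have "incidence N {} {x} = (\<Sum>y<N. if y = x then 1 else 0 :: 'k)"
    unfolding incidence_def by (rule sum.cong) (auto simp: insertion_sign_def)
  then have "incidence N {} {x} = (1::'k)" using x by simp
  then show ?thesis using b by (simp add: simplex_dif_def faces_0 face_0 label_empty x)
qed

lemma label_ideal_eq: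
  "label_ideal = {(\<Sum>b<card (faces N (Suc 0)). simplex_dif N m 0 0 b * g b) |g. \<forall>b<card (faces N (Suc 0)). g b \<in> poly_ring V}"
proof -
  have "bij_betw (\<lambda>x. {x}) {..<N} (faces N (Suc 0))"
    by (rule bij_betwI') (auto simp: faces_def card_Suc_eq)
  then have reindex: "(\<Sum>A\<in>faces N (Suc 0). h A) = (\<Sum>x<N. h {x})" for h :: "nat set \<Rightarrow> ('v, 'k) mpoly"
    by (rule sum.reindex_bij_betw[symmetric])
  have "inj_on (\<lambda>x. Poly_Mapping.single (m {x}) (1::'k)) {..<N}"
  proof (rule inj_onI)
    fix x y assume xy: "x \<in> {..<N}" "y \<in> {..<N}" "Poly_Mapping.single (m {x}) (1::'k) = Poly_Mapping.single (m {y}) 1"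
    have "m {x} = m {y}" using arg_cong[OF xy(3), of Poly_Mapping.keys] by simp
    then show "x = y" using inj_onD[OF label_inj] xy by simp
  qed
  note gi = gen_ideal_image[OF this]
  have sum_eq: "(\<Sum>b<card (faces N (Suc 0)). simplex_dif N m 0 0 b * g b) =
      (\<Sum>x<N. g (face_index N (Suc 0) {x}) * Poly_Mapping.single (m {x}) 1)" for g :: "nat \<Rightarrow> ('v, 'k) mpoly"
  proof -
    have "(\<Sum>b<card (faces N (Suc 0)). simplex_dif N m 0 0 b * g b) =
        (\<Sum>A\<in>faces N (Suc 0). g (face_index N (Suc 0) A) * Poly_Mapping.single (m A) 1)"
      unfolding sum_faces
      by (rule sum.cong) (simp_all add: simplex_dif_0 face_index_less face_face_index mult.commute)
    then show ?thesis by (simp add: reindex)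
  qed
  have sing: "{x} \<in> faces N (Suc 0)" if "x < N" for x using that by (simp add: faces_def)
  show ?thesis
    unfolding label_ideal_def gi sum_eq
  proof (intro equalityI subsetI; clarify)
    fix q :: "nat \<Rightarrow> ('v, 'k) mpoly" assume q: "\<forall>x\<in>{..<N}. q x \<in> poly_ring V"
    define g where "g b = q (the_elem (face N (Suc 0) b))" for b
    have "g (face_index N (Suc 0) {x}) = q x" if "x < N" for x
      using sing[OF that] by (simp add: g_def face_face_index)
    then have "(\<Sum>x<N. q x * Poly_Mapping.single (m {x}) 1) =
        (\<Sum>x<N. g (face_index N (Suc 0) {x}) * Poly_Mapping.single (m {x}) 1)"
      by simp
    moreover have "g b \<in> poly_ring V" if "b < card (faces N (Suc 0))" for b
      using face_in[OF that] q by (auto simp: g_def faces_def card_Suc_eq)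
    ultimately show "\<exists>g. (\<Sum>x<N. q x * Poly_Mapping.single (m {x}) 1) =
        (\<Sum>x<N. g (face_index N (Suc 0) {x}) * Poly_Mapping.single (m {x}) 1) \<and>
        (\<forall>b<card (faces N (Suc 0)). g b \<in> poly_ring V)" by blast
  next
    fix g :: "nat \<Rightarrow> ('v, 'k) mpoly" assume "\<forall>b<card (faces N (Suc 0)). g b \<in> poly_ring V"
    then have "\<forall>x\<in>{..<N}. g (face_index N (Suc 0) {x}) \<in> poly_ring V"
      using face_index_less[OF sing] by auto
    then show "\<exists>q. (\<Sum>x<N. g (face_index N (Suc 0) {x}) * Poly_Mapping.single (m {x}) 1) =
        (\<Sum>x<N. q x * Poly_Mapping.single (m {x}) 1) \<and> (\<forall>x\<in>{..<N}. q x \<in> poly_ring V)"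
      by (intro exI[of _ "\<lambda>x. g (face_index N (Suc 0) {x})"]) simp
  qed
qed

lemma aug_res_labelled:
  "aug_res V deg label_ideal (\<lambda>i. card (faces N i)) (simplex_deg deg N m) (simplex_dif N m)"
proof
  show "card (faces N 0) = 1" by (simp add: faces_0)
  show "simplex_deg deg N m 0 = 0"
    by (auto simp: simplex_deg_def fun_eq_iff faces_0 face_0 label_empty)
  show "(simplex_dif N m i :: nat \<Rightarrow> nat \<Rightarrow> ('v, 'k) mpoly) \<in> graded_maps V deg (card (faces N (Suc i))) (simplex_deg deg N m (Suc i)) (card (faces N i)) (simplex_deg deg N m i)" for i
  proof (rule graded_mapsI)
    fix a b assume ab: "a < card (faces N i)" "b < card (faces N (Suc i))"
    let ?A = "face N (Suc i) b" and ?B = "face N i a"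
    have A: "?A \<subseteq> {..<N}" using face_in[OF ab(2)] by (simp add: faces_def)
    have "Poly_Mapping.keys (m ?A - m ?B) \<subseteq> V"
      using label_V[OF A] by (auto simp: in_keys_iff lookup_minus subset_iff)
    then show "(simplex_dif N m i a b :: ('v, 'k) mpoly) \<in> poly_ring V"
      using ab by (simp add: simplex_dif_def poly_ring_def)
    show "homogeneous deg (simplex_deg deg N m (Suc i) b - simplex_deg deg N m i a) (simplex_dif N m i a b :: ('v, 'k) mpoly)"
    proof (cases "incidence N ?B ?A = (0::'k)")
      case True
      then show ?thesis by (simp add: simplex_dif_def)
    next
      case False
      then have "?B \<subseteq> ?A" by (rule incidence_nonzero)
      then have "m ?B + (m ?A - m ?B) = m ?A" by (intro mono_dvd_add_diff label_mono A)
      then have "mon_degree deg (m ?A) = mon_degree deg (m ?B) + mon_degree deg (m ?A - m ?B)"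
        by (metis mon_degree_add)
      then show ?thesis using ab by (simp add: simplex_deg_def simplex_dif_def homogeneous_def)
    qed
  qed (auto simp: simplex_dif_def)
  show "mat_mul (card (faces N (Suc i))) (simplex_dif N m i) (simplex_dif N m (Suc i)) = (0 :: nat \<Rightarrow> nat \<Rightarrow> ('v, 'k) mpoly)" for i
  proof (intro ext)
    fix a c
    show "mat_mul (card (faces N (Suc i))) (simplex_dif N m i) (simplex_dif N m (Suc i)) a c = (0 :: nat \<Rightarrow> nat \<Rightarrow> ('v, 'k) mpoly) a c"
    proof (cases "a < card (faces N i) \<and> c < card (faces N (Suc (Suc i)))")
      case False
      then show ?thesis by (auto simp: mat_mul_def simplex_dif_def intro!: sum.neutral)
    next
      case True
      define u :: "nat \<Rightarrow> ('v, 'k) mpoly" where "u b = of_bool (b = c)" for b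
      have u: "simplex_dif N m (Suc i) b c = (\<Sum>c<card (faces N (Suc (Suc i))). simplex_dif N m (Suc i) b c * u c)" for b
      proof -
        have "(\<Sum>c'<card (faces N (Suc (Suc i))). simplex_dif N m (Suc i) b c' * u c')
            = (\<Sum>c'<card (faces N (Suc (Suc i))). if c' = c then simplex_dif N m (Suc i) b c else 0)"
          by (rule sum.cong) (auto simp: u_def)
        then show ?thesis using True by simp
      qed
      define w where "w a = (\<Sum>b<card (faces N (Suc i)). simplex_dif N m i a b *
          (\<Sum>c<card (faces N (Suc (Suc i))). simplex_dif N m (Suc i) b c * u c))" for a
      have "strand N m \<alpha> i w = strand N m \<alpha> i (\<lambda>_. 0)" for \<alpha>
        unfolding w_def strand_simplex_dif boundary_boundary by (simp add: strand_def fun_eq_iff)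
      then have "w a = (\<lambda>_. 0) a"
        using True by (intro strand_ext[where f = w and g = "\<lambda>_. 0" and i = i]) auto
      moreover have "mat_mul (card (faces N (Suc i))) (simplex_dif N m i) (simplex_dif N m (Suc i)) a c = w a"
        unfolding mat_mul_def w_def using u by simp
      ultimately show ?thesis by simp
    qed
  qed
  show "simplex_dif N m 0 0 b \<in> label_ideal" if b: "b < card (faces N (Suc 0))" for b
  proof -
    have "(\<Sum>c<card (faces N (Suc 0)). simplex_dif N m 0 0 c * of_bool (c = b)) = (\<Sum>c<card (faces N (Suc 0)). if c = b then simplex_dif N m 0 0 b else 0 :: ('v, 'k) mpoly)"
      by (rule sum.cong) auto
    also have "\<dots> = simplex_dif N m 0 0 b" using b by simp
    finally have "simplex_dif N m 0 0 b = (\<Sum>c<card (faces N (Suc 0)). simplex_dif N m 0 0 c * of_bool (c = b) :: ('v, 'k) mpoly)" ..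
    moreover have "\<forall>c<card (faces N (Suc 0)). (of_bool (c = b) :: ('v, 'k) mpoly) \<in> poly_ring V" by (simp add: of_bool_def)
    ultimately show ?thesis unfolding label_ideal_eq by (intro CollectI exI[of _ "\<lambda>c. of_bool (c = b)"]) blast
  qed
  show "\<exists>g. (\<forall>b<card (faces N (Suc 0)). g b \<in> poly_ring V) \<and> (\<Sum>b<card (faces N (Suc 0)). simplex_dif N m 0 0 b * g b) = p"
    if "p \<in> label_ideal" for p
    using that unfolding label_ideal_eq by blast
qed (rule simplex_exact)

end

definition labelled_complex ::
    "('v \<Rightarrow> 'w \<Rightarrow> int) \<Rightarrow> nat \<Rightarrow> (nat set \<Rightarrow> 'v \<Rightarrow>\<^sub>0 nat) \<Rightarrow> ('v, 'w, 'k::field) free_complex" where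
  "labelled_complex deg N m = \<lparr>rk = \<lambda>i. card (faces N (Suc i)), bdeg = \<lambda>i. simplex_deg deg N m (Suc i),
     dif = \<lambda>i. simplex_dif N m (Suc i), aug = simplex_dif N m 0 0\<rparr>"

theorem (in labelled_simplex) labelled_resolution:
  "graded_free_resolution V deg (gen_ideal V ((\<lambda>x. Poly_Mapping.single (m {x}) 1) ` {..<N}))
     (labelled_complex deg N m :: ('v, 'w, 'k) free_complex)"
  unfolding labelled_complex_def label_ideal_def[symmetric]
  by (rule resolution_of_aug_res[OF aug_res_labelled]) (auto simp: label_ideal_eq)

section \<open>Coarsening the grading\<close>

lemma dim_zero_space: "fs.dim {0 :: nat \<Rightarrow> 'k::field} = 0"
  by (metis card.empty fs.dim_span_eq_card_independent fs.independent_empty fs.span_empty)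

text \<open>After tensoring with \<open>k\<close>, differentials preserve the degrees of basis elements, hence commute with
taking components.\<close>

lemma tensor_dif_restr:
  fixes F :: "('v, 'w, 'k::field) free_complex"
  assumes "graded_free_resolution V deg I F"
  shows "tensor_dif F j (restr (bdeg F (Suc j)) \<gamma> x) = restr (bdeg F j) \<gamma> (tensor_dif F j x)"
proof
  fix a
  interpret F: aug_res V deg I "aug_rk F" "aug_bdeg F" "aug_dif F"
    by (rule aug_res_of_resolution[OF assms])
  have "bdeg F (Suc j) b = bdeg F j a" if "const_mat (aug_dif F (Suc j)) a b \<noteq> 0" for b
    using homogeneous_constant_coeff[OF graded_mapsD(2)[OF F.d_map[of "Suc j"], simplified]] that
    by (simp add: const_mat_def)
  then have "const_mat (aug_dif F (Suc j)) a b * restr (bdeg F (Suc j)) \<gamma> x b =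
      (if bdeg F j a = \<gamma> then const_mat (aug_dif F (Suc j)) a b * x b else 0)" for b
    by (cases "const_mat (aug_dif F (Suc j)) a b = 0") (auto simp: restr_def)
  then show "tensor_dif F j (restr (bdeg F (Suc j)) \<gamma> x) a = restr (bdeg F j) \<gamma> (tensor_dif F j x) a"
    unfolding tensor_dif_mat_vec mat_vec_def by (simp add: restr_def)
qed

text \<open>The differentials preserve the finer degrees, so that cycles and boundaries of the coarser degree \<open>\<alpha>\<close>
are the direct sums of those of the finer degrees in \<open>\<Gamma>\<close>.\<close>

lemma tor_dim_coarsen:
  fixes F :: "('v, 'w, 'k::field) free_complex" and F' :: "('v, 'u, 'k) free_complex"
  assumes F: "graded_free_resolution V deg I F"
    and same: "rk F' = rk F" "dif F' = dif F"
    and \<Gamma>: "finite \<Gamma>" "\<And>j b. b < rk F j \<Longrightarrow> bdeg F' j b = \<alpha> \<longleftrightarrow> bdeg F j b \<in> \<Gamma>"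
  shows "fs.dim (tor_cycles F' i \<alpha>) - fs.dim (tor_boundaries F' i \<alpha>) =
    (\<Sum>\<gamma>\<in>\<Gamma>. fs.dim (tor_cycles F i \<gamma>) - fs.dim (tor_boundaries F i \<gamma>))"
proof -
  let ?r = "\<lambda>j. restr (bdeg F j)"
  let ?S = "\<lambda>U. {x. (\<forall>b. x b \<noteq> 0 \<longrightarrow> bdeg F i b \<in> \<Gamma>) \<and> (\<forall>\<gamma>\<in>\<Gamma>. ?r i \<gamma> x \<in> U \<gamma>)}"
  have d': "tensor_dif F' j = tensor_dif F j" for j by (simp add: tensor_dif_def same)
  have part': "tensor_part F' j \<alpha> = {x. \<forall>b. x b \<noteq> 0 \<longrightarrow> b < rk F j \<and> bdeg F j b \<in> \<Gamma>}" for j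
    using \<Gamma>(2) by (auto simp: tensor_part_def same)
  have restr_part: "?r j \<gamma> x \<in> tensor_part F j \<gamma>" if "x \<in> tensor_part F' j \<alpha>" for j \<gamma> x
    using that unfolding part' by (auto simp: tensor_part_def restr_def)
  have d0: "tensor_dif F j 0 = 0" for j by (rule module_hom.zero[OF tensor_dif_hom])
  have restr_out: "?r j \<gamma> x = 0" if "x \<in> tensor_part F' j \<alpha>" "\<gamma> \<notin> \<Gamma>" for j \<gamma> x
    using that unfolding part' by (intro ext) (auto simp: restr_def)
  have Z: "tor_cycles F' i \<alpha> = ?S (tor_cycles F i)"
  proof (intro equalityI subsetI)
    fix x assume x: "x \<in> tor_cycles F' i \<alpha>"
    then have xp: "x \<in> tensor_part F' i \<alpha>" by (simp add: tor_cycles_def)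
    have "?r i \<gamma> x \<in> tor_cycles F i \<gamma>" for \<gamma>
    proof (cases i)
      case 0
      then show ?thesis using restr_part[OF xp] by (simp add: tor_cycles_def)
    next
      case (Suc j)
      then have "tensor_dif F j x = 0" using x by (simp add: tor_cycles_def d')
      then have "tensor_dif F j (?r (Suc j) \<gamma> x) = 0"
        unfolding tensor_dif_restr[OF F] by (simp add: restr_def fun_eq_iff)
      then show ?thesis using restr_part[OF xp] Suc by (simp add: tor_cycles_def)
    qed
    then show "x \<in> ?S (tor_cycles F i)" using xp unfolding part' by blast
  next
    fix x assume x: "x \<in> ?S (tor_cycles F i)"
    have "b < rk F i \<and> bdeg F i b \<in> \<Gamma>" if b: "x b \<noteq> 0" for b
    proof -
      have "bdeg F i b \<in> \<Gamma>" using x b by blast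
      then have "?r i (bdeg F i b) x \<in> tor_cycles F i (bdeg F i b)" using x by blast
      moreover have "?r i (bdeg F i b) x b \<noteq> 0" using b by (simp add: restr_def)
      ultimately have "b < rk F i" using tor_cycles_bounded by blast
      then show ?thesis using \<open>bdeg F i b \<in> \<Gamma>\<close> by blast
    qed
    then have xp: "x \<in> tensor_part F' i \<alpha>" unfolding part' by blast
    moreover have "tensor_dif F j x = 0" if i: "i = Suc j" for j
    proof
      fix a
      let ?\<gamma> = "bdeg F j a"
      have "?r (Suc j) ?\<gamma> x \<in> tor_cycles F (Suc j) ?\<gamma> \<or> ?r (Suc j) ?\<gamma> x = 0"
        using x restr_out[OF xp] i by blast
      then have "tensor_dif F j (?r (Suc j) ?\<gamma> x) = 0"
        by (auto simp: tor_cycles_def d0)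
      then have "?r j ?\<gamma> (tensor_dif F j x) a = 0" unfolding tensor_dif_restr[OF F] by simp
      then show "tensor_dif F j x a = 0 a" by (simp add: restr_def)
    qed
    ultimately show "x \<in> tor_cycles F' i \<alpha>" by (simp add: tor_cycles_def d' split: nat.split)
  qed
  have B: "tor_boundaries F' i \<alpha> = ?S (tor_boundaries F i)"
  proof (intro equalityI subsetI)
    fix x assume "x \<in> tor_boundaries F' i \<alpha>"
    then obtain y where y: "y \<in> tensor_part F' (Suc i) \<alpha>" "x = tensor_dif F i y"
      unfolding tor_boundaries_def d' by blast
    have rx: "?r i \<gamma> x = tensor_dif F i (?r (Suc i) \<gamma> y)" for \<gamma>
      unfolding y(2) tensor_dif_restr[OF F] ..
    then have "?r i \<gamma> x \<in> tor_boundaries F i \<gamma>" for \<gamma>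
      unfolding tor_boundaries_def using restr_part[OF y(1)] by blast
    moreover have "bdeg F i b \<in> \<Gamma>" if "x b \<noteq> 0" for b
    proof (rule ccontr)
      assume "bdeg F i b \<notin> \<Gamma>"
      then have "?r i (bdeg F i b) x = 0" using rx restr_out[OF y(1)] d0 by simp
      then have "?r i (bdeg F i b) x b = 0" by simp
      then show False using that by (simp add: restr_def)
    qed
    ultimately show "x \<in> ?S (tor_boundaries F i)" by blast
  next
    fix x assume x: "x \<in> ?S (tor_boundaries F i)"
    have "\<forall>\<gamma>\<in>\<Gamma>. \<exists>y. y \<in> tensor_part F (Suc i) \<gamma> \<and> tensor_dif F i y = ?r i \<gamma> x"
    proof
      fix \<gamma> assume "\<gamma> \<in> \<Gamma>"
      then have "?r i \<gamma> x \<in> tensor_dif F i ` tensor_part F (Suc i) \<gamma>"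
        using x by (simp add: tor_boundaries_def)
      then show "\<exists>y. y \<in> tensor_part F (Suc i) \<gamma> \<and> tensor_dif F i y = ?r i \<gamma> x"
        by (rule imageE) (metis)
    qed
    then obtain y where y: "\<And>\<gamma>. \<gamma> \<in> \<Gamma> \<Longrightarrow> y \<gamma> \<in> tensor_part F (Suc i) \<gamma>"
        "\<And>\<gamma>. \<gamma> \<in> \<Gamma> \<Longrightarrow> tensor_dif F i (y \<gamma>) = ?r i \<gamma> x" by metis
    \<comment> \<open>Preimages of the components add up to a preimage of \<open>x\<close>.\<close>
    have "(\<Sum>\<gamma>\<in>\<Gamma>. y \<gamma>) \<in> tensor_part F' (Suc i) \<alpha>"
      unfolding part'
    proof (intro CollectI allI impI)
      fix b assume "(\<Sum>\<gamma>\<in>\<Gamma>. y \<gamma>) b \<noteq> 0"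
      then obtain \<gamma> where "\<gamma> \<in> \<Gamma>" "y \<gamma> b \<noteq> 0" unfolding sum_apply by (meson sum.not_neutral_contains_not_neutral)
      then show "b < rk F (Suc i) \<and> bdeg F (Suc i) b \<in> \<Gamma>" using y(1) by (auto simp: tensor_part_def)
    qed
    moreover have "tensor_dif F' i (\<Sum>\<gamma>\<in>\<Gamma>. y \<gamma>) = x"
    proof
      fix a
      have "tensor_dif F' i (\<Sum>\<gamma>\<in>\<Gamma>. y \<gamma>) a = (\<Sum>\<gamma>\<in>\<Gamma>. ?r i \<gamma> x) a"
        unfolding d' module_hom.sum[OF tensor_dif_hom] using y(2) by simp
      also have "\<dots> = (\<Sum>\<gamma>\<in>\<Gamma>. if \<gamma> = bdeg F i a then x a else 0)"
        unfolding sum_apply by (rule sum.cong) (auto simp: restr_def)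
      also have "\<dots> = x a" using x \<Gamma>(1) by auto
      finally show "tensor_dif F' i (\<Sum>\<gamma>\<in>\<Gamma>. y \<gamma>) a = x a" .
    qed
    ultimately show "x \<in> tor_boundaries F' i \<alpha>" unfolding tor_boundaries_def by blast
  qed
  have "fs.dim (tor_cycles F' i \<alpha>) = (\<Sum>\<gamma>\<in>\<Gamma>. fs.dim (tor_cycles F i \<gamma>))"
    unfolding Z by (rule fs_dim_graded[OF \<Gamma>(1) subspace_tor_cycles, where r = "rk F i"])
      (drule (1) tor_cycles_bounded, simp)
  moreover have "fs.dim (tor_boundaries F' i \<alpha>) = (\<Sum>\<gamma>\<in>\<Gamma>. fs.dim (tor_boundaries F i \<gamma>))"
    unfolding B by (rule fs_dim_graded[OF \<Gamma>(1) subspace_tor_boundaries, where r = "rk F i"])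
      (drule subsetD[OF tor_boundaries_le_cycles[OF F]], drule (1) tor_cycles_bounded, simp)
  moreover have "fs.dim (tor_boundaries F i \<gamma>) \<le> fs.dim (tor_cycles F i \<gamma>)" for \<gamma>
    by (rule fs_dim_mono[OF subspace_tor_boundaries subspace_tor_cycles _ tor_boundaries_le_cycles[OF F], where r = "rk F i"])
      (drule (1) tor_cycles_bounded, simp)
  ultimately show ?thesis by (simp add: sum_subtractf_nat)
qed

text \<open>The complex tensored with \<open>k\<close> depends only on ranks, basis degrees and constant coefficients, so it may
be compared between resolutions over different polynomial rings.\<close>

lemma tor_cong:
  fixes F :: "('v, 'w, 'k::field) free_complex" and F' :: "('u, 'w, 'k) free_complex"
  assumes "rk F = rk F'" "\<And>j b. b < rk F j \<Longrightarrow> bdeg F j b = bdeg F' j b"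
    "\<And>j a b. a < rk F j \<Longrightarrow> b < rk F (Suc j) \<Longrightarrow> Poly_Mapping.lookup (dif F j a b) 0 = Poly_Mapping.lookup (dif F' j a b) 0"
  shows "tor_cycles F i \<alpha> = tor_cycles F' i \<alpha>" "tor_boundaries F i \<alpha> = tor_boundaries F' i \<alpha>"
proof -
  have 1: "tensor_part F j \<alpha> = tensor_part F' j \<alpha>" for j
    using assms(1,2) by (auto simp: tensor_part_def)
  have 2: "tensor_dif F j = tensor_dif F' j" for j
    using assms(1,3) by (auto simp: tensor_dif_def mat_app_def fun_eq_iff)
  show "tor_cycles F i \<alpha> = tor_cycles F' i \<alpha>" "tor_boundaries F i \<alpha> = tor_boundaries F' i \<alpha>"
    by (cases i; simp add: tor_cycles_def tor_boundaries_def 1 2)+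
qed

lemma tor_zero_outside:
  assumes "\<And>b. b < rk F i \<Longrightarrow> bdeg F i b \<noteq> \<alpha>"
  shows "fs.dim (tor_cycles F i \<alpha>) = 0"
proof -
  have "x = 0" if "x \<in> tor_cycles F i \<alpha>" for x
    using assms tor_cycles_bounded[OF that] by (auto simp: fun_eq_iff)
  then have "tor_cycles F i \<alpha> = {0}"
    using fs.subspace_0[OF subspace_tor_cycles] by blast
  then show ?thesis by (simp add: dim_zero_space)
qed

section \<open>Squarefree labels\<close>

definition var_prod :: "'v set \<Rightarrow> 'v \<Rightarrow>\<^sub>0 nat" where
  "var_prod S = (\<Sum>v\<in>S. Poly_Mapping.single v 1)"

lemma lookup_var_prod: "finite S \<Longrightarrow> Poly_Mapping.lookup (var_prod S) v = of_bool (v \<in> S)"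
  by (simp add: var_prod_def lookup_sum lookup_single when_def of_bool_def)

lemma keys_var_prod: "finite S \<Longrightarrow> Poly_Mapping.keys (var_prod S) = S"
  by (auto simp: in_keys_iff lookup_var_prod)

lemma mono_dvd_var_prod: "finite S \<Longrightarrow> mono_dvd (var_prod S) \<alpha> \<longleftrightarrow> (\<forall>v\<in>S. 1 \<le> Poly_Mapping.lookup \<alpha> v)"
  by (auto simp: mono_dvd_def lookup_var_prod of_bool_def)

lemma mono_dvd_var_prod_var_prod: "finite S \<Longrightarrow> finite T \<Longrightarrow> mono_dvd (var_prod S) (var_prod T) \<longleftrightarrow> S \<subseteq> T"
  by (auto simp: mono_dvd_var_prod lookup_var_prod)

lemma mon_degree_var_prod: "finite S \<Longrightarrow> mon_degree deg (var_prod S) = (\<lambda>w. \<Sum>v\<in>S. deg v w)"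
  by (simp add: mon_degree_def keys_var_prod lookup_var_prod)

lemma mon_degree_fine: "mon_degree fine_deg m = (\<lambda>v. int (Poly_Mapping.lookup m v))"
proof
  fix w
  have "mon_degree fine_deg m w = (\<Sum>v\<in>Poly_Mapping.keys m. if v = w then int (Poly_Mapping.lookup m w) else 0)"
    unfolding mon_degree_def by (rule sum.cong) (auto simp: fine_deg_def)
  then show "mon_degree fine_deg m w = int (Poly_Mapping.lookup m w)" by (simp add: in_keys_iff)
qed

lemma mon_degree_fine_var_prod: "finite S \<Longrightarrow> mon_degree fine_deg (var_prod S) = set_deg S"
  by (simp add: mon_degree_fine lookup_var_prod set_deg_def)

lemma mon_degree_sp_var_prod:
  assumes "finite X" "finite Y"
  shows "mon_degree sp_deg (var_prod (X <+> Y)) = set_deg X + set_deg Y"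
proof
  fix w
  have "mon_degree sp_deg (var_prod (X <+> Y)) w = (\<Sum>v\<in>X. of_bool (w = v)) + (\<Sum>v\<in>Y. of_bool (w = v))"
    using assms by (simp add: mon_degree_var_prod sum.Plus sp_deg_def fine_deg_def)
  then show "mon_degree sp_deg (var_prod (X <+> Y)) w = (set_deg X + set_deg Y) w"
    using assms by (simp add: set_deg_def of_bool_def)
qed

lemma set_deg_inj: "set_deg S = set_deg T \<longleftrightarrow> S = T"
proof
  assume eq: "set_deg S = set_deg T"
  have "v \<in> S \<longleftrightarrow> v \<in> T" for v
    using fun_cong[OF eq, of v] by (cases "v \<in> S"; cases "v \<in> T") (simp_all add: set_deg_def)
  then show "S = T" by blast
qed simp

text \<open>The Taylor resolution: a squarefree label divides \<open>\<alpha>\<close> if and only if the labels of all its vertices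
do, so the faces in multidegree \<open>\<alpha>\<close> form a simplex.\<close>

lemma taylor_simplex:
  fixes S :: "nat \<Rightarrow> 'v set"
  assumes S: "\<And>x. x < N \<Longrightarrow> finite (S x)" "\<And>x. x < N \<Longrightarrow> S x \<subseteq> V" and inj: "inj_on S {..<N}"
  shows "labelled_simplex (K :: 'k::field itself) V N (\<lambda>A. var_prod (\<Union>x\<in>A. S x))"
proof
  have fin: "finite (\<Union>x\<in>A. S x)" if "A \<subseteq> {..<N}" for A
    using S(1) that finite_subset[OF that] by auto
  show "mono_dvd (var_prod (\<Union>x\<in>A. S x)) (var_prod (\<Union>x\<in>B. S x))" if AB: "A \<subseteq> B" "B \<subseteq> {..<N}" for A B
  proof -
    have "A \<subseteq> {..<N}" using AB by blast
    then show ?thesis using AB by (auto simp: mono_dvd_var_prod fin lookup_var_prod)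
  qed
  show "var_prod (\<Union>x\<in>{}. S x) = 0" by (simp add: var_prod_def)
  show "Poly_Mapping.keys (var_prod (\<Union>x\<in>A. S x)) \<subseteq> V" if "A \<subseteq> {..<N}" for A
    using S(2) that by (auto simp: keys_var_prod fin)
  show "acyclic_complex K N {A. A \<subseteq> {..<N} \<and> mono_dvd (var_prod (\<Union>x\<in>A. S x)) \<alpha>}"
    if x: "x < N" "mono_dvd (var_prod (\<Union>x\<in>{x}. S x)) \<alpha>" for x \<alpha>
  proof -
    define T where "T = {x. x < N \<and> mono_dvd (var_prod (S x)) \<alpha>}"
    have T: "T = {x. x < N \<and> (\<forall>v\<in>S x. 1 \<le> Poly_Mapping.lookup \<alpha> v)}"
      unfolding T_def using mono_dvd_var_prod[OF S(1)] by auto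
    have "A \<subseteq> {..<N} \<and> mono_dvd (var_prod (\<Union>x\<in>A. S x)) \<alpha> \<longleftrightarrow> A \<subseteq> T" for A
      using mono_dvd_var_prod[OF fin, of A \<alpha>] unfolding T by auto
    then have "{A. A \<subseteq> {..<N} \<and> mono_dvd (var_prod (\<Union>x\<in>A. S x)) \<alpha>} = Pow T"
      by auto
    moreover have "T \<subseteq> {..<N}" "T \<noteq> {}" using x by (auto simp: T_def)
    ultimately show ?thesis using acyclic_simplex[of T N] by (simp add: acyclic_complex_def)
  qed
  show "inj_on (\<lambda>x. var_prod (\<Union>x\<in>{x}. S x)) {..<N}"
  proof (rule inj_onI)
    fix x y assume xy: "x \<in> {..<N}" "y \<in> {..<N}" "var_prod (\<Union>x\<in>{x}. S x) = var_prod (\<Union>x\<in>{y}. S x)"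
    then have "Poly_Mapping.keys (var_prod (S x)) = Poly_Mapping.keys (var_prod (S y))" by simp
    then have "S x = S y" using keys_var_prod[OF S(1)] xy(1,2) by simp
    then show "x = y" using inj_onD[OF inj] xy by blast
  qed
qed

section \<open>Transitive relations\<close>

text \<open>The faces of one multidegree of the specialized complex: \<open>s\<close> and \<open>t\<close> give the sources and targets of
numbered edges, and \<open>W\<close> collects the vertices that may play only one of the two roles.\<close>

definition edge_sets ::
    "nat \<Rightarrow> (nat \<Rightarrow> 'a) \<Rightarrow> (nat \<Rightarrow> 'a) \<Rightarrow> 'a set \<Rightarrow> 'a set \<Rightarrow> 'a set \<Rightarrow> nat set set" where
  "edge_sets N s t R C W = {A. A \<subseteq> {..<N} \<and> (\<forall>a\<in>A. s a \<in> R \<and> t a \<in> C) \<and>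
     (\<forall>a\<in>A. \<forall>b\<in>A. s a = t b \<longrightarrow> s a \<notin> W)}"

lemma down_closed_edge_sets: "down_closed (edge_sets N s t R C W)"
  unfolding down_closed_def
proof (intro ballI allI impI)
  fix A B assume "A \<in> edge_sets N s t R C W" "B \<subseteq> A"
  then show "B \<in> edge_sets N s t R C W"
    unfolding edge_sets_def mem_Collect_eq by (meson subset_iff)
qed

text \<open>For \<open>W = {}\<close> the family is a simplex. A vertex \<open>w\<close> is added to \<open>W\<close> by forbidding it as a source or
forbidding it as a target. If both parts contain edges, then so does their intersection: an edge that
ends in \<open>w\<close> and one that starts in \<open>w\<close> compose to an edge by transitivity. If one part
contains no edge, it is negligible, as the empty set is in the other part too.\<close>

lemma acyclic_edge_sets:
  fixes s t :: "nat \<Rightarrow> 'a" and K :: "'k::field itself"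
  assumes "finite W"
    and trans: "\<And>x y. x < N \<Longrightarrow> y < N \<Longrightarrow> t x = s y \<Longrightarrow> \<exists>z<N. s z = s x \<and> t z = t y"
    and irrefl: "\<And>x. x < N \<Longrightarrow> s x \<noteq> t x"
    and "\<exists>x<N. s x \<in> R \<and> t x \<in> C"
  shows "acyclic_complex K N (edge_sets N s t R C W)"
  using assms(1,4)
proof (induction W arbitrary: R C rule: finite_induct)
  case empty
  let ?S = "{x. x < N \<and> s x \<in> R \<and> t x \<in> C}"
  have "edge_sets N s t R C {} = Pow ?S" by (auto simp: edge_sets_def)
  moreover have "?S \<subseteq> {..<N}" "?S \<noteq> {}" using empty by auto
  ultimately show ?case using acyclic_simplex[of ?S N] by (simp add: acyclic_complex_def)
next
  case (insert w W)
  let ?\<Delta>\<^sub>1 = "edge_sets N s t (R - {w}) C W" and ?\<Delta>\<^sub>2 = "edge_sets N s t R (C - {w}) W"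
  let ?v = "\<lambda>R C. \<exists>x<N. s x \<in> R \<and> t x \<in> C"
  have Un: "edge_sets N s t R C (insert w W) = ?\<Delta>\<^sub>1 \<union> ?\<Delta>\<^sub>2"
    by (rule set_eqI) (auto simp: edge_sets_def)
  have Int: "?\<Delta>\<^sub>1 \<inter> ?\<Delta>\<^sub>2 = edge_sets N s t (R - {w}) (C - {w}) W"
    by (rule set_eqI) (auto simp: edge_sets_def)
  have trivial: "edge_sets N s t R' C' W \<subseteq> {{}}" if "\<not> ?v R' C'" for R' C'
    using that by (auto simp: edge_sets_def subset_iff)
  have empty_in: "{} \<in> edge_sets N s t R' C' W" for R' C' by (simp add: edge_sets_def)
  show ?case
  proof (cases "?v (R - {w}) C \<and> ?v R (C - {w})")
    case True
    then obtain x y where xy: "x < N" "s x \<in> R - {w}" "t x \<in> C" "y < N" "s y \<in> R" "t y \<in> C - {w}" by blast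
    have "?v (R - {w}) (C - {w})"
    proof (cases "t x = w \<and> s y = w")
      case True
      then obtain z where "z < N" "s z = s x" "t z = t y" using trans[of x y] xy by auto
      then show ?thesis using xy by auto
    next
      case False
      then show ?thesis using xy by blast
    qed
    then show ?thesis
      unfolding Un using True insert.IH
      by (intro acyclic_Un down_closed_edge_sets) (auto simp: Int)
  next
    case False
    obtain x where x: "x < N" "s x \<in> R" "t x \<in> C" using insert.prems by blast
    have "s x \<noteq> w \<or> t x \<noteq> w" using irrefl[OF x(1)] by auto
    then have "?v (R - {w}) C \<or> ?v R (C - {w})" using x by blast
    then consider "?v (R - {w}) C" "\<not> ?v R (C - {w})" | "\<not> ?v (R - {w}) C" "?v R (C - {w})"
      using False by blast
    then show ?thesis
    proof cases
      case 1
      then have "?\<Delta>\<^sub>1 \<union> ?\<Delta>\<^sub>2 = ?\<Delta>\<^sub>1" using trivial[OF 1(2)] empty_in by blast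
      then show ?thesis unfolding Un using insert.IH[OF 1(1)] by simp
    next
      case 2
      then have "?\<Delta>\<^sub>1 \<union> ?\<Delta>\<^sub>2 = ?\<Delta>\<^sub>2" using trivial[OF 2(1)] empty_in by blast
      then show ?thesis unfolding Un using insert.IH[OF 2(2)] by simp
    qed
  qed
qed

lemma shifted_skew_diagram_less: "shifted_skew_diagram D \<Longrightarrow> (i, j) \<in> D \<Longrightarrow> i < j"
  unfolding shifted_skew_diagram_def by auto

lemma shifted_skew_diagram_trans:
  assumes "shifted_skew_diagram D" "(i, p) \<in> D" "(p, j) \<in> D"
  shows "(i, j) \<in> D"
proof -
  obtain l lam mu where lam: "\<forall>i\<in>{1..l}. \<forall>j\<in>{1..l}. i < j \<longrightarrow> lam j < lam i"
    and D: "D = {(i::nat, j::nat). 1 \<le> i \<and> i \<le> l \<and> i + mu i + 1 \<le> j \<and> j \<le> i + (lam i::nat)}"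
    using assms(1) unfolding shifted_skew_diagram_def by blast
  have i: "1 \<le> i" and p: "p \<le> l" and ip: "i \<le> p" using assms by (auto simp: D)
  from ip p have "p + lam p \<le> i + lam i"
  proof (induction p rule: dec_induct)
    case (step q)
    then have "lam (Suc q) < lam q" using i by (intro lam[rule_format]) auto
    then show ?case using step by simp
  qed simp
  then show ?thesis using assms by (auto simp: D)
qed

section \<open>The edge ideals of a transitive relation\<close>

text \<open>The pairs in \<open>D\<close> are numbered so that sets of edges become faces of a simplex with vertices \<open>{..<N}\<close>.\<close>

locale transitive_edges =
  fixes n :: nat and D :: "(nat \<times> nat) set" and N :: nat and s t :: "nat \<Rightarrow> nat"
  assumes enum: "bij_betw (\<lambda>x. (s x, t x)) {..<N} D"
    and D_sub: "D \<subseteq> {1..n} \<times> {1..n}"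
    and D_less: "(i, j) \<in> D \<Longrightarrow> i < j"
    and D_trans: "(i, p) \<in> D \<Longrightarrow> (p, j) \<in> D \<Longrightarrow> (i, j) \<in> D"
begin

text \<open>The labels of the Taylor complex of the bipartite ideal, of its specialization, and of the Taylor
complex of the nonbipartite ideal. In \<open>sp_label\<close> a vertex that is both a source and a target has
exponent 2, whereas it has exponent 1 in \<open>nonbip_label\<close>.\<close>

definition "bip_label A = var_prod (s ` A <+> t ` A)"
definition "sp_label A = var_prod (s ` A) + var_prod (t ` A)"
definition "nonbip_label A = var_prod (s ` A \<union> t ` A)"

lemma edge_in: "x < N \<Longrightarrow> (s x, t x) \<in> D"
  using enum by (auto simp: bij_betw_def)

lemma edge_less: "x < N \<Longrightarrow> s x < t x"
  using edge_in D_less by blast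

lemma edge_range: "x < N \<Longrightarrow> s x \<in> {1..n} \<and> t x \<in> {1..n}"
  using edge_in D_sub by blast

lemma edge_inj: "x < N \<Longrightarrow> y < N \<Longrightarrow> s x = s y \<Longrightarrow> t x = t y \<Longrightarrow> x = y"
  using enum by (auto simp: bij_betw_def inj_on_def)

lemma edge_surj: "(i, j) \<in> D \<Longrightarrow> \<exists>x<N. s x = i \<and> t x = j"
  using enum by (fastforce simp: bij_betw_def)

lemma D_eq: "D = (\<lambda>x. (s x, t x)) ` {..<N}"
  using enum by (simp add: bij_betw_def)

lemma finite_st: "A \<subseteq> {..<N} \<Longrightarrow> finite (s ` A)" "A \<subseteq> {..<N} \<Longrightarrow> finite (t ` A)"
  by (auto dest: finite_subset)

lemma bip_simplex: "labelled_simplex (K :: 'k::field itself) ({1..n} <+> {1..n}) N bip_label"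
proof -
  have "inj_on (\<lambda>x. {Inl (s x), Inr (t x)} :: (nat + nat) set) {..<N}"
    by (rule inj_onI) (auto simp: doubleton_eq_iff intro: edge_inj)
  then have "labelled_simplex K ({1..n} <+> {1..n}) N (\<lambda>A. var_prod (\<Union>x\<in>A. {Inl (s x), Inr (t x)}))"
    by (intro taylor_simplex) (use edge_range in auto)
  moreover have "(\<Union>x\<in>A. {Inl (s x), Inr (t x)}) = s ` A <+> t ` A" for A by auto
  ultimately show ?thesis by (simp add: bip_label_def[abs_def])
qed

lemma nonbip_simplex: "labelled_simplex (K :: 'k::field itself) {1..n} N nonbip_label"
proof -
  have "inj_on (\<lambda>x. {s x, t x}) {..<N}"
  proof (rule inj_onI)
    fix x y assume "x \<in> {..<N}" "y \<in> {..<N}" "{s x, t x} = {s y, t y}"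
    then show "x = y" using edge_less[of x] edge_less[of y] by (auto simp: doubleton_eq_iff intro: edge_inj)
  qed
  then have "labelled_simplex K {1..n} N (\<lambda>A. var_prod (\<Union>x\<in>A. {s x, t x}))"
    by (intro taylor_simplex) (use edge_range in auto)
  moreover have "(\<Union>x\<in>A. {s x, t x}) = s ` A \<union> t ` A" for A by auto
  ultimately show ?thesis by (simp add: nonbip_label_def[abs_def])
qed

lemma lookup_sp_label: "A \<subseteq> {..<N} \<Longrightarrow>
    Poly_Mapping.lookup (sp_label A) v = of_bool (v \<in> s ` A) + of_bool (v \<in> t ` A)"
  by (simp add: sp_label_def lookup_add lookup_var_prod finite_st)

text \<open>The label of \<open>A\<close> divides \<open>\<alpha>\<close> if and only if all sources and targets have a positive exponent in \<open>\<alpha>\<close> and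
those with exponent 1 do not have both roles. This turns the acyclicity condition into the one for
transitive relations.\<close>

lemma sp_simplex: "labelled_simplex (K :: 'k::field itself) {1..n} N sp_label"
proof
  show "mono_dvd (sp_label A) (sp_label B)" if AB: "A \<subseteq> B" "B \<subseteq> {..<N}" for A B
  proof -
    have "A \<subseteq> {..<N}" using AB by blast
    then show ?thesis using AB by (auto simp: mono_dvd_def lookup_sp_label intro!: add_mono)
  qed
  show "sp_label {} = 0" by (simp add: sp_label_def var_prod_def)
  show "Poly_Mapping.keys (sp_label A) \<subseteq> {1..n}" if A: "A \<subseteq> {..<N}" for A
    using edge_range A by (auto simp: sp_label_def keys_add_nat keys_var_prod finite_st)
  show "acyclic_complex K N {A. A \<subseteq> {..<N} \<and> mono_dvd (sp_label A) \<alpha>}"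
    if x: "x < N" "mono_dvd (sp_label {x}) \<alpha>" for x \<alpha>
  proof -
    define R where "R = {v. 1 \<le> Poly_Mapping.lookup \<alpha> v}"
    define W where "W = {v \<in> {1..n}. Poly_Mapping.lookup \<alpha> v \<le> 1}"
    have *: "mono_dvd (sp_label A) \<alpha> \<longleftrightarrow> A \<in> edge_sets N s t R R W" if A: "A \<subseteq> {..<N}" for A
    proof
      assume l: "mono_dvd (sp_label A) \<alpha>"
      then have le: "of_bool (v \<in> s ` A) + of_bool (v \<in> t ` A) \<le> Poly_Mapping.lookup \<alpha> v" for v
        by (simp add: mono_dvd_def lookup_sp_label[OF A])
      have "s a \<in> R \<and> t a \<in> R" if "a \<in> A" for a
        using le[of "s a"] le[of "t a"] that by (auto simp: R_def of_bool_def split: if_splits)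
      moreover have "s a \<notin> W" if "a \<in> A" "b \<in> A" "s a = t b" for a b
      proof -
        have "s a \<in> s ` A" "s a \<in> t ` A" using imageI[OF that(1), of s] imageI[OF that(2), of t] that(3) by simp_all
        then show ?thesis using le[of "s a"] by (auto simp: W_def)
      qed
      ultimately show "A \<in> edge_sets N s t R R W" using A by (auto simp: edge_sets_def)
    next
      assume e: "A \<in> edge_sets N s t R R W"
      have "of_bool (v \<in> s ` A) + of_bool (v \<in> t ` A) \<le> Poly_Mapping.lookup \<alpha> v" for v
      proof (cases "v \<in> s ` A \<and> v \<in> t ` A")
        case True
        then obtain a b where ab: "a \<in> A" "v = s a" "b \<in> A" "v = t b" by blast
        then have "s a \<notin> W" using e unfolding edge_sets_def mem_Collect_eq by metis
        then show ?thesis using ab True edge_range[of a] A by (auto simp: W_def)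
      next
        case False
        then show ?thesis using e by (auto simp: edge_sets_def R_def)
      qed
      then show "mono_dvd (sp_label A) \<alpha>" by (simp add: mono_dvd_def lookup_sp_label[OF A])
    qed
    then have "{A. A \<subseteq> {..<N} \<and> mono_dvd (sp_label A) \<alpha>} = edge_sets N s t R R W"
      by (auto simp: edge_sets_def)
    moreover have "acyclic_complex K N (edge_sets N s t R R W)"
    proof (rule acyclic_edge_sets)
      show "finite W" by (simp add: W_def)
      show "\<exists>z<N. s z = s x \<and> t z = t y" if "x < N" "y < N" "t x = s y" for x y
        using edge_surj[OF D_trans[of "s x" "s y" "t y"]] edge_in[of x] edge_in[of y] that by auto
      show "s x \<noteq> t x" if "x < N" for x using edge_less[OF that] by simp
      have "{x} \<in> edge_sets N s t R R W" using x * by simp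
      then show "\<exists>x<N. s x \<in> R \<and> t x \<in> R" using x(1) by (auto simp: edge_sets_def)
    qed
    ultimately show ?thesis by simp
  qed
  show "inj_on (\<lambda>x. sp_label {x}) {..<N}"
  proof (rule inj_onI)
    fix x y assume xy: "x \<in> {..<N}" "y \<in> {..<N}" "sp_label {x} = sp_label {y}"
    have "Poly_Mapping.keys (sp_label {x}) = Poly_Mapping.keys (sp_label {y})" using xy by simp
    then have "{s x, t x} = {s y, t y}" by (simp add: sp_label_def keys_add_nat keys_var_prod insert_commute)
    then show "x = y" using edge_less[of x] edge_less[of y] xy by (auto simp: doubleton_eq_iff intro: edge_inj)
  qed
qed

lemma mvar_mult: "mvar a * mvar b = (Poly_Mapping.single (Poly_Mapping.single a 1 + Poly_Mapping.single b 1) 1 :: ('v, 'k::field) mpoly)"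
  by (simp add: mvar_def mult_single)

lemma bip_ideal_labels:
  "gen_ideal ({1..n} <+> {1..n}) ((\<lambda>x. Poly_Mapping.single (bip_label {x}) (1::'k::field)) ` {..<N}) = bip_ideal n D"
proof -
  have "(\<lambda>x. Poly_Mapping.single (bip_label {x}) (1::'k)) ` {..<N} = (\<lambda>(i, j). mvar (Inl i) * mvar (Inr j)) ` D"
    unfolding D_eq image_image
    by (rule image_cong) (simp_all add: bip_label_def mvar_mult var_prod_def sum.Plus)
  then show ?thesis by (simp add: bip_ideal_def)
qed

lemma sp_ideal_labels:
  "gen_ideal {1..n} ((\<lambda>x. Poly_Mapping.single (sp_label {x}) (1::'k::field)) ` {..<N}) = nonbip_ideal n D"
proof -
  have "(\<lambda>x. Poly_Mapping.single (sp_label {x}) (1::'k)) ` {..<N} = (\<lambda>(i, j). mvar i * mvar j) ` D"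
    unfolding D_eq image_image
    by (rule image_cong) (simp_all add: sp_label_def mvar_mult var_prod_def)
  then show ?thesis by (simp add: nonbip_ideal_def)
qed

lemma nonbip_ideal_labels:
  "gen_ideal {1..n} ((\<lambda>x. Poly_Mapping.single (nonbip_label {x}) (1::'k::field)) ` {..<N}) = nonbip_ideal n D"
proof -
  have "nonbip_label {x} = sp_label {x}" if "x < N" for x
    using edge_less[OF that] by (simp add: nonbip_label_def sp_label_def var_prod_def add.commute)
  then have "(\<lambda>x. Poly_Mapping.single (nonbip_label {x}) (1::'k)) ` {..<N} =
      (\<lambda>x. Poly_Mapping.single (sp_label {x}) (1::'k)) ` {..<N}" by (intro image_cong) simp_all
  then show ?thesis using sp_ideal_labels by simp
qed

lemma bip_resolution:
  "graded_free_resolution ({1..n} <+> {1..n}) deg (bip_ideal n D) (labelled_complex deg N bip_label :: (nat + nat, 'w, 'k::field) free_complex)"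
  by (rule labelled_simplex.labelled_resolution[OF bip_simplex, unfolded bip_ideal_labels])

lemma sp_resolution:
  "graded_free_resolution {1..n} deg (nonbip_ideal n D) (labelled_complex deg N sp_label :: (nat, 'w, 'k::field) free_complex)"
  by (rule labelled_simplex.labelled_resolution[OF sp_simplex, unfolded sp_ideal_labels])

lemma nonbip_resolution:
  "graded_free_resolution {1..n} deg (nonbip_ideal n D) (labelled_complex deg N nonbip_label :: (nat, 'w, 'k::field) free_complex)"
  by (rule labelled_simplex.labelled_resolution[OF nonbip_simplex, unfolded nonbip_ideal_labels])

lemma face_sub: "b < card (faces N i) \<Longrightarrow> face N i b \<subseteq> {..<N}"
  using face_in by (fastforce simp: faces_def)

lemma bdeg_labelled: "b < rk (labelled_complex deg N m) i \<Longrightarrow>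
    bdeg (labelled_complex deg N m) i b = mon_degree deg (m (face N (Suc i) b))"
  by (simp add: labelled_complex_def simplex_deg_def)

lemma rk_labelled: "rk (labelled_complex deg N m) i = card (faces N (Suc i))"
  by (simp add: labelled_complex_def)

text \<open>The specialized Taylor complex resolves the nonbipartite ideal, and the Taylor complex itself the
bipartite one. Tensored with \<open>k\<close> they coincide: for \<open>B \<subseteq> A\<close> the exponents of the label of \<open>A\<close> are at
least those of \<open>B\<close> for sources and for targets separately, so equal sums force equal summands.\<close>

theorem beta_nonbip_eq_sp: "beta_nonbip TYPE('k::field) n D i \<alpha> = beta_bip_sp TYPE('k) n D i \<alpha>"
proof -
  let ?F = "labelled_complex fine_deg N sp_label :: (nat, nat, 'k) free_complex"
  let ?G = "labelled_complex sp_deg N bip_label :: (nat + nat, nat, 'k) free_complex"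
  have rk: "rk ?F = rk ?G" by (simp add: labelled_complex_def)
  have deg: "bdeg ?F j b = bdeg ?G j b" if "b < rk ?F j" for j b
  proof -
    have A: "face N (Suc j) b \<subseteq> {..<N}" using that face_sub by (simp add: rk_labelled)
    have "b < rk ?G j" using that by (simp add: rk)
    then show ?thesis
      unfolding bdeg_labelled[OF that] using A
      by (simp add: bdeg_labelled bip_label_def sp_label_def mon_degree_add mon_degree_fine_var_prod mon_degree_sp_var_prod finite_st)
  qed
  have coeff: "Poly_Mapping.lookup (dif ?F j a b) 0 = Poly_Mapping.lookup (dif ?G j a b) 0"
    if ab: "a < rk ?F j" "b < rk ?F (Suc j)" for j a b
  proof -
    let ?B = "face N (Suc j) a" and ?A = "face N (Suc (Suc j)) b"
    have fin: "?A \<subseteq> {..<N}" "?B \<subseteq> {..<N}" using ab face_sub by (simp_all add: rk_labelled)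
    have "sp_label ?A - sp_label ?B = 0 \<longleftrightarrow> bip_label ?A - bip_label ?B = 0" if BA: "?B \<subseteq> ?A"
    proof -
      have z: "p - q = 0 \<longleftrightarrow> mono_dvd p q" for p q :: "'v \<Rightarrow>\<^sub>0 nat"
        by (auto simp: poly_mapping_eq_iff fun_eq_iff lookup_minus mono_dvd_def)
      have sub: "s ` ?B \<subseteq> s ` ?A" "t ` ?B \<subseteq> t ` ?A" using BA by blast+
      have "mono_dvd (sp_label ?A) (sp_label ?B) \<longleftrightarrow> s ` ?A \<subseteq> s ` ?B \<and> t ` ?A \<subseteq> t ` ?B"
      proof
        assume l: "mono_dvd (sp_label ?A) (sp_label ?B)"
        have le: "(of_bool (v \<in> s ` ?A) :: nat) + of_bool (v \<in> t ` ?A) \<le> of_bool (v \<in> s ` ?B) + of_bool (v \<in> t ` ?B)" for v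
          using l fin by (simp add: mono_dvd_def lookup_sp_label)
        have "v \<in> s ` ?B" if "v \<in> s ` ?A" for v
          using le[of v] that sub by (cases "v \<in> s ` ?B"; cases "v \<in> t ` ?A"; cases "v \<in> t ` ?B") auto
        moreover have "v \<in> t ` ?B" if "v \<in> t ` ?A" for v
          using le[of v] that sub by (cases "v \<in> t ` ?B"; cases "v \<in> s ` ?A"; cases "v \<in> s ` ?B") auto
        ultimately show "s ` ?A \<subseteq> s ` ?B \<and> t ` ?A \<subseteq> t ` ?B" by blast
      next
        assume "s ` ?A \<subseteq> s ` ?B \<and> t ` ?A \<subseteq> t ` ?B"
        then show "mono_dvd (sp_label ?A) (sp_label ?B)"
          using fin sub by (metis mono_dvd_def le_refl sp_label_def subset_antisym)
      qed
      moreover have "mono_dvd (bip_label ?A) (bip_label ?B) \<longleftrightarrow> s ` ?A \<subseteq> s ` ?B \<and> t ` ?A \<subseteq> t ` ?B"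
      proof -
        have "X <+> Y \<subseteq> X' <+> Y' \<longleftrightarrow> X \<subseteq> X' \<and> Y \<subseteq> Y'" for X X' Y Y' :: "nat set" by blast
        then show ?thesis
          unfolding bip_label_def using fin by (simp add: mono_dvd_var_prod_var_prod finite_st)
      qed
      ultimately show ?thesis by (simp add: z)
    qed
    then show ?thesis
      using incidence_nonzero[of N ?B ?A]
      by (cases "incidence N ?B ?A = (0::'k)")
        (auto simp: labelled_complex_def simplex_dif_def lookup_single when_def)
  qed
  have "beta_nonbip TYPE('k) n D i \<alpha> = fs.dim (tor_cycles ?F i \<alpha>) - fs.dim (tor_boundaries ?F i \<alpha>)"
    unfolding beta_nonbip_def by (rule betti_eq[OF sp_resolution])
  also have "\<dots> = fs.dim (tor_cycles ?G i \<alpha>) - fs.dim (tor_boundaries ?G i \<alpha>)"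
    using tor_cong[OF rk deg coeff] by simp
  also have "\<dots> = beta_bip_sp TYPE('k) n D i \<alpha>"
    unfolding beta_bip_sp_def by (rule betti_eq[OF bip_resolution, symmetric])
  finally show ?thesis .
qed

text \<open>Read off from the Taylor complex of the nonbipartite ideal, all of whose labels are squarefree.\<close>

lemma beta_nonbip_squarefree:
  assumes "\<And>Z. \<alpha> \<noteq> set_deg Z"
  shows "beta_nonbip TYPE('k::field) n D i \<alpha> = 0"
proof -
  let ?F = "labelled_complex fine_deg N nonbip_label :: (nat, nat, 'k) free_complex"
  have "bdeg ?F i b \<noteq> \<alpha>" if "b < rk ?F i" for b
  proof -
    have "face N (Suc i) b \<subseteq> {..<N}" using that face_sub by (simp add: rk_labelled)
    then show ?thesis
      using assms that by (simp add: bdeg_labelled nonbip_label_def mon_degree_fine_var_prod finite_st) metis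
  qed
  then have "fs.dim (tor_cycles ?F i \<alpha>) = 0" by (rule tor_zero_outside)
  then show ?thesis
    unfolding beta_nonbip_def betti_eq[OF nonbip_resolution] by simp
qed

text \<open>The basis elements of the Taylor complex of the bipartite ideal have degrees \<open>X \<squnion> Y\<close>, whose coarse
degree is the sum of the indicator vectors of \<open>X\<close> and \<open>Y\<close>.\<close>

theorem beta_sp_eq_sum:
  "beta_bip_sp TYPE('k::field) n D i \<alpha> =
    (\<Sum>(X, Y) \<in> {(X, Y). X \<subseteq> {1..n} \<and> Y \<subseteq> {1..n} \<and> set_deg X + set_deg Y = \<alpha>}.
       beta_bip TYPE('k) n D i (set_deg (X <+> Y)))"
proof -
  let ?F = "labelled_complex fine_deg N bip_label :: (nat + nat, nat + nat, 'k) free_complex"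
  let ?G = "labelled_complex sp_deg N bip_label :: (nat + nat, nat, 'k) free_complex"
  define P where "P = {(X, Y). X \<subseteq> {1..n} \<and> Y \<subseteq> {1..n} \<and> set_deg X + set_deg Y = \<alpha>}"
  define h :: "nat set \<times> nat set \<Rightarrow> nat + nat \<Rightarrow> int" where "h = (\<lambda>(X, Y). set_deg (X <+> Y))"
  have "P \<subseteq> Pow {1..n} \<times> Pow {1..n}" by (auto simp: P_def)
  then have fin: "finite P" by (rule finite_subset) simp
  have plus_inj: "X <+> Y = X' <+> Y' \<longleftrightarrow> X = X' \<and> Y = Y'" for X X' Y Y' :: "nat set" by blast
  have inj: "inj_on h P" by (rule inj_onI) (auto simp: h_def set_deg_inj plus_inj)
  have same: "rk ?G = rk ?F" "dif ?G = dif ?F" by (simp_all add: labelled_complex_def)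
  have deg: "bdeg ?G j b = \<alpha> \<longleftrightarrow> bdeg ?F j b \<in> h ` P" if b: "b < rk ?F j" for j b
  proof -
    let ?A = "face N (Suc j) b"
    have A: "?A \<subseteq> {..<N}" using b face_sub by (simp add: rk_labelled)
    have bG: "b < rk ?G j" using b by (simp add: same)
    have "bdeg ?G j b = set_deg (s ` ?A) + set_deg (t ` ?A)"
      unfolding bdeg_labelled[OF bG] using A by (simp add: bip_label_def mon_degree_sp_var_prod finite_st)
    moreover have "bdeg ?F j b = h (s ` ?A, t ` ?A)"
      using b A by (simp add: bdeg_labelled bip_label_def mon_degree_fine_var_prod finite_st h_def)
    moreover have "h (X, Y) \<in> h ` P \<longleftrightarrow> (X, Y) \<in> P" for X Y
      by (auto simp: h_def set_deg_inj plus_inj)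
    moreover have "s ` ?A \<subseteq> {1..n}" "t ` ?A \<subseteq> {1..n}" using A edge_range by blast+
    ultimately show ?thesis by (simp add: P_def)
  qed
  have "beta_bip_sp TYPE('k) n D i \<alpha> = fs.dim (tor_cycles ?G i \<alpha>) - fs.dim (tor_boundaries ?G i \<alpha>)"
    unfolding beta_bip_sp_def by (rule betti_eq[OF bip_resolution])
  also have "\<dots> = (\<Sum>\<gamma>\<in>h ` P. fs.dim (tor_cycles ?F i \<gamma>) - fs.dim (tor_boundaries ?F i \<gamma>))"
    by (rule tor_dim_coarsen[OF bip_resolution same _ deg]) (simp_all add: fin)
  also have "\<dots> = (\<Sum>\<gamma>\<in>h ` P. beta_bip TYPE('k) n D i \<gamma>)"
    unfolding beta_bip_def betti_eq[OF bip_resolution] ..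
  also have "\<dots> = (\<Sum>p\<in>P. beta_bip TYPE('k) n D i (h p))"
    by (simp add: sum.reindex[OF inj])
  finally show ?thesis by (simp add: P_def h_def case_prod_unfold)
qed

end

theorem theorem2p21:
  fixes n :: nat and D :: "(nat \<times> nat) set"
  assumes "shifted_skew_diagram D"
    and "D \<subseteq> {1..n} \<times> {1..n}"
  shows "(\<forall>i. \<forall>\<alpha> :: nat \<Rightarrow> int. (\<forall>v. v \<notin> {1..n} \<longrightarrow> \<alpha> v = 0) \<longrightarrow>
            beta_nonbip TYPE('k::field) n D i \<alpha> = beta_bip_sp TYPE('k) n D i \<alpha>) \<and>
         (\<forall>i. \<forall>X Y. X \<subseteq> {1..n} \<longrightarrow> Y \<subseteq> {1..n} \<longrightarrow> X \<inter> Y \<noteq> {} \<longrightarrow>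
            beta_bip TYPE('k) n D i (set_deg (X <+> Y)) = 0) \<and>
         (\<forall>i. \<forall>Z. Z \<subseteq> {1..n} \<longrightarrow>
            beta_nonbip TYPE('k) n D i (set_deg Z) =
              (\<Sum>(X, Y) \<in> {(X, Y). X \<subseteq> {1..n} \<and> Y \<subseteq> {1..n} \<and> X \<inter> Y = {} \<and> X \<union> Y = Z}.
                 beta_bip TYPE('k) n D i (set_deg (X <+> Y))))"
proof -
  have finD: "finite D" using assms(2) by (rule finite_subset) simp
  obtain ed where ed: "bij_betw ed {..<card D} D"
    using ex_bij_betw_nat_finite[OF finD] by (auto simp: atLeast0LessThan)
  interpret transitive_edges n D "card D" "fst \<circ> ed" "snd \<circ> ed"
    by unfold_locales
      (use ed assms(2) shifted_skew_diagram_less[OF assms(1)] shifted_skew_diagram_trans[OF assms(1)]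
        in \<open>simp_all add: comp_def\<close>)
  show ?thesis
  proof (intro conjI allI impI)
    fix i and \<alpha> :: "nat \<Rightarrow> int"
    show "beta_nonbip TYPE('k) n D i \<alpha> = beta_bip_sp TYPE('k) n D i \<alpha>" by (rule beta_nonbip_eq_sp)
  next
    fix i X Y assume XY: "X \<subseteq> {1..n}" "Y \<subseteq> {1..n}" "X \<inter> Y \<noteq> {}"
    define \<alpha> where "\<alpha> = set_deg X + (set_deg Y :: nat \<Rightarrow> int)"
    define P where "P = {(X, Y). X \<subseteq> {1..n} \<and> Y \<subseteq> {1..n} \<and> set_deg X + set_deg Y = \<alpha>}"
    \<comment> \<open>A common element gives \<open>\<alpha>\<close> an entry 2, so the sum over all pairs in \<open>P\<close> vanishes.\<close>
    obtain v where "v \<in> X" "v \<in> Y" using XY by blast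
    then have "\<alpha> v = 2" by (simp add: \<alpha>_def set_deg_def)
    then have "\<alpha> \<noteq> set_deg Z" for Z by (cases "v \<in> Z") (auto simp: set_deg_def)
    then have "beta_nonbip TYPE('k) n D i \<alpha> = 0" by (rule beta_nonbip_squarefree)
    then have "(\<Sum>(X, Y) \<in> P. beta_bip TYPE('k) n D i (set_deg (X <+> Y))) = 0"
      unfolding beta_nonbip_eq_sp beta_sp_eq_sum P_def .
    moreover have "finite P"
      by (rule finite_subset[of _ "Pow {1..n} \<times> Pow {1..n}"]) (auto simp: P_def)
    moreover have "(X, Y) \<in> P" using XY by (simp add: P_def \<alpha>_def)
    ultimately show "beta_bip TYPE('k) n D i (set_deg (X <+> Y)) = 0" by force
  next
    fix i and Z :: "nat set" assume "Z \<subseteq> {1..n}"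
    have "set_deg X + set_deg Y = (set_deg Z :: nat \<Rightarrow> int) \<longleftrightarrow> X \<inter> Y = {} \<and> X \<union> Y = Z" for X Y :: "nat set"
    proof -
      have "set_deg X v + set_deg Y v = set_deg Z v \<longleftrightarrow> \<not> (v \<in> X \<and> v \<in> Y) \<and> (v \<in> X \<or> v \<in> Y \<longleftrightarrow> v \<in> Z)" for v
        by (simp add: set_deg_def of_bool_def)
      then show ?thesis unfolding fun_eq_iff plus_fun_apply by blast
    qed
    then show "beta_nonbip TYPE('k) n D i (set_deg Z) =
        (\<Sum>(X, Y) \<in> {(X, Y). X \<subseteq> {1..n} \<and> Y \<subseteq> {1..n} \<and> X \<inter> Y = {} \<and> X \<union> Y = Z}.
           beta_bip TYPE('k) n D i (set_deg (X <+> Y)))"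
      unfolding beta_nonbip_eq_sp beta_sp_eq_sum by simp
  qed
qed

end
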